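(* For every $f\in\mathcal Q^n$, $$M(f)\ge2\kappa_n^{-1/n}\,\|f\|_n.$$ Equality is attained if and only if $f$ is the characteristic function of an arbitrary ball.
   Context: $\mathcal Q^n$ is the set of functions $f:\mathbb R^n\to[0,+\infty]$ that are not identically zero, quasi-concave (all sets $\{f\ge t\}$ convex), upper semicontinuous, and satisfy $\lim_{\|x\|\to\infty}f(x)=0$. For a non-empty compact convex $K\subset\mathbb R^n$, the quermassintegrals $W_i(K)$, $i=0,\dots,n$, are defined by $\mathcal H^n(K+\rho B)=\sum_{i=0}^n\binom ni W_i(K)\rho^i$ for all $\rho\ge0$ ($B$ the unit Euclidean ball, $\mathcal H^n$ Lebesgue measure); empty level sets contribute $0$. $\kappa_n=\mathcal H^n(B)$. The mean width of $f\in\mathcal Q^n$ is $M(f)=2\kappa_n^{-1}W_{n-1}(f)$, where $W_{n-1}(f)=\int_0^{+\infty}W_{n-1}(\{f\ge t\})\,dt$. $\|f\|_n=(\int_{\mathbb R^n}f^n\,dx)^{1/n}$.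
   Formalization: Equality also holds for c·1_ball, for every f when n=1, when the norm is infinite, and if 1_ball is raised at one point; so "only if" is proved for n≥2 and finite norm, giving f=c·1_ball (c>0) up to a larger value at one point of the ball. *)

theory Defs
  imports "HOL-Analysis.Analysis"
begin

text \<open>
  \<open>\<real>\<^sup>n\<close> is an arbitrary type \<open>'a :: euclidean_space\<close> with \<open>n = DIM('a) \<ge> 1\<close>; functions with
  values in \<open>[0, +\<infinity>]\<close> have type \<open>'a \<Rightarrow> ennreal\<close>.
\<close>

definition quasi_concave :: "('a::euclidean_space \<Rightarrow> ennreal) \<Rightarrow> bool" where
  "quasi_concave f \<longleftrightarrow> (\<forall>t. convex {x. t \<le> f x})"

definition upper_semicontinuous :: "('a::euclidean_space \<Rightarrow> ennreal) \<Rightarrow> bool" where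
  "upper_semicontinuous f \<longleftrightarrow> (\<forall>x. Limsup (at x) f \<le> f x)"

definition Qn :: "('a::euclidean_space \<Rightarrow> ennreal) set" where
  "Qn = {f. f \<noteq> (\<lambda>_. 0) \<and> quasi_concave f \<and> upper_semicontinuous f \<and> (f \<longlongrightarrow> 0) at_infinity}"

text \<open>
  The coefficients of the Steiner polynomial of \<open>K\<close>; the indices \<open>i > n\<close>, on which the polynomial
  does not depend, are set to 0 so that the coefficient sequence is unique. The sum
  \<open>K + cball 0 \<rho>\<close> is the Minkowski sum.
\<close>
definition quermassintegral :: "nat \<Rightarrow> 'a::euclidean_space set \<Rightarrow> real" where
  "quermassintegral i K =
     (if K = {} then 0
      else (THE w :: nat \<Rightarrow> real.
              (\<forall>j > DIM('a). w j = 0) \<and>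
              (\<forall>\<rho> \<ge> 0. measure lborel (K + cball 0 \<rho>) =
                 (\<Sum>j = 0..DIM('a). real (DIM('a) choose j) * w j * \<rho> ^ j))) i)"

definition quermassintegral_fun :: "nat \<Rightarrow> ('a::euclidean_space \<Rightarrow> ennreal) \<Rightarrow> ennreal" where
  "quermassintegral_fun i f =
     (\<integral>\<^sup>+ t \<in> {0<..}. ennreal (quermassintegral i {x. ennreal t \<le> f x}) \<partial>lborel)"

text \<open>\<open>\<kappa>\<^sub>n\<close>; the type argument carries the dimension.\<close>
definition kappa :: "'a::euclidean_space itself \<Rightarrow> real" where
  "kappa _ = measure lborel (cball (0::'a) 1)"

definition mean_width :: "('a::euclidean_space \<Rightarrow> ennreal) \<Rightarrow> ennreal" where
  "mean_width f = ennreal (2 / kappa TYPE('a)) * quermassintegral_fun (DIM('a) - 1) f"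

definition ennreal_root :: "nat \<Rightarrow> ennreal \<Rightarrow> ennreal" where
  "ennreal_root n x = (if x = \<infinity> then \<infinity> else ennreal (root n (enn2real x)))"

definition norm_n :: "('a::euclidean_space \<Rightarrow> ennreal) \<Rightarrow> ennreal" where
  "norm_n f = ennreal_root DIM('a) (\<integral>\<^sup>+ x. f x ^ DIM('a) \<partial>lborel)"

end

theory Submission
  imports Defs
begin

text \<open>
  Every superlevel set of \<open>f\<close> satisfies the Urysohn inequality, and integrating over the levels reduces
  the claim to Minkowski's integral inequality for \<open>f = \<integral> 1\<^bsub>{f \<ge> t}\<^esub> dt\<close>. The latter follows, with its
  equality case, from \<open>f\<^sup>n = f\<^bsup>n-1\<^esup> \<integral> 1\<^bsub>{f \<ge> t}\<^esub> dt\<close>, Fubini and Young's inequality on each level.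

  The Steiner polynomial exists because \<open>\<rho> \<mapsto> vol (K + \<rho>I)\<close> is affine for a segment \<open>I\<close>, hence
  \<open>vol (K + \<rho>Z)\<close> is a polynomial for a zonotope \<open>Z\<close>, and the ball is a limit of zonotopes. Comparing the
  coefficients of \<open>\<rho>\<^bsup>n-1\<^esup>\<close> in the Brunn--Minkowski inequality for \<open>K + \<rho>B\<close> gives Urysohn's inequality,
  and equality in it forces Brunn--Minkowski equality for \<open>K\<close> and \<open>B\<close>. Cutting \<open>K\<close> and \<open>B\<close> by parallel
  hyperplanes in equal volume fractions then shows that support points satisfy \<open>p(v) \<bullet> u = p(w) \<bullet> u\<close>
  whenever \<open>v \<bullet> u = w \<bullet> u\<close>, so \<open>p(v) - p(w)\<close> is parallel to \<open>v - w\<close>; any three points of the sphere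
  being affinely independent, \<open>p\<close> is a homothety and \<open>K\<close> is a ball.
\<close>

section \<open>The Brunn--Minkowski inequality\<close>

text \<open>Equality holds for more than indicators of balls. A positive multiple of such an
  indicator attains it too, and raising the value at a single point \<open>p\<close> of the ball
  changes neither side, because a point has volume 0 and mean width 0; hence the shape of
  \<open>corollary6p3\<close>. If \<open>DIM('a) = 1\<close>, both sides are the integral of
  \<open>f\<close>, and an infinite norm makes both sides infinite, so the converse is claimed only
  outside these cases.

  The integral argument yields level equalities only for almost every \<open>t\<close> and values of
  \<open>f\<close> only for almost every \<open>x\<close>. The levels are compact and convex, and a
  closed subset of full measure in a convex body is the whole body, which turns these statements
  into exact ones. Only levels of volume 0 escape; equality in Urysohn's inequality makes such a
  level a ball of radius 0, and this is where the exceptional point \<open>p\<close> comes from.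

  The exponent \<open>n\<close> makes the two inequalities fit together: the \<open>n\<close>-th
  root of the volume of a level is both the norm of its indicator and a multiple of the radius that
  Urysohn's inequality compares with the mean width.\<close>

abbreviation vol :: "'a::euclidean_space set \<Rightarrow> real" where
  "vol \<equiv> measure lborel"

section \<open>Volumes of compact sets, Minkowski sums and halfspace cuts\<close>

lemma compact_set_plus:
  fixes A B :: "'a::real_normed_vector set"
  assumes "compact A" "compact B"
  shows "compact (A + B)"
proof -
  have "A + B = {x + y | x y. x \<in> A \<and> y \<in> B}"
    by (auto simp: set_plus_def)
  then show ?thesis using compact_sums[OF assms] by simp
qed

lemma vol_mono_compact:
  fixes S T :: "'a::euclidean_space set"
  assumes "S \<subseteq> T" "compact T" "S \<in> sets borel"
  shows "vol S \<le> vol T"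
  using assms emeasure_compact_finite[of T]
  by (intro measure_mono_fmeasurable) (auto simp: fmeasurable_def compact_imp_closed)

lemma vol_translation:
  fixes S :: "'a::euclidean_space set"
  assumes "compact S"
  shows "vol ((+) a ` S) = vol S"
proof -
  have "compact ((+) a ` S)" using assms by (rule compact_translation)
  then show ?thesis
    using assms measure_translation[of a S] by (simp add: compact_imp_closed borel_closed)
qed

lemma vol_scaleR:
  fixes S :: "'a::euclidean_space set"
  assumes "compact S"
  shows "vol ((*\<^sub>R) c ` S) = \<bar>c\<bar> ^ DIM('a) * vol S"
proof -
  have "compact ((*\<^sub>R) c ` S)" using assms by (rule compact_scaling)
  then show ?thesis
    using assms measure_lebesgue_affine[of c 0 S]
    by (simp add: compact_imp_closed borel_closed)
qed

lemma vol_Un_negligible: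
  fixes S T :: "'a::euclidean_space set"
  assumes "compact S" "compact T" "negligible (S \<inter> T)"
  shows "vol (S \<union> T) = vol S + vol T"
proof -
  have "measure lebesgue (S \<union> T) = measure lebesgue S + measure lebesgue T"
    using assms by (subst measure_Un3) (auto simp: lmeasurable_compact negligible_imp_measure0)
  then show ?thesis
    using assms by (simp add: compact_imp_closed borel_closed)
qed

lemma vol_negligible:
  fixes S :: "'a::euclidean_space set"
  assumes "compact S" "negligible S"
  shows "vol S = 0"
  using assms negligible_imp_measure0[of S] by (simp add: compact_imp_closed borel_closed)

lemma negligible_hyperplane':
  fixes u :: "'a::euclidean_space"
  assumes "u \<noteq> 0" shows "negligible {x. x \<bullet> u = b}"
  using negligible_hyperplane[of u b] assms by (simp add: inner_commute)

lemma compact_Int_halfspace: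
  fixes u :: "'a::euclidean_space"
  assumes "compact S"
  shows "compact (S \<inter> {x. x \<bullet> u \<le> d})" "compact (S \<inter> {x. x \<bullet> u \<ge> d})"
  using assms closed_halfspace_le[of u d] closed_halfspace_ge[of d u]
  by (auto intro!: compact_Int_closed simp: inner_commute)

lemma vol_halfspace_split:
  fixes u :: "'a::euclidean_space"
  assumes "compact S" "u \<noteq> 0"
  shows "vol S = vol (S \<inter> {x. x \<bullet> u \<le> d}) + vol (S \<inter> {x. x \<bullet> u \<ge> d})"
proof -
  have "S = (S \<inter> {x. x \<bullet> u \<le> d}) \<union> (S \<inter> {x. x \<bullet> u \<ge> d})" by auto
  moreover have "negligible ((S \<inter> {x. x \<bullet> u \<le> d}) \<inter> (S \<inter> {x. x \<bullet> u \<ge> d}))"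
    using negligible_hyperplane'[OF assms(2), of d] by (rule negligible_subset) auto
  ultimately show ?thesis
    using vol_Un_negligible compact_Int_halfspace[OF assms(1)] by metis
qed

text \<open>Off the null hyperplane at height \<open>d\<close> the indicators are eventually
  constant along a sequence tending to \<open>d\<close>, and they are dominated by the indicator of
  \<open>S\<close>.\<close>

lemma continuous_vol_halfspace:
  fixes u :: "'a::euclidean_space"
  assumes S: "compact S" and u: "u \<noteq> 0"
  shows "continuous_on UNIV (\<lambda>d. vol (S \<inter> {x. x \<bullet> u \<le> d}))"
  unfolding continuous_on_sequentially
proof (intro ballI allI impI, elim conjE)
  fix d and D :: "nat \<Rightarrow> real"
  assume D: "D \<longlonglongrightarrow> d"
  let ?f = "\<lambda>c x. indicator (S \<inter> {x. x \<bullet> u \<le> c}) x :: real"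
  have Sb: "S \<in> sets borel" using S by (simp add: compact_imp_closed borel_closed)
  have meas: "S \<inter> {x. x \<bullet> u \<le> c} \<in> sets borel" for c
    using compact_Int_halfspace[OF S] by (simp add: compact_imp_closed borel_closed)
  have null: "{x. x \<bullet> u = d} \<in> null_sets lborel"
  proof -
    have "closed {x. x \<bullet> u = d}"
      using closed_hyperplane[of u d] by (simp add: inner_commute)
    then have "{x. x \<bullet> u = d} \<in> sets lborel" by simp
    then show ?thesis
      using negligible_hyperplane'[OF u, of d] by (simp add: negligible_iff_null_sets null_sets_completion_iff)
  qed
  have "(\<lambda>i. LINT x|lborel. ?f (D i) x) \<longlonglongrightarrow> (LINT x|lborel. ?f d x)"
  proof (rule integral_dominated_convergence[where w = "indicator S"])
    show "integrable lborel (indicator S :: 'a \<Rightarrow> real)"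
      using Sb emeasure_compact_finite[OF S] by (auto simp: integrable_indicator_iff)
    show "AE x in lborel. (\<lambda>i. ?f (D i) x) \<longlonglongrightarrow> ?f d x"
      using AE_not_in[OF null]
    proof eventually_elim
      case (elim x)
      have "eventually (\<lambda>i. ?f (D i) x = ?f d x) sequentially"
      proof (cases "x \<bullet> u < d")
        case True
        then show ?thesis using order_tendstoD(1)[OF D True]
          by (auto elim!: eventually_mono simp: indicator_def)
      next
        case False
        then have "x \<bullet> u > d" using elim by auto
        then show ?thesis using order_tendstoD(2)[OF D, of "x \<bullet> u"]
          by (auto elim!: eventually_mono simp: indicator_def)
      qed
      then show ?case by (rule tendsto_eventually)
    qed
  qed (use meas in \<open>auto split: split_indicator\<close>)
  then show "((\<lambda>d. vol (S \<inter> {x. x \<bullet> u \<le> d})) \<circ> D) \<longlonglongrightarrow> vol (S \<inter> {x. x \<bullet> u \<le> d})"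
    using meas by (simp add: o_def)
qed

text \<open>The bounds on \<open>d\<close> are for later use: a cut of the unit ball between heights
  \<open>- norm u\<close> and \<open>norm u\<close> leaves two non-empty pieces even when one of
  them has volume 0, and Brunn--Minkowski needs non-empty sets.\<close>

lemma vol_halfspace_ivt:
  fixes u :: "'a::euclidean_space"
  assumes S: "compact S" and u: "u \<noteq> 0" and R: "\<And>x. x \<in> S \<Longrightarrow> \<bar>x \<bullet> u\<bar> \<le> R" "0 \<le> R"
    and s: "0 \<le> s" "s \<le> vol S"
  obtains d where "- R \<le> d" "d \<le> R" "vol (S \<inter> {x. x \<bullet> u \<le> d}) = s"
proof -
  have "S \<inter> {x. x \<bullet> u \<le> R} = S" using R by (auto simp: abs_le_iff)
  moreover have "vol (S \<inter> {x. x \<bullet> u \<le> - R}) = 0"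
  proof (rule vol_negligible)
    show "negligible (S \<inter> {x. x \<bullet> u \<le> - R})"
      using negligible_hyperplane'[OF u, of "- R"] by (rule negligible_subset) (use R in fastforce)
  qed (rule compact_Int_halfspace[OF S])
  ultimately have "\<exists>d\<ge>- R. d \<le> R \<and> vol (S \<inter> {x. x \<bullet> u \<le> d}) = s"
    using s R by (intro IVT') (auto intro!: continuous_on_subset[OF continuous_vol_halfspace[OF S u]])
  then show thesis using that by blast
qed

section \<open>Brunn--Minkowski for two boxes\<close>

text \<open>After division by the right-hand side, the arithmetic-geometric mean inequality applies
  to the ratios \<open>a i / (a i + b i)\<close> and \<open>b i / (a i + b i)\<close>, which add up
  to 1 for each \<open>i\<close>.\<close>

lemma prod_root_superadditive:
  fixes a b :: "'i \<Rightarrow> real"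
  assumes "finite S" "S \<noteq> {}" "\<And>i. i \<in> S \<Longrightarrow> a i > 0" "\<And>i. i \<in> S \<Longrightarrow> b i > 0"
  shows "root (card S) (\<Prod>i\<in>S. a i) + root (card S) (\<Prod>i\<in>S. b i) \<le> root (card S) (\<Prod>i\<in>S. a i + b i)"
proof -
  let ?n = "card S"
  have n: "?n > 0" using assms by (simp add: card_gt_0_iff)
  have pos: "a i + b i > 0" if "i \<in> S" for i using assms that by (simp add: add_pos_pos)
  have am: "root ?n (\<Prod>i\<in>S. x i) \<le> (\<Sum>i\<in>S. x i) / ?n" if "\<And>i. i \<in> S \<Longrightarrow> x i > 0" for x :: "'i \<Rightarrow> real"
  proof -
    have "(\<Prod>i\<in>S. x i) powr (1 / ?n) \<le> (\<Sum>i\<in>S. x i / ?n)"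
      using assms that by (intro arith_geom_mean) (auto simp: less_imp_le)
    moreover have "(\<Prod>i\<in>S. x i) > 0"
      using that by (intro prod_pos) auto
    ultimately show ?thesis
      using n by (simp add: root_powr_inverse sum_divide_distrib inverse_eq_divide)
  qed
  have r: "root ?n (\<Prod>i\<in>S. x i / (a i + b i)) = root ?n (\<Prod>i\<in>S. x i) / root ?n (\<Prod>i\<in>S. a i + b i)" for x
    by (simp add: prod_dividef real_root_divide)
  have "root ?n (\<Prod>i\<in>S. a i / (a i + b i)) + root ?n (\<Prod>i\<in>S. b i / (a i + b i))
     \<le> (\<Sum>i\<in>S. a i / (a i + b i)) / ?n + (\<Sum>i\<in>S. b i / (a i + b i)) / ?n"
    using assms pos by (intro add_mono am) auto
  also have "\<dots> = (\<Sum>i\<in>S. a i / (a i + b i) + b i / (a i + b i)) / ?n"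
    by (simp add: sum.distrib add_divide_distrib)
  also have "(\<Sum>i\<in>S. a i / (a i + b i) + b i / (a i + b i)) = (\<Sum>i\<in>S. 1)"
    using pos by (intro sum.cong) (simp_all add: add_divide_distrib[symmetric] less_imp_neq[symmetric])
  finally have "root ?n (\<Prod>i\<in>S. a i / (a i + b i)) + root ?n (\<Prod>i\<in>S. b i / (a i + b i)) \<le> 1"
    using n by simp
  moreover have "root ?n (\<Prod>i\<in>S. a i + b i) > 0"
    using pos n by (simp add: prod_pos)
  ultimately show ?thesis unfolding r by (simp add: add_divide_distrib[symmetric])
qed

lemma cbox_plus_superset:
  fixes a b c d :: "'a::euclidean_space"
  assumes "cbox a b \<noteq> {}" "cbox c d \<noteq> {}"
  shows "cbox (a + c) (b + d) \<subseteq> cbox a b + cbox c d"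
proof
  fix x assume x: "x \<in> cbox (a + c) (b + d)"
  \<comment> \<open>Coordinatewise, \<open>x - c\<close> is clamped to the interval of the first
    box; the remainder \<open>x - y\<close> then falls into the second.\<close>
  define y where "y = (\<Sum>i\<in>Basis. max (a \<bullet> i) (min (b \<bullet> i) (x \<bullet> i - c \<bullet> i)) *\<^sub>R i)"
  have y: "y \<bullet> i = max (a \<bullet> i) (min (b \<bullet> i) (x \<bullet> i - c \<bullet> i))" if "i \<in> Basis" for i
    using that by (simp add: y_def)
  have ab: "a \<bullet> i \<le> b \<bullet> i" "c \<bullet> i \<le> d \<bullet> i" if "i \<in> Basis" for i
    using assms that by (auto simp: box_ne_empty)
  have "y \<in> cbox a b" "x - y \<in> cbox c d"
    using x ab by (force simp: mem_box y inner_simps)+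
  then show "x \<in> cbox a b + cbox c d"
    using set_plus_intro[of y _ "x - y"] by simp
qed

lemma brunn_minkowski_cbox:
  fixes a b c d :: "'a::euclidean_space"
  assumes "vol (cbox a b) > 0" "vol (cbox c d) > 0"
  shows "(root DIM('a) (vol (cbox a b)) + root DIM('a) (vol (cbox c d))) ^ DIM('a)
           \<le> vol (cbox a b + cbox c d)"
proof -
  have ab: "a \<bullet> i < b \<bullet> i" "c \<bullet> i < d \<bullet> i" if "i \<in> Basis" for i
    using assms that by (auto simp: content_pos_lt_eq)
  have ne: "cbox a b \<noteq> {}" "cbox c d \<noteq> {}" "cbox (a + c) (b + d) \<noteq> {}"
    using ab by (auto simp: box_ne_empty less_imp_le inner_simps intro!: add_mono)
  have "root DIM('a) (vol (cbox a b)) + root DIM('a) (vol (cbox c d))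
        \<le> root DIM('a) (\<Prod>i\<in>Basis. (b \<bullet> i - a \<bullet> i) + (d \<bullet> i - c \<bullet> i))"
    unfolding content_cbox'[OF ne(1)] content_cbox'[OF ne(2)]
    using ab by (intro prod_root_superadditive) auto
  also have "(\<Prod>i\<in>Basis. (b \<bullet> i - a \<bullet> i) + (d \<bullet> i - c \<bullet> i)) = vol (cbox (a + c) (b + d))"
    unfolding content_cbox'[OF ne(3)] by (intro prod.cong) (auto simp: inner_simps)
  finally have "(root DIM('a) (vol (cbox a b)) + root DIM('a) (vol (cbox c d))) ^ DIM('a)
      \<le> root DIM('a) (vol (cbox (a + c) (b + d))) ^ DIM('a)"
    by (intro power_mono) auto
  also have "\<dots> = vol (cbox (a + c) (b + d))" by simp
  also have "\<dots> \<le> vol (cbox a b + cbox c d)"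
    using cbox_plus_superset[OF ne(1,2)] by (intro vol_mono_compact compact_set_plus) auto
  finally show ?thesis .
qed

section \<open>Brunn--Minkowski for finite families of boxes\<close>

text \<open>Boxes are indexed so that a cut by a halfspace keeps the indices and the induction can
  count them. Positive volume is required so that boxes flattened by a cut leave the family and
  lower the count.\<close>

definition box_family :: "'i set \<Rightarrow> ('i \<Rightarrow> 'a::euclidean_space set) \<Rightarrow> bool" where
  "box_family I Q \<longleftrightarrow> finite I \<and> I \<noteq> {} \<and> (\<forall>i\<in>I. (\<exists>a b. Q i = cbox a b) \<and> vol (Q i) > 0) \<and>
     pairwise (\<lambda>i j. interior (Q i) \<inter> interior (Q j) = {}) I"

lemma box_family_compact: "box_family I Q \<Longrightarrow> compact (\<Union>(Q ` I))"
  by (intro compact_UN) (auto simp: box_family_def)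

text \<open>Boxes with non-empty disjoint interiors have non-overlapping projections to some axis.
  The plane found here leaves at least one box missing on each side, which drives the
  induction.\<close>

lemma box_family_separate:
  fixes Q :: "'i \<Rightarrow> 'a::euclidean_space set"
  assumes Q: "box_family I Q" and "card I \<ge> 2"
  obtains i j k c where "i \<in> I" "j \<in> I" "k \<in> Basis" "Q i \<subseteq> {x. x \<bullet> k \<le> c}" "Q j \<subseteq> {x. x \<bullet> k \<ge> c}"
proof -
  obtain i j where ij: "i \<in> I" "j \<in> I" "i \<noteq> j"
    using assms(2) by (metis One_nat_def Suc_1 card_2_iff' card_le_Suc0_iff_eq card.infinite not_less_eq_eq zero_le)
  then have disj: "interior (Q i) \<inter> interior (Q j) = {}"
    using Q by (auto simp: box_family_def pairwise_def)
  obtain a b where ab: "Q i = cbox a b" "vol (cbox a b) > 0"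
    using Q ij unfolding box_family_def by metis
  obtain c d where cd: "Q j = cbox c d" "vol (cbox c d) > 0"
    using Q ij unfolding box_family_def by metis
  have "box a b \<inter> box c d = {}" using disj by (simp add: ab cd interior_cbox)
  then obtain k where k: "k \<in> Basis" "b \<bullet> k \<le> a \<bullet> k \<or> d \<bullet> k \<le> c \<bullet> k \<or> b \<bullet> k \<le> c \<bullet> k \<or> d \<bullet> k \<le> a \<bullet> k"
    unfolding disjoint_interval by blast
  moreover have "a \<bullet> k < b \<bullet> k" "c \<bullet> k < d \<bullet> k"
    using ab cd k by (auto simp: content_pos_lt_eq)
  ultimately consider "b \<bullet> k \<le> c \<bullet> k" | "d \<bullet> k \<le> a \<bullet> k" by linarith
  then show thesis
  proof cases
    case 1
    have "Q i \<subseteq> {x. x \<bullet> k \<le> b \<bullet> k}" "Q j \<subseteq> {x. x \<bullet> k \<ge> b \<bullet> k}"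
      using k(1) 1 by (auto simp: ab cd mem_box intro: order_trans)
    then show thesis using that ij k by blast
  next
    case 2
    have "Q j \<subseteq> {x. x \<bullet> k \<le> d \<bullet> k}" "Q i \<subseteq> {x. x \<bullet> k \<ge> d \<bullet> k}"
      using k(1) 2 by (auto simp: ab cd mem_box intro: order_trans)
    then show thesis using that ij k by blast
  qed
qed

lemma box_family_Int:
  fixes Q :: "'i \<Rightarrow> 'a::euclidean_space set"
  assumes Q: "box_family I Q" and H: "\<And>a b. \<exists>c d. cbox a b \<inter> H = cbox c d"
    and pos: "(\<Sum>i\<in>I. vol (Q i \<inter> H)) > 0"
  defines "J \<equiv> {i\<in>I. vol (Q i \<inter> H) > 0}"
  shows "box_family J (\<lambda>i. Q i \<inter> H)" "(\<Sum>i\<in>J. vol (Q i \<inter> H)) = (\<Sum>i\<in>I. vol (Q i \<inter> H))"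
proof -
  have fin: "finite I" using Q by (simp add: box_family_def)
  show *: "(\<Sum>i\<in>J. vol (Q i \<inter> H)) = (\<Sum>i\<in>I. vol (Q i \<inter> H))"
    unfolding J_def using fin by (intro sum.mono_neutral_left) (auto simp: zero_less_measure_iff)
  have "J \<noteq> {}" using pos unfolding *[symmetric] by auto
  moreover have "\<exists>a b. Q i \<inter> H = cbox a b" if "i \<in> J" for i
    using that Q H unfolding box_family_def J_def by (metis (mono_tags, lifting) mem_Collect_eq)
  moreover have "pairwise (\<lambda>i j. interior (Q i \<inter> H) \<inter> interior (Q j \<inter> H) = {}) J"
    using Q unfolding box_family_def J_def pairwise_def interior_Int by blast
  ultimately show "box_family J (\<lambda>i. Q i \<inter> H)"
    using fin by (auto simp: box_family_def J_def)
qed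

text \<open>Sums of lower pieces stay below height \<open>c + d\<close> and sums of upper pieces
  above it, so they overlap in a null set only. Both the induction over boxes and the analysis of
  the equality case rest on this.\<close>

lemma vol_plus_halfspaces:
  fixes k :: "'a::euclidean_space"
  assumes A: "compact A" and B: "compact B" and k: "k \<noteq> 0"
    and sub: "A1 \<subseteq> A \<inter> {x. x \<bullet> k \<le> c}" "A2 \<subseteq> A \<inter> {x. x \<bullet> k \<ge> c}"
      "B1 \<subseteq> B \<inter> {x. x \<bullet> k \<le> d}" "B2 \<subseteq> B \<inter> {x. x \<bullet> k \<ge> d}"
    and cpt: "compact A1" "compact A2" "compact B1" "compact B2"
  shows "vol (A1 + B1) + vol (A2 + B2) = vol ((A1 + B1) \<union> (A2 + B2))"
    "vol ((A1 + B1) \<union> (A2 + B2)) \<le> vol (A + B)"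
proof -
  have cp: "compact (A1 + B1)" "compact (A2 + B2)" "compact (A + B)"
    using assms by (auto intro: compact_set_plus)
  have "A1 + B1 \<subseteq> {x. x \<bullet> k \<le> c + d}" "A2 + B2 \<subseteq> {x. x \<bullet> k \<ge> c + d}"
    using sub by (fastforce simp: set_plus_def inner_add_left intro: add_mono)+
  then have "(A1 + B1) \<inter> (A2 + B2) \<subseteq> {x. x \<bullet> k = c + d}"
    by force
  then have "negligible ((A1 + B1) \<inter> (A2 + B2))"
    using negligible_hyperplane'[OF k] negligible_subset by blast
  then show "vol (A1 + B1) + vol (A2 + B2) = vol ((A1 + B1) \<union> (A2 + B2))"
    using cp by (simp add: vol_Un_negligible)
  have "(A1 + B1) \<union> (A2 + B2) \<subseteq> A + B"
    using sub by (fastforce simp: set_plus_def)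
  then show "vol ((A1 + B1) \<union> (A2 + B2)) \<le> vol (A + B)"
    using cp by (intro vol_mono_compact) (auto simp: compact_imp_closed borel_closed compact_Un)
qed

lemma root_proportional_power:
  assumes "n > 0" "p > 0" "t \<ge> 0"
  shows "(root n p + root n (p * t)) ^ n = p * (1 + root n t) ^ n"
proof -
  have "(root n p + root n (p * t)) ^ n = (root n p * (1 + root n t)) ^ n"
    by (simp add: real_root_mult algebra_simps)
  also have "\<dots> = p * (1 + root n t) ^ n"
    using assms by (simp add: power_mult_distrib)
  finally show ?thesis .
qed

text \<open>On the left, sums of the volumes of the boxes replace the volumes of the unions, so that
  additivity under a cut holds box by box.\<close>

definition bm_families :: "'i set \<Rightarrow> ('i \<Rightarrow> 'a::euclidean_space set) \<Rightarrow> 'i set \<Rightarrow> ('i \<Rightarrow> 'a set) \<Rightarrow> bool" where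
  "bm_families I P J Q \<longleftrightarrow>
     (root DIM('a) (\<Sum>i\<in>I. vol (P i)) + root DIM('a) (\<Sum>j\<in>J. vol (Q j))) ^ DIM('a)
       \<le> vol (\<Union>(P ` I) + \<Union>(Q ` J))"

lemma bm_families_commute: "bm_families I P J Q \<longleftrightarrow> bm_families J Q I P"
  by (simp add: bm_families_def add.commute)

text \<open>The Hadwiger--Ohmann cut. A coordinate hyperplane that separates two boxes of
  \<open>P\<close> leaves fewer of them on either side, and a parallel one cuts \<open>Q\<close> in
  the same volume ratio without increasing the number of its boxes. Both halves then have the volume
  ratio \<open>q / p\<close> of the whole, so the two bounds from the induction hypothesis share a
  factor and add up to the full bound.\<close>

lemma bm_families_step:
  fixes P Q :: "'i \<Rightarrow> 'a::euclidean_space set"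
  assumes P: "box_family I P" and Q: "box_family J Q" and card: "card I \<ge> 2"
    and IH: "\<And>I' P' J' Q'. box_family I' P' \<Longrightarrow> box_family J' (Q' :: 'i \<Rightarrow> 'a set) \<Longrightarrow>
      card I' < card I \<Longrightarrow> card J' \<le> card J \<Longrightarrow> bm_families I' P' J' Q'"
  shows "bm_families I P J Q"
proof -
  let ?n = "DIM('a)"
  obtain i0 j0 k c where ij: "i0 \<in> I" "j0 \<in> I" and k: "k \<in> Basis"
    and sep: "P i0 \<subseteq> {x. x \<bullet> k \<le> c}" "P j0 \<subseteq> {x. x \<bullet> k \<ge> c}"
    using box_family_separate[OF P card] by blast
  have k0: "k \<noteq> 0" using k by auto
  define H1 where "H1 = (\<lambda>c. {x. x \<bullet> k \<le> c})"
  define H2 where "H2 = (\<lambda>c. {x. x \<bullet> k \<ge> c})"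
  have H: "\<exists>c d. cbox a b \<inter> H1 e = cbox c d" "\<exists>c d. cbox a b \<inter> H2 e = cbox c d" for a b e
    unfolding H1_def H2_def interval_split[OF k] by blast+
  have finI: "finite I" "finite J" using P Q by (auto simp: box_family_def)
  have cptP: "compact (P i)" if "i \<in> I" for i using P that by (force simp: box_family_def)
  have cptQ: "compact (Q i)" if "i \<in> J" for i using Q that by (force simp: box_family_def)
  have posP: "vol (P i) > 0" if "i \<in> I" for i using P that by (simp add: box_family_def)
  define p1 where "p1 = (\<Sum>i\<in>I. vol (P i \<inter> H1 c))"
  define p2 where "p2 = (\<Sum>i\<in>I. vol (P i \<inter> H2 c))"
  define p where "p = (\<Sum>i\<in>I. vol (P i))"
  define q where "q = (\<Sum>i\<in>J. vol (Q i))"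
  have p: "p = p1 + p2"
    unfolding p_def p1_def p2_def H1_def H2_def sum.distrib[symmetric]
    using vol_halfspace_split[OF cptP k0] by (intro sum.cong) auto
  have "vol (P i0 \<inter> H1 c) > 0" "vol (P j0 \<inter> H2 c) > 0"
    using ij sep posP by (auto simp: H1_def H2_def Int_absorb2)
  then have p12: "p1 > 0" "p2 > 0"
    unfolding p1_def p2_def using ij finI by (auto intro: sum_pos2[of I i0] sum_pos2[of I j0])
  have q: "q > 0"
    unfolding q_def using Q by (auto simp: box_family_def intro!: sum_pos)
  have cptU: "compact (\<Union>(Q ` J))" by (rule box_family_compact[OF Q])
  obtain d where d: "(\<Sum>i\<in>J. vol (Q i \<inter> H1 d)) = p1 * (q / p)"
  proof -
    obtain R where R: "\<And>x. x \<in> \<Union>(Q ` J) \<Longrightarrow> norm x \<le> R" "R > 0"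
      using compact_imp_bounded[OF cptU] unfolding bounded_pos by blast
    have bd: "\<bar>x \<bullet> k\<bar> \<le> R" if "x \<in> \<Union>(Q ` J)" for x
      using R(1)[OF that] Basis_le_norm[OF k, of x] by linarith
    \<comment> \<open>The margin 1 makes the lower halfspace contain all boxes at one end and miss
      all of them at the other, as the intermediate value theorem requires.\<close>
    have "Q i \<inter> H1 (R + 1) = Q i" "Q i \<inter> H1 (- R - 1) = {}" if "i \<in> J" for i
      using bd that by (force simp: H1_def abs_le_iff)+
    then have "(\<Sum>i\<in>J. vol (Q i \<inter> H1 (R + 1))) = q" "(\<Sum>i\<in>J. vol (Q i \<inter> H1 (- R - 1))) = 0"
      by (auto simp: q_def)
    moreover have "0 \<le> p1 * (q / p)" "p1 * (q / p) \<le> q"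
      using p12 q p by (auto simp: field_simps)
    moreover have "continuous_on {- R - 1..R + 1} (\<lambda>d. \<Sum>i\<in>J. vol (Q i \<inter> H1 d))"
      unfolding H1_def using cptQ
      by (intro continuous_on_sum continuous_on_subset[OF continuous_vol_halfspace[OF _ k0]]) auto
    ultimately have "\<exists>d\<ge>- R - 1. d \<le> R + 1 \<and> (\<Sum>i\<in>J. vol (Q i \<inter> H1 d)) = p1 * (q / p)"
      using R(2) by (intro IVT') auto
    then show thesis using that by blast
  qed
  have "q = (\<Sum>i\<in>J. vol (Q i \<inter> H1 d)) + (\<Sum>i\<in>J. vol (Q i \<inter> H2 d))"
    unfolding q_def H1_def H2_def sum.distrib[symmetric]
    using vol_halfspace_split[OF cptQ k0] by (intro sum.cong) auto
  then have d2: "(\<Sum>i\<in>J. vol (Q i \<inter> H2 d)) = p2 * (q / p)"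
    using d p p12 by (simp add: field_simps)
  define I1 where "I1 = {i\<in>I. vol (P i \<inter> H1 c) > 0}"
  define I2 where "I2 = {i\<in>I. vol (P i \<inter> H2 c) > 0}"
  define J1 where "J1 = {i\<in>J. vol (Q i \<inter> H1 d) > 0}"
  define J2 where "J2 = {i\<in>J. vol (Q i \<inter> H2 d) > 0}"
  have q12: "p1 * (q / p) > 0" "p2 * (q / p) > 0" using p12 p q by auto
  note fI1 = box_family_Int[OF P H(1)[of _ _ c], folded I1_def p1_def, OF p12(1)]
  note fI2 = box_family_Int[OF P H(2)[of _ _ c], folded I2_def p2_def, OF p12(2)]
  note fJ1 = box_family_Int[OF Q H(1)[of _ _ d], folded J1_def, unfolded d, OF q12(1)]
  note fJ2 = box_family_Int[OF Q H(2)[of _ _ d], folded J2_def, unfolded d2, OF q12(2)]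
  have null: "vol (S \<inter> T) = 0" if "compact S" "closed T" "S \<inter> T \<subseteq> {x. x \<bullet> k = c}" for S T
    using that negligible_subset[OF negligible_hyperplane'[OF k0]] by (intro vol_negligible compact_Int_closed) auto
  have "closed (H1 c)" "closed (H2 c)"
    using closed_halfspace_le[of k c] closed_halfspace_ge[of c k] by (auto simp: H1_def H2_def inner_commute)
  \<comment> \<open>\<open>i0\<close> lies below the plane and \<open>j0\<close> above it, so each
    keeps only a slice in the plane on the other side and drops out there.\<close>
  then have "vol (P j0 \<inter> H1 c) = 0" "vol (P i0 \<inter> H2 c) = 0"
    using sep ij cptP by (intro null; force simp: H1_def H2_def)+
  then have "j0 \<notin> I1" "i0 \<notin> I2"
    by (auto simp: I1_def I2_def)
  then have "I1 \<subset> I" "I2 \<subset> I" using ij by (auto simp: I1_def I2_def)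
  then have cards: "card I1 < card I" "card I2 < card I" "card J1 \<le> card J" "card J2 \<le> card J"
    using finI by (auto intro!: psubset_card_mono card_mono simp: J1_def J2_def)
  let ?A1 = "\<Union>i\<in>I1. P i \<inter> H1 c" and ?A2 = "\<Union>i\<in>I2. P i \<inter> H2 c"
  let ?B1 = "\<Union>i\<in>J1. Q i \<inter> H1 d" and ?B2 = "\<Union>i\<in>J2. Q i \<inter> H2 d"
  have "p1 * (1 + root ?n (q / p)) ^ ?n \<le> vol (?A1 + ?B1)"
    using IH[OF fI1(1) fJ1(1) cards(1,3)] p12 p q unfolding bm_families_def fI1(2) fJ1(2)
    by (subst (asm) root_proportional_power) auto
  moreover have "p2 * (1 + root ?n (q / p)) ^ ?n \<le> vol (?A2 + ?B2)"
    using IH[OF fI2(1) fJ2(1) cards(2,4)] p12 p q unfolding bm_families_def fI2(2) fJ2(2)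
    by (subst (asm) root_proportional_power) auto
  moreover have "vol (?A1 + ?B1) + vol (?A2 + ?B2) \<le> vol (\<Union>(P ` I) + \<Union>(Q ` J))"
  proof -
    have sub: "?A1 \<subseteq> \<Union>(P ` I) \<inter> {x. x \<bullet> k \<le> c}" "?A2 \<subseteq> \<Union>(P ` I) \<inter> {x. x \<bullet> k \<ge> c}"
      "?B1 \<subseteq> \<Union>(Q ` J) \<inter> {x. x \<bullet> k \<le> d}" "?B2 \<subseteq> \<Union>(Q ` J) \<inter> {x. x \<bullet> k \<ge> d}"
      by (auto simp: I1_def I2_def J1_def J2_def H1_def H2_def)
    note cpts = box_family_compact[OF fI1(1)] box_family_compact[OF fI2(1)]
      box_family_compact[OF fJ1(1)] box_family_compact[OF fJ2(1)]
    show ?thesis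
      using vol_plus_halfspaces[OF box_family_compact[OF P] cptU k0 sub cpts] by simp
  qed
  moreover have "(root ?n p + root ?n q) ^ ?n = p * (1 + root ?n (q / p)) ^ ?n"
    using root_proportional_power[of ?n p "q / p"] p p12 q by simp
  ultimately show ?thesis
    unfolding bm_families_def p_def[symmetric] q_def[symmetric] by (simp add: p distrib_right)
qed

lemma brunn_minkowski_box_families:
  fixes P Q :: "'i \<Rightarrow> 'a::euclidean_space set"
  assumes "box_family I P" "box_family J Q"
  shows "bm_families I P J Q"
  using assms
proof (induction "card I + card J" arbitrary: I P J Q rule: less_induct)
  case less
  consider "card I \<ge> 2" | "card J \<ge> 2" | "card I < 2" "card J < 2" by linarith
  then show ?case
  proof cases
    case 1
    show ?thesis
      by (rule bm_families_step[OF less.prems 1]) (use less.hyps in force)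
  next
    case 2
    show ?thesis
      unfolding bm_families_commute[of I]
      by (rule bm_families_step[OF less.prems(2,1) 2]) (use less.hyps in force)
  next
    case 3
    moreover have "card I > 0" "card J > 0" using less.prems by (auto simp: box_family_def card_gt_0_iff)
    ultimately have "card I = 1" "card J = 1" by auto
    then obtain i j where ij: "I = {i}" "J = {j}" by (auto simp: card_1_singleton_iff)
    then obtain a b c d where "P i = cbox a b" "Q j = cbox c d"
      using less.prems by (auto simp: box_family_def)
    then show ?thesis
      using less.prems brunn_minkowski_cbox[of a b c d] by (simp add: ij box_family_def bm_families_def)
  qed
qed

section \<open>From families of boxes to compact sets\<close>

text \<open>A division of a large cube that is fine for balls of radius \<open>e / 2\<close> has
  cells of diameter at most \<open>e\<close>; those meeting \<open>A\<close> cover it and stay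
  within distance \<open>e\<close> of it.\<close>

lemma compact_box_family_cover:
  fixes A :: "'a::euclidean_space set"
  assumes A: "compact A" "A \<noteq> {}" and e: "e > 0"
  obtains I and P :: "'a set \<Rightarrow> 'a set" where "box_family I P" "A \<subseteq> \<Union>(P ` I)" "\<Union>(P ` I) \<subseteq> A + cball 0 e"
    "vol A \<le> (\<Sum>i\<in>I. vol (P i))"
proof -
  obtain R where R: "R > 0" "\<And>x. x \<in> A \<Longrightarrow> norm x \<le> R"
    using compact_imp_bounded[OF A(1)] unfolding bounded_pos by blast
  let ?b = "R *\<^sub>R One :: 'a"
  have sub: "A \<subseteq> cbox (- ?b) ?b"
  proof
    fix x assume "x \<in> A"
    then have "\<bar>x \<bullet> i\<bar> \<le> R" if "i \<in> Basis" for i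
      using R(2) Basis_le_norm[OF that, of x] by force
    then show "x \<in> cbox (- ?b) ?b" by (auto simp: mem_box abs_le_iff minus_le_iff)
  qed
  have ct: "vol (cbox (- ?b) ?b) \<noteq> 0"
  proof -
    have "(- ?b) \<bullet> i < ?b \<bullet> i" if "i \<in> Basis" for i using R(1) that by simp
    then have "vol (cbox (- ?b) ?b) > 0" unfolding content_pos_lt_eq by blast
    then show ?thesis by simp
  qed
  have "gauge (\<lambda>x::'a. ball x (e / 2))" using e by auto
  then obtain p where p: "p tagged_division_of cbox (- ?b) ?b" "(\<lambda>x. ball x (e / 2)) fine p"
    by (rule fine_division_exists)
  \<comment> \<open>Degenerate cells are discarded, as \<open>box_family\<close> demands; the others
    still divide the cube.\<close>
  define D where "D = {K \<in> snd ` p. vol K \<noteq> 0}"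
  have D: "D division_of cbox (- ?b) ?b"
    unfolding D_def by (intro division_of_nontrivial division_of_tagged_division p ct)
  define I where "I = {K \<in> D. K \<inter> A \<noteq> {}}"
  have "A \<subseteq> \<Union>D" using sub D by (auto simp: division_of_def)
  then have cover: "A \<subseteq> \<Union>((\<lambda>K. K) ` I)" by (auto simp: I_def)
  have near: "K \<subseteq> A + cball 0 e" if K: "K \<in> I" for K
  proof
    fix x assume x: "x \<in> K"
    obtain y where y: "y \<in> K" "y \<in> A" using K unfolding I_def by blast
    have "K \<in> snd ` p" using K unfolding I_def D_def by blast
    then obtain z where "(z, K) \<in> p" by (metis imageE prod.collapse)
    then have "K \<subseteq> ball z (e / 2)" using p(2) by (auto simp: fine_def)
    then have "dist z x < e / 2" "dist z y < e / 2" using x y by auto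
    then have "dist y x \<le> e" by (metis dist_commute dist_triangle_half_r less_imp_le)
    then have "x - y \<in> cball 0 e" by (simp add: dist_norm norm_minus_commute)
    then show "x \<in> A + cball 0 e" using set_plus_intro[OF y(2), of "x - y" "cball 0 e"] by simp
  qed
  have "box_family I (\<lambda>K. K)"
    unfolding box_family_def
  proof (intro conjI ballI)
    show "finite I" using D by (auto simp: I_def division_of_def)
    show "I \<noteq> {}" using cover A(2) by auto
    show "\<exists>a b. K = cbox a b" if "K \<in> I" for K using D that by (auto simp: I_def division_of_def)
    show "vol K > 0" if "K \<in> I" for K using that unfolding I_def D_def zero_less_measure_iff by blast
    show "pairwise (\<lambda>i j. interior i \<inter> interior j = {}) I"
      using D by (auto simp: I_def division_of_def pairwise_def)
  qed
  moreover have "vol A \<le> (\<Sum>K\<in>I. vol K)"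
  proof -
    have fin: "finite I" and cpt: "\<And>K. K \<in> I \<Longrightarrow> compact K"
      using D by (force simp: I_def division_of_def)+
    have "vol A \<le> vol (\<Union>((\<lambda>K. K) ` I))"
      using cover fin cpt A by (intro vol_mono_compact compact_UN) (auto simp: compact_imp_closed borel_closed)
    also have "\<dots> \<le> (\<Sum>K\<in>I. vol K)"
      using fin cpt by (intro measure_UNION_le) (auto simp: compact_imp_closed borel_closed)
    finally show ?thesis .
  qed
  ultimately show thesis using that[of I "\<lambda>K. K"] cover near by blast
qed

lemma cball_plus_cball:
  fixes x y :: "'a::real_normed_vector"
  assumes "a \<ge> 0" "b \<ge> 0"
  shows "cball x a + cball y b = cball (x + y) (a + b)"
proof (intro equalityI subsetI)
  fix z assume "z \<in> cball x a + cball y b"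
  then obtain p q where pq: "dist x p \<le> a" "dist y q \<le> b" "z = p + q" by (auto simp: set_plus_def)
  then show "z \<in> cball (x + y) (a + b)"
    using dist_triangle_add[of x y p q] by simp
next
  fix z assume z: "z \<in> cball (x + y) (a + b)"
  show "z \<in> cball x a + cball y b"
  proof (cases "a + b = 0")
    case True
    then show ?thesis using z assms by (auto simp: add_nonneg_eq_0_iff set_plus_def)
  next
    case False
    then have ab: "a + b > 0" using assms by simp
    define w where "w = z - (x + y)"
    have w: "norm w \<le> a + b" using z by (simp add: w_def dist_norm norm_minus_commute)
    have sc: "norm ((c / (a + b)) *\<^sub>R w) \<le> c" if "c \<ge> 0" for c
      using ab that mult_left_mono[OF w that] by (simp add: pos_divide_le_eq)
    have "(a / (a + b)) *\<^sub>R w + (b / (a + b)) *\<^sub>R w = w"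
      using ab by (simp add: scaleR_add_left[symmetric] add_divide_distrib[symmetric])
    moreover have "z = (x + y) + w" by (simp add: w_def)
    ultimately have "z = (x + (a / (a + b)) *\<^sub>R w) + (y + (b / (a + b)) *\<^sub>R w)"
      by (metis add.assoc add.commute add.left_commute)
    moreover have "x + (a / (a + b)) *\<^sub>R w \<in> cball x a" "y + (b / (a + b)) *\<^sub>R w \<in> cball y b"
      using sc assms by (simp_all add: dist_norm)
    ultimately show ?thesis using set_plus_intro by metis
  qed
qed

text \<open>Since \<open>C\<close> is closed, its parallel bodies decrease to \<open>C\<close>; they
  have finite volume, so the measure is continuous from above along them.\<close>

lemma vol_plus_cball_tendsto:
  fixes C :: "'a::euclidean_space set"
  assumes C: "compact C"
  shows "(\<lambda>k. vol (C + cball 0 (inverse (real (Suc k))))) \<longlonglongrightarrow> vol C"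
proof -
  let ?A = "\<lambda>k. C + cball 0 (inverse (real (Suc k)))"
  have cpt: "compact (?A k)" for k using C by (intro compact_set_plus) auto
  have "(\<Inter>k. ?A k) = C"
  proof (intro equalityI subsetI)
    fix x assume "x \<in> C"
    then have "x \<in> ?A k" for k using set_plus_intro[of x C 0 "cball 0 (inverse (real (Suc k)))"] by simp
    then show "x \<in> (\<Inter>k. ?A k)" by blast
  next
    fix x assume x: "x \<in> (\<Inter>k. ?A k)"
    have "\<exists>y\<in>C. dist y x \<le> inverse (real (Suc k))" for k
    proof -
      have "x \<in> ?A k" using x by blast
      then obtain y z where "y \<in> C" "norm z \<le> inverse (real (Suc k))" "x = y + z"
        by (auto elim!: set_plus_elim)
      then show ?thesis by (intro bexI[of _ y]) (simp_all add: dist_norm)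
    qed
    then obtain y where y: "\<And>k. y k \<in> C" "\<And>k. dist (y k) x \<le> inverse (real (Suc k))" by metis
    have "(\<lambda>k. dist (y k) x) \<longlonglongrightarrow> 0"
      using LIMSEQ_inverse_real_of_nat
      by (rule Lim_null_comparison[rotated]) (use y(2) in simp)
    then have "y \<longlonglongrightarrow> x" by (rule iffD2[OF tendsto_dist_iff])
    then show "x \<in> C" 
      using y(1) closed_sequentially[OF compact_imp_closed[OF C], of y x] by blast
  qed
  moreover have "(\<lambda>k. vol (?A k)) \<longlonglongrightarrow> vol (\<Inter>k. ?A k)"
  proof (rule Lim_measure_decseq)
    show "range ?A \<subseteq> sets lborel" using cpt by (auto simp: compact_imp_closed borel_closed)
    show "decseq ?A"
    proof (rule decseq_SucI)
      fix k
      have "inverse (real (Suc (Suc k))) \<le> inverse (real (Suc k))" by (simp add: field_simps)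
      then show "?A (Suc k) \<subseteq> ?A k" by (intro set_plus_mono2 subset_cball) auto
    qed
    show "emeasure lborel (?A k) \<noteq> \<infinity>" for k using emeasure_compact_finite[OF cpt[of k]] by simp
  qed
  ultimately show ?thesis by simp
qed

theorem brunn_minkowski:
  fixes A B :: "'a::euclidean_space set"
  assumes A: "compact A" "A \<noteq> {}" and B: "compact B" "B \<noteq> {}"
  shows "(root DIM('a) (vol A) + root DIM('a) (vol B)) ^ DIM('a) \<le> vol (A + B)"
proof (rule LIMSEQ_le_const[OF vol_plus_cball_tendsto[OF compact_set_plus[OF A(1) B(1)]]])
  show "\<exists>N. \<forall>k\<ge>N. (root DIM('a) (vol A) + root DIM('a) (vol B)) ^ DIM('a)
          \<le> vol (A + B + cball 0 (inverse (real (Suc k))))"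
  proof (intro exI allI impI)
    fix k :: nat
    \<comment> \<open>Half the radius for each summand, because the enlargements of \<open>A\<close>
      and \<open>B\<close> add up.\<close>
    let ?e = "inverse (real (Suc k)) / 2"
    have e: "?e > 0" by simp
    obtain I and P :: "'a set \<Rightarrow> 'a set" where P: "box_family I P" "\<Union>(P ` I) \<subseteq> A + cball 0 ?e"
      "vol A \<le> (\<Sum>i\<in>I. vol (P i))"
      using compact_box_family_cover[OF A e] by metis
    obtain J and Q :: "'a set \<Rightarrow> 'a set" where Q: "box_family J Q" "\<Union>(Q ` J) \<subseteq> B + cball 0 ?e"
      "vol B \<le> (\<Sum>i\<in>J. vol (Q i))"
      using compact_box_family_cover[OF B e] by metis
    have "(root DIM('a) (vol A) + root DIM('a) (vol B)) ^ DIM('a)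
       \<le> (root DIM('a) (\<Sum>i\<in>I. vol (P i)) + root DIM('a) (\<Sum>j\<in>J. vol (Q j))) ^ DIM('a)"
      using P(3) Q(3) by (intro power_mono add_mono) auto
    also have "\<dots> \<le> vol (\<Union>(P ` I) + \<Union>(Q ` J))"
      using brunn_minkowski_box_families[OF P(1) Q(1)] by (simp add: bm_families_def)
    also have "\<dots> \<le> vol (A + B + cball 0 (inverse (real (Suc k))))"
    proof (rule vol_mono_compact)
      have "\<Union>(P ` I) + \<Union>(Q ` J) \<subseteq> (A + cball 0 ?e) + (B + cball 0 ?e)"
        by (intro set_plus_mono2 P Q)
      also have "\<dots> = A + B + (cball 0 ?e + cball 0 ?e)" by (simp add: ac_simps)
      also have "\<dots> = A + B + cball 0 (inverse (real (Suc k)))"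
        by (subst cball_plus_cball) auto
      finally show "\<Union>(P ` I) + \<Union>(Q ` J) \<subseteq> A + B + cball 0 (inverse (real (Suc k)))" .
    qed (use A B P Q in \<open>auto intro!: compact_set_plus borel_closed compact_imp_closed box_family_compact\<close>)
    finally show "(root DIM('a) (vol A) + root DIM('a) (vol B)) ^ DIM('a)
      \<le> vol (A + B + cball 0 (inverse (real (Suc k))))" .
  qed
qed

section \<open>Zonotopes and the ball\<close>

text \<open>Cauchy's functional equation on the half-line. Nonnegativity makes \<open>h\<close>
  monotone, and placing \<open>x\<close> between consecutive multiples of \<open>1 / N\<close>
  determines \<open>h x\<close> up to \<open>h 1 / N\<close>.\<close>

lemma additive_nonneg_linear:
  fixes h :: "real \<Rightarrow> real"
  assumes add: "\<And>x y. x \<ge> 0 \<Longrightarrow> y \<ge> 0 \<Longrightarrow> h (x + y) = h x + h y"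
    and nonneg: "\<And>x. x \<ge> 0 \<Longrightarrow> h x \<ge> 0" and x: "x \<ge> 0"
  shows "h x = x * h 1"
proof -
  have h0: "h 0 = 0" using add[of 0 0] by simp
  have mult: "h (real n * y) = real n * h y" if "y \<ge> 0" for n y
    using that by (induction n) (simp_all add: h0 add distrib_right)
  have mono: "h a \<le> h b" if "0 \<le> a" "a \<le> b" for a b
    using add[of a "b - a"] nonneg[of "b - a"] that by simp
  have bound: "\<bar>h x - x * h 1\<bar> \<le> h 1 * inverse (real (Suc n))" for n
  proof -
    let ?N = "real (Suc n)"
    define m where "m = nat \<lfloor>?N * x\<rfloor>"
    have "real m = of_int \<lfloor>?N * x\<rfloor>" using x by (simp add: m_def)
    then have m: "real m \<le> ?N * x" "?N * x \<le> real (Suc m)"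
      by linarith+
    have "real m * h 1 \<le> ?N * h x"
      using mono[OF _ m(1)] mult[of 1 m] mult[OF x, of "Suc n"] by simp
    moreover have "?N * h x \<le> real (Suc m) * h 1"
      using mono[OF _ m(2)] mult[of 1 "Suc m"] mult[OF x, of "Suc n"] x by simp
    moreover have "real m * h 1 \<le> ?N * x * h 1" "?N * x * h 1 \<le> real (Suc m) * h 1"
      using m nonneg[of 1] by (auto intro: mult_right_mono)
    moreover have "real (Suc m) * h 1 = real m * h 1 + h 1" by (simp add: distrib_right)
    ultimately have "\<bar>?N * h x - ?N * x * h 1\<bar> \<le> h 1" by linarith
    moreover have "?N * h x - ?N * x * h 1 = ?N * (h x - x * h 1)" by (simp add: algebra_simps)
    ultimately have "?N * \<bar>h x - x * h 1\<bar> \<le> h 1" by (simp add: abs_mult)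
    then show ?thesis by (simp add: field_simps)
  qed
  have "(\<lambda>n. h 1 * inverse (real (Suc n))) \<longlonglongrightarrow> h 1 * 0"
    by (intro tendsto_intros LIMSEQ_inverse_real_of_nat)
  then have "\<bar>h x - x * h 1\<bar> \<le> h 1 * 0"
    by (rule LIMSEQ_le_const) (use bound in blast)
  then show ?thesis by simp
qed

lemma closed_segment_0: "closed_segment 0 (w :: 'a::real_vector) = (\<lambda>t. t *\<^sub>R w) ` {0..1}"
  by (auto simp: closed_segment_def)

text \<open>Sweeping \<open>K\<close> by \<open>a + b\<close> is sweeping it by \<open>a\<close> and
  then sweeping the translate of \<open>K\<close> by \<open>b\<close>, and the two swept regions
  meet exactly in that translate. The gain in volume is therefore additive and nonnegative in the
  length, hence linear.\<close>

lemma vol_plus_segment: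
  fixes K :: "'a::euclidean_space set"
  assumes K: "compact K" "convex K" and r: "r \<ge> 0"
  shows "vol (K + closed_segment 0 (r *\<^sub>R v)) = vol K + r * (vol (K + closed_segment 0 v) - vol K)"
proof -
  define S where "S = (\<lambda>r. K + closed_segment 0 (r *\<^sub>R v))"
  have S: "z \<in> S r \<longleftrightarrow> (\<exists>x\<in>K. \<exists>t\<in>{0..r}. z = x + t *\<^sub>R v)" if "r \<ge> 0" for z r
  proof
    assume "z \<in> S r"
    then obtain x t where "x \<in> K" "0 \<le> t" "t \<le> 1" "z = x + (t * r) *\<^sub>R v"
      by (auto simp: S_def closed_segment_0 elim!: set_plus_elim)
    moreover have "t * r \<le> r" using calculation that by (simp add: mult_left_le_one_le)
    ultimately show "\<exists>x\<in>K. \<exists>t\<in>{0..r}. z = x + t *\<^sub>R v"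
      using that by (intro bexI[of _ x] bexI[of _ "t * r"]) auto
  next
    assume "\<exists>x\<in>K. \<exists>t\<in>{0..r}. z = x + t *\<^sub>R v"
    then obtain x t where xt: "x \<in> K" "0 \<le> t" "t \<le> r" "z = x + t *\<^sub>R v" by auto
    have "t *\<^sub>R v \<in> closed_segment 0 (r *\<^sub>R v)"
    proof (cases "r = 0")
      case False
      then have "t *\<^sub>R v = (t / r) *\<^sub>R (r *\<^sub>R v)" "t / r \<in> {0..1}"
        using xt that by auto
      then show ?thesis unfolding closed_segment_0 by blast
    qed (use xt in auto)
    then show "z \<in> S r" using xt by (auto simp: S_def)
  qed
  have cpt: "compact (S r)" for r unfolding S_def using K by (intro compact_set_plus) auto
  have S0: "S 0 = K" by (auto simp: S_def set_plus_def)
  have add: "vol (S (a + b)) - vol K = (vol (S a) - vol K) + (vol (S b) - vol K)" if ab: "a \<ge> 0" "b \<ge> 0" for a b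
  proof -
    have un: "S (a + b) = S a \<union> ((+) (a *\<^sub>R v)) ` S b"
    proof (intro equalityI subsetI)
      fix z assume "z \<in> S (a + b)"
      then obtain x t where xt: "x \<in> K" "0 \<le> t" "t \<le> a + b" "z = x + t *\<^sub>R v"
        using S[of "a + b"] ab by auto
      show "z \<in> S a \<union> ((+) (a *\<^sub>R v)) ` S b"
      proof (cases "t \<le> a")
        case True
        then have "z \<in> S a" unfolding S[OF ab(1)] using xt by force
        then show ?thesis by blast
      next
        case False
        have "x + (t - a) *\<^sub>R v \<in> S b" using False xt S[OF ab(2)] by force
        moreover have "z = a *\<^sub>R v + (x + (t - a) *\<^sub>R v)" using xt by (simp add: algebra_simps)
        ultimately show ?thesis by blast
      qed
    next
      fix z assume "z \<in> S a \<union> ((+) (a *\<^sub>R v)) ` S b"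
      then consider "z \<in> S a" | y where "y \<in> S b" "z = a *\<^sub>R v + y" by auto
      then show "z \<in> S (a + b)"
      proof cases
        case 1
        then show ?thesis using S[OF ab(1)] S[of "a + b"] ab by force
      next
        case 2
        then obtain x t where "x \<in> K" "0 \<le> t" "t \<le> b" "y = x + t *\<^sub>R v" using S[OF ab(2)] by auto
        then have "z = x + (a + t) *\<^sub>R v" "a + t \<in> {0..a + b}" using 2 ab by (auto simp: algebra_simps)
        then show ?thesis using S[of "a + b"] ab \<open>x \<in> K\<close> by fastforce
      qed
    qed
    have int: "S a \<inter> ((+) (a *\<^sub>R v)) ` S b = (+) (a *\<^sub>R v) ` K"
    proof (intro equalityI subsetI)
      fix z assume "z \<in> S a \<inter> ((+) (a *\<^sub>R v)) ` S b"
      then obtain x t y s where *: "x \<in> K" "0 \<le> t" "t \<le> a" "y \<in> K" "0 \<le> s" "s \<le> b"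
        "z = x + t *\<^sub>R v" "z = a *\<^sub>R v + (y + s *\<^sub>R v)"
        using S[OF ab(1)] S[OF ab(2)] by auto
      \<comment> \<open>Convexity enters here: \<open>y + s v\<close> lies between \<open>y\<close>
        and \<open>x = y + d v\<close>, because \<open>d \<ge> s\<close>.\<close>
      have "y + s *\<^sub>R v \<in> K"
      proof (cases "s = 0")
        case False
        define d where "d = a - t + s"
        have d: "d > 0" using * False by (simp add: d_def)
        have x: "x = y + d *\<^sub>R v" using *(7,8) by (simp add: d_def algebra_simps)
        have "y + s *\<^sub>R v = (1 - s / d) *\<^sub>R y + (s / d) *\<^sub>R x"
          using d by (simp add: x algebra_simps)
        moreover have "0 \<le> s / d" "s / d \<le> 1" using * d by (auto simp: d_def)
        ultimately show ?thesis using convexD_alt[OF K(2) *(4,1)] by simp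
      qed (use * in simp)
      then show "z \<in> (+) (a *\<^sub>R v) ` K" using * by blast
    next
      fix z assume "z \<in> (+) (a *\<^sub>R v) ` K"
      then obtain x where "x \<in> K" "z = a *\<^sub>R v + x" by auto
      then have "z \<in> S a" "x \<in> S b" using S[OF ab(1)] S[OF ab(2)] ab by (force simp: add.commute)+
      then show "z \<in> S a \<inter> ((+) (a *\<^sub>R v)) ` S b" using \<open>z = _\<close> by blast
    qed
    have "measure lebesgue (S a \<union> ((+) (a *\<^sub>R v)) ` S b)
        = measure lebesgue (S a) + measure lebesgue (((+) (a *\<^sub>R v)) ` S b) - measure lebesgue ((+) (a *\<^sub>R v) ` K)"
      using cpt[of a] cpt[of b] unfolding int[symmetric]
      by (intro measure_Un3 lmeasurable_compact compact_translation)
    then have "measure lebesgue (S (a + b)) = measure lebesgue (S a) + measure lebesgue (S b) - measure lebesgue K"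
      by (simp add: un measure_translation)
    then show ?thesis using cpt K by (simp add: compact_imp_closed borel_closed)
  qed
  have "vol (S r) - vol K = r * (vol (S 1) - vol K)"
  proof (rule additive_nonneg_linear[of "\<lambda>r. vol (S r) - vol K", OF add _ r])
    fix x :: real assume "x \<ge> 0"
    then have "z \<in> S x" if "z \<in> K" for z
      using S[of x z] that by (intro iffD2[OF S] bexI[of _ z] bexI[of _ 0]) auto
    then have "K \<subseteq> S x" by blast
    then show "vol (S x) - vol K \<ge> 0"
      using vol_mono_compact[OF _ cpt] K by (simp add: compact_imp_closed borel_closed)
  qed
  then show ?thesis by (simp add: S_def)
qed

lemma vol_plus_symmetric_segment:
  fixes K :: "'a::euclidean_space set"
  assumes K: "compact K" "convex K" and r: "r \<ge> 0"
  shows "vol (K + closed_segment (- (r *\<^sub>R v)) (r *\<^sub>R v)) =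
    vol K + r * (vol (K + closed_segment (- v) v) - vol K)"
proof -
  have eq: "vol (K + closed_segment (- w) w) = vol (K + closed_segment 0 (2 *\<^sub>R w))" for w
  proof -
    have "closed_segment (- w) w = (+) (- w) ` closed_segment 0 (2 *\<^sub>R w)"
      unfolding closed_segment_translation[symmetric] by (simp add: scaleR_2)
    then have "K + closed_segment (- w) w = (+) (- w) ` (K + closed_segment 0 (2 *\<^sub>R w))"
      by (auto simp: set_plus_def image_iff algebra_simps) (metis diff_conv_add_uminus add.assoc)+
    then show ?thesis
      using vol_translation[OF compact_set_plus[OF K(1) compact_segment], of "- w" 0 "2 *\<^sub>R w"] by simp
  qed
  show ?thesis
    unfolding eq using vol_plus_segment[OF K r, of "2 *\<^sub>R v"] by (simp add: mult.commute)
qed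

section \<open>Zonotopes and their support functions\<close>

text \<open>With symmetric segments the support function at \<open>a\<close> is the sum of the
  \<open>\<bar>a \<bullet> v\<bar>\<close>, a form that can be approached by integrals over the
  ball.\<close>

fun zonotope :: "'a::real_vector list \<Rightarrow> 'a set" where
  "zonotope [] = {0}"
| "zonotope (v # vs) = closed_segment (- v) v + zonotope vs"

lemma compact_zonotope: "compact (zonotope (vs :: 'a::euclidean_space list))"
  by (induction vs) (auto intro: compact_set_plus)

lemma convex_zonotope: "convex (zonotope (vs :: 'a::euclidean_space list))"
  by (induction vs) (auto intro: convex_set_plus)

lemma zonotope_scaleR: "zonotope (map ((*\<^sub>R) r) vs) = (*\<^sub>R) r ` zonotope (vs :: 'a::real_vector list)"
proof (induction vs)
  case (Cons v vs)
  have "closed_segment (- (r *\<^sub>R v)) (r *\<^sub>R v) = (*\<^sub>R) r ` closed_segment (- v) v"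
    using closed_segment_linear_image[of "(*\<^sub>R) r" "- v" v] by simp
  moreover have "(*\<^sub>R) r ` (A + B) = (*\<^sub>R) r ` A + (*\<^sub>R) r ` B" for A B :: "'a set"
    by (force simp: set_plus_def image_iff scaleR_add_right)
  ultimately show ?case using Cons.IH by simp
qed simp

text \<open>The volume is affine in the scale of the first segment. The value and the slope of this
  affine function are polynomials in the scale of the remaining segments, by induction applied to
  \<open>K\<close> and to \<open>K + closed_segment (- v) v\<close>; this is why \<open>K\<close> is
  arbitrary in the induction.\<close>

lemma vol_plus_zonotope_poly:
  fixes K :: "'a::euclidean_space set"
  assumes "compact K" "convex K"
  obtains p where "\<And>r. r \<ge> 0 \<Longrightarrow> vol (K + zonotope (map ((*\<^sub>R) r) vs)) = poly p r"
proof -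
  have "\<exists>p. \<forall>r\<ge>0. vol (K + zonotope (map ((*\<^sub>R) r) vs)) = poly p r"
    using assms
  proof (induction vs arbitrary: K)
    case Nil
    then show ?case by (intro exI[of _ "[:vol K:]"]) simp
  next
    case (Cons v vs)
    let ?Z = "\<lambda>r. zonotope (map ((*\<^sub>R) r) vs)"
    have "compact (K + closed_segment (- v) v)" "convex (K + closed_segment (- v) v)"
      using Cons.prems by (auto intro: compact_set_plus convex_set_plus)
    then obtain p q where p: "\<And>r. r \<ge> 0 \<Longrightarrow> vol (K + ?Z r) = poly p r"
      and q: "\<And>r. r \<ge> 0 \<Longrightarrow> vol (K + closed_segment (- v) v + ?Z r) = poly q r"
      using Cons.IH Cons.prems by meson
    have "vol (K + zonotope (map ((*\<^sub>R) r) (v # vs))) = poly (p + [:0, 1:] * (q - p)) r" if "r \<ge> 0" for r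
    proof -
      have "vol (K + zonotope (map ((*\<^sub>R) r) (v # vs))) = vol ((K + ?Z r) + closed_segment (- (r *\<^sub>R v)) (r *\<^sub>R v))"
        by (simp add: ac_simps)
      also have "\<dots> = vol (K + ?Z r) + r * (vol ((K + ?Z r) + closed_segment (- v) v) - vol (K + ?Z r))"
        using Cons.prems that
        by (intro vol_plus_symmetric_segment) (auto intro: compact_set_plus convex_set_plus compact_zonotope convex_zonotope)
      also have "(K + ?Z r) + closed_segment (- v) v = K + closed_segment (- v) v + ?Z r"
        by (simp add: ac_simps)
      finally show ?thesis using p q that by simp
    qed
    then show ?case by blast
  qed
  then show thesis using that by blast
qed

lemma zonotope_inner_le:
  assumes "z \<in> zonotope vs" shows "a \<bullet> z \<le> (\<Sum>v\<leftarrow>vs. \<bar>a \<bullet> (v :: 'a::euclidean_space)\<bar>)"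
  using assms
proof (induction vs arbitrary: z)
  case (Cons v vs)
  then obtain s y where *: "s \<in> closed_segment (- v) v" "y \<in> zonotope vs" "z = s + y"
    by (auto elim: set_plus_elim)
  obtain t where t: "0 \<le> t" "t \<le> 1" "s = (1 - t) *\<^sub>R (- v) + t *\<^sub>R v"
    using *(1) unfolding closed_segment_def by blast
  have "a \<bullet> s = (2 * t - 1) * (a \<bullet> v)" by (simp add: t inner_simps algebra_simps)
  also have "\<dots> \<le> \<bar>2 * t - 1\<bar> * \<bar>a \<bullet> v\<bar>" by (simp add: abs_mult[symmetric])
  also have "\<dots> \<le> \<bar>a \<bullet> v\<bar>" using t by (intro mult_left_le_one_le) auto
  finally show ?case using Cons.IH[OF *(2)] by (simp add: *(3) inner_add_right)
qed simp

lemma zonotope_inner_attained: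
  "\<exists>z\<in>zonotope vs. a \<bullet> z = (\<Sum>v\<leftarrow>vs. \<bar>a \<bullet> (v :: 'a::euclidean_space)\<bar>)"
proof (induction vs)
  case (Cons v vs)
  then obtain z where z: "z \<in> zonotope vs" "a \<bullet> z = (\<Sum>v\<leftarrow>vs. \<bar>a \<bullet> v\<bar>)" by blast
  define s where "s = (if a \<bullet> v \<ge> 0 then v else - v)"
  have "s \<in> closed_segment (- v) v" "a \<bullet> s = \<bar>a \<bullet> v\<bar>" by (auto simp: s_def)
  then show ?case using z by (intro bexI[of _ "s + z"]) (auto simp: inner_add_right)
qed simp

text \<open>Inclusions of compact convex sets follow from comparing support functions on unit
  vectors: for the outer ball the direction of \<open>z\<close> itself is tested, for the inner one
  the normal of a hyperplane separating a missing point.\<close>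

lemma zonotope_cball_bounds:
  fixes vs :: "'a::euclidean_space list"
  assumes "\<And>a. norm a = 1 \<Longrightarrow> c1 \<le> (\<Sum>v\<leftarrow>vs. \<bar>a \<bullet> v\<bar>) \<and> (\<Sum>v\<leftarrow>vs. \<bar>a \<bullet> v\<bar>) \<le> c2"
    and "c2 \<ge> 0"
  shows "cball 0 c1 \<subseteq> zonotope vs" "zonotope vs \<subseteq> cball 0 c2"
proof -
  let ?h = "\<lambda>a. \<Sum>v\<leftarrow>vs. \<bar>a \<bullet> v\<bar>"
  have hom: "?h (t *\<^sub>R a) = t * ?h a" if "t \<ge> 0" for t a
    using that by (induction vs) (auto simp: abs_mult distrib_left)
  show "zonotope vs \<subseteq> cball 0 c2"
  proof
    fix z assume z: "z \<in> zonotope vs"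
    show "z \<in> cball 0 c2"
    proof (cases "z = 0")
      case False
      have "(z /\<^sub>R norm z) \<bullet> z \<le> c2"
        using zonotope_inner_le[OF z, of "z /\<^sub>R norm z"] assms(1)[of "z /\<^sub>R norm z"] False by simp
      then show ?thesis using False by (simp add: dot_square_norm power2_eq_square mult.assoc[symmetric])
    qed (use assms in simp)
  qed
  show "cball 0 c1 \<subseteq> zonotope vs"
  proof (rule ccontr)
    assume "\<not> cball 0 c1 \<subseteq> zonotope vs"
    then obtain w where "w \<in> cball 0 c1" and w0: "w \<notin> zonotope vs" by blast
    then have w: "norm w \<le> c1" "w \<notin> zonotope vs" by auto
    obtain a b where ab: "a \<bullet> w < b" "\<And>x. x \<in> zonotope vs \<Longrightarrow> a \<bullet> x > b"
      using separating_hyperplane_closed_point[OF convex_zonotope compact_imp_closed[OF compact_zonotope] w(2)]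
      by blast
    obtain z where z: "z \<in> zonotope vs" "- a \<bullet> z = ?h (- a)"
      using zonotope_inner_attained by blast
    have a: "a \<noteq> 0" using ab(1) ab(2)[OF z(1)] by auto
    have "norm a * c1 \<le> norm a * ?h (a /\<^sub>R norm a)"
      using assms(1)[of "a /\<^sub>R norm a"] a by (intro mult_left_mono) auto
    also have "\<dots> = ?h a" using hom[of "norm a" "a /\<^sub>R norm a"] a by simp
    also have "\<dots> = - a \<bullet> z" using z by simp
    also have "\<dots> < - (a \<bullet> w)" using ab(1) ab(2)[OF z(1)] by simp
    also have "\<dots> \<le> norm a * norm w" using norm_cauchy_schwarz[of "- a" w] by simp
    also have "\<dots> \<le> norm a * c1" using w by (intro mult_left_mono) auto
    finally show False by simp
  qed
qed


section \<open>Averages over the unit ball and zonotopes close to the ball\<close>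

lemma nn_integral_lborel_translation:
  fixes f :: "'a::euclidean_space \<Rightarrow> ennreal"
  assumes [measurable]: "f \<in> borel_measurable borel"
  shows "(\<integral>\<^sup>+x. f (c + x) \<partial>lborel) = (\<integral>\<^sup>+x. f x \<partial>lborel)"
proof -
  have "(\<integral>\<^sup>+x. f x \<partial>lborel) = (\<integral>\<^sup>+x. f x \<partial>distr lborel borel ((+) c))"
    by (simp add: lborel_distr_plus)
  then show ?thesis by (simp add: nn_integral_distr)
qed

(* Weighting with the unit ball B and using Fubini and translation invariance twice gives
   vol B * integral (g o T) = integral g(y) * vol {x. y - T x \<in> B} dy. *)
lemma nn_integral_linear_isometry:
  fixes g :: "'a::euclidean_space \<Rightarrow> ennreal"
  assumes g [measurable]: "g \<in> borel_measurable borel"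
    and T: "linear T" "\<And>x. norm (T x) = norm x" "\<And>x. T (T x) = x"
  shows "(\<integral>\<^sup>+x. g (T x) \<partial>lborel) = (\<integral>\<^sup>+x. g x \<partial>lborel)"
proof -
  let ?B = "indicator (cball 0 1 :: 'a set) :: 'a \<Rightarrow> ennreal"
  let ?k = "emeasure lborel (cball 0 1 :: 'a set)"
  have T_add: "T (x + y) = T x + T y" "T (x - y) = T x - T y" for x y
    using T(1) by (auto simp: linear_add linear_diff)
  have [measurable]: "T \<in> borel_measurable borel"
    using T(1) by (intro borel_measurable_continuous_onI linear_continuous_on linear_conv_bounded_linear[THEN iffD1])
  have [measurable]: "(cball 0 1 :: 'a set) \<in> sets borel" by simp
  have "?k * (\<integral>\<^sup>+x. g (T x) \<partial>lborel) = (\<integral>\<^sup>+y. ?B y * (\<integral>\<^sup>+x. g (T x) \<partial>lborel) \<partial>lborel)"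
    by (subst nn_integral_multc) simp_all
  also have "\<dots> = (\<integral>\<^sup>+y. (\<integral>\<^sup>+x. ?B y * g (T x + y) \<partial>lborel) \<partial>lborel)"
  proof (rule nn_integral_cong)
    fix y
    have "(\<integral>\<^sup>+x. g (T x) \<partial>lborel) = (\<integral>\<^sup>+x. g (T (T y + x)) \<partial>lborel)"
      by (rule nn_integral_lborel_translation[of "\<lambda>x. g (T x)", symmetric]) measurable
    also have "\<dots> = (\<integral>\<^sup>+x. g (T x + y) \<partial>lborel)"
      by (simp add: T_add T(3) add.commute)
    finally show "?B y * (\<integral>\<^sup>+x. g (T x) \<partial>lborel) = (\<integral>\<^sup>+x. ?B y * g (T x + y) \<partial>lborel)"
      by (simp add: nn_integral_cmult)
  qed
  also have "\<dots> = (\<integral>\<^sup>+x. (\<integral>\<^sup>+y. ?B y * g (T x + y) \<partial>lborel) \<partial>lborel)"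
    by (rule lborel_pair.Fubini') measurable
  also have "\<dots> = (\<integral>\<^sup>+x. (\<integral>\<^sup>+y. ?B (y - T x) * g y \<partial>lborel) \<partial>lborel)"
  proof (rule nn_integral_cong)
    fix x
    show "(\<integral>\<^sup>+y. ?B y * g (T x + y) \<partial>lborel) = (\<integral>\<^sup>+y. ?B (y - T x) * g y \<partial>lborel)"
      using nn_integral_lborel_translation[of "\<lambda>y. ?B (y - T x) * g y" "T x"] by simp
  qed
  also have "\<dots> = (\<integral>\<^sup>+y. (\<integral>\<^sup>+x. ?B (y - T x) * g y \<partial>lborel) \<partial>lborel)"
    by (rule lborel_pair.Fubini'[symmetric]) measurable
  also have "\<dots> = (\<integral>\<^sup>+y. ?k * g y \<partial>lborel)"
  proof (rule nn_integral_cong)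
    fix y
    have "?B (y - T x) = indicator (cball (T y) 1) x" for x
    proof -
      have "norm (y - T x) = norm (T (y - T x))" by (simp add: T(2))
      also have "\<dots> = norm (T y - x)" by (simp add: T_add T(3))
      finally show ?thesis by (simp add: indicator_def dist_norm norm_minus_commute[of "T x" y])
    qed
    then have "(\<integral>\<^sup>+x. ?B (y - T x) * g y \<partial>lborel) = emeasure lborel (cball (T y) 1) * g y"
      by (simp only:) (subst nn_integral_multc; simp add: borel_measurable_indicator_iff)
    also have "emeasure lborel (cball (T y) 1) = ?k"
      by (simp add: emeasure_cball)
    finally show "(\<integral>\<^sup>+x. ?B (y - T x) * g y \<partial>lborel) = ?k * g y" .
  qed
  also have "\<dots> = ?k * (\<integral>\<^sup>+y. g y \<partial>lborel)"
    by (simp add: nn_integral_cmult)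
  finally have "?k * (\<integral>\<^sup>+x. g (T x) \<partial>lborel) = ?k * (\<integral>\<^sup>+y. g y \<partial>lborel)" .
  moreover have "unit_ball_vol (real DIM('a)) \<noteq> 0"
    by (metis less_irrefl of_nat_0_le_iff unit_ball_vol_pos)
  then have "?k \<noteq> 0" "?k \<noteq> \<infinity>"
    by (simp_all add: emeasure_cball)
  ultimately show ?thesis by (simp add: ennreal_mult_cancel_left)
qed

text \<open>The witness is the reflection in the hyperplane orthogonal to \<open>a - b\<close>;
  equality of the norms is what makes it carry \<open>a\<close> to \<open>b\<close>.\<close>

lemma reflection_swap:
  fixes a b :: "'a::euclidean_space"
  assumes "norm a = norm b" "a \<noteq> b"
  obtains T where "linear T" "\<And>x. norm (T x) = norm x" "\<And>x. T (T x) = x" "\<And>x y. T x \<bullet> y = x \<bullet> T y" "T a = b"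
proof -
  define w where "w = a - b"
  define T where "T = (\<lambda>x. x - (2 * (x \<bullet> w) / (w \<bullet> w)) *\<^sub>R w)"
  have w: "w \<bullet> w \<noteq> 0" using assms by (simp add: w_def)
  have lin: "linear T"
    by (rule linearI) (simp_all add: T_def inner_simps algebra_simps add_divide_distrib)
  have sym: "T x \<bullet> y = x \<bullet> T y" for x y
    by (simp add: T_def inner_simps inner_commute)
  have inv: "T (T x) = x" for x
  proof -
    have "2 * (x \<bullet> w) / (w \<bullet> w) * (w \<bullet> w) = 2 * (x \<bullet> w)"
      using w by (simp only: times_divide_eq_left nonzero_mult_div_cancel_right not_False_eq_True)
    then have "T x \<bullet> w = - (x \<bullet> w)" unfolding T_def inner_diff_left inner_scaleR_left by linarith
    moreover have "T (T x) = T x - (2 * (T x \<bullet> w) / (w \<bullet> w)) *\<^sub>R w" by (simp only: T_def)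
    ultimately have "T (T x) = T x + (2 * (x \<bullet> w) / (w \<bullet> w)) *\<^sub>R w" by simp
    then show ?thesis by (simp add: T_def)
  qed
  have nrm: "norm (T x) = norm x" for x
    by (simp add: norm_eq_sqrt_inner sym inv)
  have "a \<bullet> a = b \<bullet> b" using assms(1) by (simp add: norm_eq)
  then have "2 * (a \<bullet> w) = w \<bullet> w" by (simp add: w_def inner_simps inner_commute)
  then have "T a = b" using w by (simp add: T_def w_def)
  then show thesis using that lin sym inv nrm by blast
qed

lemma ball_mean_abs_inner_const:
  fixes a b :: "'a::euclidean_space"
  assumes "norm a = norm b"
  shows "(\<integral>\<^sup>+u. indicator (cball 0 1) u * ennreal \<bar>a \<bullet> u\<bar> \<partial>lborel) =
    (\<integral>\<^sup>+u. indicator (cball 0 1) u * ennreal \<bar>b \<bullet> u\<bar> \<partial>lborel)"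
proof (cases "a = b")
  case False
  have [measurable]: "(cball 0 1 :: 'a set) \<in> sets borel" by simp
  obtain T where T: "linear T" "\<And>x. norm (T x) = norm x" "\<And>x. T (T x) = x"
    "\<And>x y. T x \<bullet> y = x \<bullet> T y" "T a = b"
    using reflection_swap[OF assms False] by metis
  have "(\<integral>\<^sup>+u. indicator (cball 0 1) u * ennreal \<bar>a \<bullet> u\<bar> \<partial>lborel) =
    (\<integral>\<^sup>+u. indicator (cball 0 1) (T u) * ennreal \<bar>a \<bullet> T u\<bar> \<partial>lborel)"
    by (rule nn_integral_linear_isometry[OF _ T(1-3), symmetric]) measurable
  also have "\<dots> = (\<integral>\<^sup>+u. indicator (cball 0 1) u * ennreal \<bar>b \<bullet> u\<bar> \<partial>lborel)"
    using T(2) by (intro nn_integral_cong) (simp add: T(4)[symmetric] T(5) indicator_def)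
  finally show ?thesis .
qed simp

text \<open>As a function of \<open>a\<close>, this integral is the support function of a limit of
  zonotopes. Its constancy on unit vectors says that the limit is a ball, of radius
  \<open>c\<close>, and \<open>c > 0\<close> because the integrand vanishes on the ball only along a
  null hyperplane.\<close>

lemma ball_mean_abs_inner:
  obtains c where "c > 0" "\<And>a :: 'a::euclidean_space. norm a = 1 \<Longrightarrow>
    integrable lborel (\<lambda>u. indicator (cball 0 1) u * \<bar>a \<bullet> u\<bar>) \<and>
    (LINT u|lborel. indicator (cball 0 1) u * \<bar>a \<bullet> u\<bar>) = c"
proof -
  let ?f = "\<lambda>(a::'a) u. indicator (cball 0 1) u * \<bar>a \<bullet> u\<bar>"
  have int: "integrable lborel (?f a)" for a :: 'a
  proof -
    have "integrable lborel (\<lambda>u. indicator (cball 0 1) u *\<^sub>R \<bar>a \<bullet> u\<bar>)"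
      by (rule borel_integrable_compact) (auto intro!: continuous_intros)
    then show ?thesis by simp
  qed
  obtain e :: 'a where e: "e \<in> Basis" using nonempty_Basis by blast
  define c where "c = (LINT u|lborel. ?f e u)"
  have c: "(LINT u|lborel. ?f a u) = c" if "norm a = 1" for a
  proof -
    have eq: "ennreal (?f a u) = indicator (cball 0 1) u * ennreal \<bar>a \<bullet> u\<bar>" for a u :: 'a
      by (simp add: indicator_def)
    have "ennreal (LINT u|lborel. ?f a u) = ennreal (LINT u|lborel. ?f e u)"
      using ball_mean_abs_inner_const[of a e] that e
      by (simp add: nn_integral_eq_integral[OF int, symmetric] eq)
    then show ?thesis by (simp add: c_def)
  qed
  have "c \<noteq> 0"
  proof
    assume "c = 0"
    then have "AE u in lborel. ?f e u = 0"
      unfolding c_def by (subst (asm) integral_nonneg_eq_0_iff_AE[OF int]) auto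
    moreover have "AE u in lborel. u \<notin> {x. e \<bullet> x = 0}"
    proof (rule AE_not_in)
      have "e \<noteq> 0" using e by auto
      then show "{x. e \<bullet> x = 0} \<in> null_sets lborel"
        using negligible_hyperplane[of e 0] closed_hyperplane[of e 0]
        by (simp add: negligible_iff_null_sets null_sets_completion_iff)
    qed
    ultimately have "AE u in lborel. u \<notin> (cball 0 1 :: 'a set)"
      by eventually_elim (auto simp: indicator_def split: if_splits)
    then have "emeasure lborel (cball 0 1 :: 'a set) = 0"
      by (subst (asm) AE_iff_measurable[of "cball 0 1"]) auto
    then show False using unit_ball_vol_pos[of "real DIM('a)"] by (simp add: emeasure_cball)
  qed
  moreover have "c \<ge> 0" unfolding c_def by (intro integral_nonneg_AE) auto
  ultimately show thesis using that[of c] int c by auto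
qed

text \<open>A simple function \<open>g\<close> close in mean to the identity on the ball, extended
  by 0, provides the segments: each value \<open>y\<close>, weighted by the measure of its fibre and
  divided by \<open>c\<close>. The support function is then the integral of
  \<open>\<bar>a \<bullet> g x\<bar>\<close> over \<open>c\<close>. Its error is at most the mean
  distance of \<open>F\<close> and \<open>g\<close> over \<open>c\<close>, uniformly in the unit
  vector \<open>a\<close>.\<close>

lemma zonotope_approximates_ball:
  assumes e: "e > 0" "e < 1"
  obtains vs :: "'a::euclidean_space list" where "cball 0 (1 - e) \<subseteq> zonotope vs" "zonotope vs \<subseteq> cball 0 (1 + e)"
proof -
  obtain c where c: "c > 0" and mean: "\<And>a :: 'a. norm a = 1 \<Longrightarrow>
    integrable lborel (\<lambda>u. indicator (cball 0 1) u * \<bar>a \<bullet> u\<bar>) \<and>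
    (LINT u|lborel. indicator (cball 0 1) u * \<bar>a \<bullet> u\<bar>) = c"
    using ball_mean_abs_inner by metis
  define F where "F = (\<lambda>u::'a. indicator (cball 0 1) u *\<^sub>R u)"
  have intF: "integrable lborel F"
    using borel_integrable_compact[of "cball 0 1 :: 'a set" "\<lambda>u. u"] by (simp add: F_def)
  then obtain s where s: "\<And>i. Bochner_Integration.simple_bochner_integrable lborel (s i)"
    "(\<lambda>i. \<integral>\<^sup>+x. norm (F x - s i x) \<partial>lborel) \<longlonglongrightarrow> 0"
    unfolding integrable.simps has_bochner_integral.simps by blast
  have "eventually (\<lambda>i. (\<integral>\<^sup>+x. norm (F x - s i x) \<partial>lborel) < ennreal (c * e)) sequentially"
    using order_tendstoD(2)[OF s(2), of "ennreal (c * e)"] c e by simp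
  then obtain i where i: "(\<integral>\<^sup>+x. norm (F x - s i x) \<partial>lborel) < ennreal (c * e)"
    by (auto simp: eventually_sequentially)
  define g where "g = s i"
  have g: "Bochner_Integration.simple_bochner_integrable lborel g" using s(1) by (simp add: g_def)
  then have fin: "finite (range g)" and sg: "simple_function lborel g"
    by (auto simp: simple_bochner_integrable.simps simple_function_def)
  have intg: "integrable lborel g" by (rule integrableI_simple_bochner_integrable[OF g])
  have dist: "(LINT x|lborel. norm (F x - g x)) < c * e"
  proof -
    have "ennreal (LINT x|lborel. norm (F x - g x)) < ennreal (c * e)"
      using i intF intg by (subst nn_integral_eq_integral[symmetric]) (auto simp: g_def)
    then show ?thesis using c e by (simp add: ennreal_less_iff)
  qed
  obtain ys where ys: "set ys = range g" "distinct ys"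
    using finite_distinct_list[OF fin] by blast
  define m where "m = (\<lambda>y. measure lborel {x. g x = y})"
  define vs where "vs = map (\<lambda>y. (m y / c) *\<^sub>R y) ys"
  have sum: "(\<Sum>v\<leftarrow>vs. \<bar>a \<bullet> v\<bar>) = (LINT x|lborel. \<bar>a \<bullet> g x\<bar>) / c" for a
  proof -
    have sb: "Bochner_Integration.simple_bochner_integrable lborel (\<lambda>x. \<bar>a \<bullet> g x\<bar>)"
      by (rule simple_bochner_integrable_compose2[of "\<lambda>x y. \<bar>a \<bullet> x\<bar>", OF _ g g]) auto
    have "(LINT x|lborel. \<bar>a \<bullet> g x\<bar>) = Bochner_Integration.simple_bochner_integral lborel (\<lambda>x. \<bar>a \<bullet> g x\<bar>)"
      by (rule simple_bochner_integrable_eq_integral[OF sb, symmetric])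
    also have "\<dots> = (\<Sum>y\<in>range g. m y *\<^sub>R \<bar>a \<bullet> y\<bar>)"
      unfolding m_def
      using simple_bochner_integral_partition[OF sb sg, of "\<lambda>y. \<bar>a \<bullet> y\<bar>"] by simp
    also have "\<dots> / c = (\<Sum>y\<leftarrow>ys. \<bar>a \<bullet> ((m y / c) *\<^sub>R y)\<bar>)"
      using ys c by (simp add: sum_list_distinct_conv_sum_set sum_divide_distrib abs_mult m_def)
    finally show ?thesis by (simp add: vs_def o_def)
  qed
  have close: "\<bar>(\<Sum>v\<leftarrow>vs. \<bar>a \<bullet> v\<bar>) - 1\<bar> \<le> e" if a: "norm a = 1" for a
  proof -
    have F: "\<bar>a \<bullet> F u\<bar> = indicator (cball 0 1) u * \<bar>a \<bullet> u\<bar>" for u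
      by (simp add: F_def indicator_def)
    have ig: "integrable lborel (\<lambda>x. \<bar>a \<bullet> g x\<bar>)" "integrable lborel (\<lambda>x. \<bar>a \<bullet> F x\<bar>)"
      using intg intF by auto
    have "\<bar>(LINT x|lborel. \<bar>a \<bullet> g x\<bar>) - c\<bar> = \<bar>LINT x|lborel. \<bar>a \<bullet> g x\<bar> - \<bar>a \<bullet> F x\<bar>\<bar>"
      using mean[OF a] ig by (simp add: F)
    also have "\<dots> \<le> (LINT x|lborel. \<bar>\<bar>a \<bullet> g x\<bar> - \<bar>a \<bullet> F x\<bar>\<bar>)"
      by (rule integral_abs_bound)
    also have "\<dots> \<le> (LINT x|lborel. norm (F x - g x))"
    proof (rule integral_mono)
      fix x
      have "\<bar>\<bar>a \<bullet> g x\<bar> - \<bar>a \<bullet> F x\<bar>\<bar> \<le> \<bar>a \<bullet> (F x - g x)\<bar>" by (simp add: inner_diff_right)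
      also have "\<dots> \<le> norm (F x - g x)" using Cauchy_Schwarz_ineq2[of a "F x - g x"] a by simp
      finally show "\<bar>\<bar>a \<bullet> g x\<bar> - \<bar>a \<bullet> F x\<bar>\<bar> \<le> norm (F x - g x)" .
    qed (use ig intF intg in auto)
    finally have "\<bar>(LINT x|lborel. \<bar>a \<bullet> g x\<bar>) - c\<bar> \<le> c * e" using dist by simp
    moreover have "(\<Sum>v\<leftarrow>vs. \<bar>a \<bullet> v\<bar>) - 1 = ((LINT x|lborel. \<bar>a \<bullet> g x\<bar>) - c) / c"
      using c by (simp add: sum field_simps)
    ultimately show ?thesis using c by (simp add: abs_divide pos_divide_le_eq mult.commute)
  qed
  have "1 - e \<le> (\<Sum>v\<leftarrow>vs. \<bar>a \<bullet> v\<bar>) \<and> (\<Sum>v\<leftarrow>vs. \<bar>a \<bullet> v\<bar>) \<le> 1 + e" if "norm a = 1" for a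
    using close[OF that] by linarith
  then show thesis
    using zonotope_cball_bounds[of "1 - e" vs "1 + e"] e that by auto
qed

section \<open>Steiner polynomials and the Urysohn inequality\<close>

lemma lead_coeff_nonneg:
  fixes p :: "real poly"
  assumes "\<And>x. x \<ge> x0 \<Longrightarrow> poly p x \<ge> 0"
  shows "lead_coeff p \<ge> 0"
proof (rule ccontr)
  assume "\<not> lead_coeff p \<ge> 0"
  then have "lead_coeff (- p) > 0" by simp
  then obtain n where n: "\<And>x. x \<ge> n \<Longrightarrow> poly (- p) x \<ge> lead_coeff (- p)"
    using poly_pinfty_gt_lc by blast
  have "poly p (max n x0) \<ge> 0" using assms by simp
  moreover have "poly (- p) (max n x0) > 0" using n[of "max n x0"] \<open>lead_coeff (- p) > 0\<close> by simp
  ultimately show False by simp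
qed

text \<open>Were the degree of \<open>p\<close> larger, \<open>p\<close> and \<open>q - p\<close>
  would have opposite leading coefficients although both are nonnegative for large
  arguments.\<close>

lemma degree_le_of_bounds:
  fixes p q :: "real poly"
  assumes p: "\<And>x. x \<ge> x0 \<Longrightarrow> 0 \<le> poly p x" and pq: "\<And>x. x \<ge> x0 \<Longrightarrow> poly p x \<le> poly q x"
    and q: "degree q \<le> n"
  shows "degree p \<le> n"
proof (rule ccontr)
  assume *: "\<not> degree p \<le> n"
  then have lt: "degree q < degree (- p)" using q by simp
  have "lead_coeff p \<ge> 0" using lead_coeff_nonneg p by blast
  moreover have "lead_coeff (q - p) \<ge> 0" by (rule lead_coeff_nonneg[of x0]) (use pq in simp)
  moreover have "lead_coeff (q - p) = - lead_coeff p"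
    using lead_coeff_add_le[OF lt] by simp
  ultimately have "lead_coeff p = 0" by linarith
  then have "p = 0" by simp
  then show False using * by simp
qed

text \<open>Once the higher coefficients agree, the coefficient of \<open>q - p\<close> at
  \<open>m\<close> is either its leading one or 0. Inequalities between volumes for large radii
  become inequalities between Steiner coefficients in this way.\<close>

lemma coeff_mono_of_le:
  fixes p q :: "real poly"
  assumes pq: "\<And>x. x \<ge> x0 \<Longrightarrow> poly p x \<le> poly q x"
    and eq: "\<And>i. i > m \<Longrightarrow> coeff p i = coeff q i"
  shows "coeff p m \<le> coeff q m"
proof -
  have deg: "degree (q - p) \<le> m" using eq by (intro degree_le) simp
  have "lead_coeff (q - p) \<ge> 0" by (rule lead_coeff_nonneg[of x0]) (use pq in simp)
  moreover have "coeff (q - p) m = 0" if "degree (q - p) \<noteq> m"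
    using deg that by (intro coeff_eq_0) simp
  ultimately have "coeff (q - p) m \<ge> 0"
    by (cases "degree (q - p) = m") auto
  then show ?thesis by simp
qed

text \<open>The nodes are \<open>0, ..., n\<close> because volumes of parallel bodies are given by a
  polynomial at nonnegative arguments only.\<close>

definition lagrange_basis :: "nat \<Rightarrow> nat \<Rightarrow> real poly" where
  "lagrange_basis n i = (\<Prod>j\<in>{..n} - {i}. smult (1 / (real i - real j)) [:- real j, 1:])"

lemma poly_lagrange_basis:
  assumes "i \<le> n" "j \<le> n"
  shows "poly (lagrange_basis n i) (real j) = (if i = j then 1 else 0)"
  using assms by (auto simp: lagrange_basis_def poly_prod diff_divide_distrib[symmetric] intro!: prod.neutral)

lemma degree_lagrange_basis:
  assumes "i \<le> n" shows "degree (lagrange_basis n i) \<le> n"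
proof -
  have "degree (lagrange_basis n i) \<le> (\<Sum>j\<in>{..n} - {i}. degree (smult (1 / (real i - real j)) [:- real j, 1:]))"
    unfolding lagrange_basis_def by (rule order.trans[OF degree_prod_sum_le]) (simp_all add: o_def)
  also have "\<dots> \<le> (\<Sum>j\<in>{..n} - {i}. 1)" by (intro sum_mono) simp
  also have "\<dots> = n" using assms by simp
  finally show ?thesis .
qed

lemma lagrange_interpolation:
  fixes p :: "real poly"
  assumes "degree p \<le> n"
  shows "p = (\<Sum>i\<le>n. smult (poly p (real i)) (lagrange_basis n i))"
proof (rule poly_eqI_degree[of "real ` {..n}"])
  fix x :: real assume "x \<in> real ` {..n}"
  then obtain j where j: "j \<le> n" "x = real j" by auto
  then show "poly p x = poly (\<Sum>i\<le>n. smult (poly p (real i)) (lagrange_basis n i)) x"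
    by (simp add: poly_sum poly_lagrange_basis if_distrib cong: if_cong)
next
  have card: "card (real ` {..n}) = Suc n" by (simp add: card_image inj_on_def)
  show "degree p < card (real ` {..n})" using assms card by simp
  have "degree (\<Sum>i\<le>n. smult (poly p (real i)) (lagrange_basis n i)) \<le> n"
    by (intro degree_sum_le) (auto intro: order.trans[OF degree_smult_le] degree_lagrange_basis)
  then show "degree (\<Sum>i\<le>n. smult (poly p (real i)) (lagrange_basis n i)) < card (real ` {..n})"
    using card by simp
qed

text \<open>With the degree bounded by \<open>n\<close>, the values at \<open>n + 1\<close> nodes
  determine a polynomial linearly, so convergence at the nodes fixes the limit everywhere.\<close>

lemma polynomial_pointwise_limit:
  fixes p :: "nat \<Rightarrow> real poly"
  assumes deg: "\<And>k. degree (p k) \<le> n" and lim: "\<And>x. x \<ge> 0 \<Longrightarrow> (\<lambda>k. poly (p k) x) \<longlonglongrightarrow> f x"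
  obtains q where "degree q \<le> n" "\<And>x. x \<ge> 0 \<Longrightarrow> poly q x = f x"
proof -
  define q where "q = (\<Sum>i\<le>n. smult (f (real i)) (lagrange_basis n i))"
  have "degree q \<le> n"
    unfolding q_def by (intro degree_sum_le) (auto intro: order.trans[OF degree_smult_le] degree_lagrange_basis)
  moreover have "poly q x = f x" if "x \<ge> 0" for x
  proof (rule LIMSEQ_unique[OF _ lim[OF that]])
    have "poly (p k) x = (\<Sum>i\<le>n. poly (p k) (real i) * poly (lagrange_basis n i) x)" for k
      using arg_cong[OF lagrange_interpolation[OF deg[of k]], of "\<lambda>p. poly p x"] by (simp add: poly_sum)
    then show "(\<lambda>k. poly (p k) x) \<longlonglongrightarrow> poly q x"
      by (simp add: q_def poly_sum) (intro tendsto_intros lim, simp)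
  qed
  ultimately show thesis using that by blast
qed

section \<open>Existence of the Steiner polynomial\<close>

text \<open>As \<open>0 \<in> K\<close>, the set \<open>K\<close> lies in \<open>t K\<close>, so
  enlarging the radius by the factor \<open>t\<close> costs at most a dilation of the whole sum.
  This takes the place of continuity of the volume in the radius.\<close>

lemma set_plus_cball_scaleR_subset:
  fixes K :: "'a::euclidean_space set"
  assumes "convex K" "0 \<in> K" "t \<ge> 1"
  shows "K + cball 0 (t * r) \<subseteq> (*\<^sub>R) t ` (K + cball 0 r)"
proof
  fix z assume "z \<in> K + cball 0 (t * r)"
  then obtain x y where xy: "x \<in> K" "norm y \<le> t * r" "z = x + y" by (auto elim!: set_plus_elim)
  have "(1 / t) *\<^sub>R x \<in> K"
    using convexD_alt[OF assms(1,2) xy(1), of "1 / t"] assms(3) by simp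
  moreover have "(1 / t) *\<^sub>R y \<in> cball 0 r" using xy(2) assms(3) by (simp add: pos_divide_le_eq mult.commute)
  ultimately have "(1 / t) *\<^sub>R x + (1 / t) *\<^sub>R y \<in> K + cball 0 r" by (rule set_plus_intro)
  moreover have "z = t *\<^sub>R ((1 / t) *\<^sub>R x + (1 / t) *\<^sub>R y)" using assms(3) xy by (simp add: scaleR_add_right)
  ultimately show "z \<in> (*\<^sub>R) t ` (K + cball 0 r)" by blast
qed

lemma vol_plus_cball_scale_le:
  fixes K :: "'a::euclidean_space set"
  assumes "compact K" "convex K" "0 \<in> K" "t \<ge> 1"
  shows "vol (K + cball 0 (t * r)) \<le> t ^ DIM('a) * vol (K + cball 0 r)"
proof -
  have "compact (K + cball 0 r)" "compact (K + cball 0 (t * r))" using assms by (auto intro: compact_set_plus)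
  then show ?thesis
    using set_plus_cball_scaleR_subset[OF assms(2-4), of r] assms(4)
      vol_mono_compact[of "K + cball 0 (t * r)" "(*\<^sub>R) t ` (K + cball 0 r)"]
    by (simp add: vol_scaleR compact_scaling compact_imp_closed borel_closed)
qed

lemma vol_cball: "r \<ge> 0 \<Longrightarrow> vol (cball (x :: 'a::euclidean_space) r) = kappa TYPE('a) * r ^ DIM('a)"
  by (simp add: kappa_def content_cball)

lemma kappa_pos: "kappa TYPE('a::euclidean_space) > 0"
  by (simp add: kappa_def)

lemma vol_plus_cball_upper:
  fixes K :: "'a::euclidean_space set"
  assumes "K \<subseteq> cball 0 R" "R \<ge> 0" "compact K" "Z \<subseteq> cball 0 r" "compact Z" "r \<ge> 0"
  shows "vol (K + Z) \<le> kappa TYPE('a) * (R + r) ^ DIM('a)"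
proof -
  have "K + Z \<subseteq> cball 0 R + cball 0 r" using assms by (intro set_plus_mono2)
  then have "K + Z \<subseteq> cball 0 (R + r)" using assms by (simp add: cball_plus_cball)
  then have "vol (K + Z) \<le> vol (cball (0::'a) (R + r))"
    using assms by (intro vol_mono_compact borel_compact) (auto intro: compact_set_plus)
  then show ?thesis using assms by (simp add: vol_cball)
qed

text \<open>The polynomial of a zonotope could a priori have as high a degree as there are segments,
  and this number is not bounded along the approximation. Comparison with the volume of a large ball
  lowers the degree to \<open>DIM('a)\<close>, after which the pointwise limit is again a
  polynomial.\<close>

lemma steiner_polynomial_origin:
  fixes K :: "'a::euclidean_space set"
  assumes K: "compact K" "convex K" "0 \<in> K"
  obtains p where "degree p \<le> DIM('a)" "\<And>r. r \<ge> 0 \<Longrightarrow> poly p r = vol (K + cball 0 r)"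
proof -
  let ?n = "DIM('a)"
  obtain R where "R > 0" "\<forall>x\<in>K. norm x \<le> R"
    using compact_imp_bounded[OF K(1)] unfolding bounded_pos by blast
  then have R: "K \<subseteq> cball 0 R" "R > 0" by auto
  \<comment> \<open>The sequence starts at 1/2 because \<open>zonotope_approximates_ball\<close>
    needs an error below 1.\<close>
  define e where "e = (\<lambda>k. inverse (real (Suc (Suc k))))"
  have e: "0 < e k" "e k < 1" for k by (auto simp: e_def inverse_less_1_iff)
  have "e \<longlonglongrightarrow> 0" unfolding e_def using LIMSEQ_Suc[OF LIMSEQ_inverse_real_of_nat] by simp
  have "\<exists>vs :: 'a list. cball 0 (1 - e k) \<subseteq> zonotope vs \<and> zonotope vs \<subseteq> cball 0 (1 + e k)" for k
    using zonotope_approximates_ball[OF e] by metis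
  then obtain vs :: "nat \<Rightarrow> 'a list" where vs: "\<And>k. cball 0 (1 - e k) \<subseteq> zonotope (vs k)"
    "\<And>k. zonotope (vs k) \<subseteq> cball 0 (1 + e k)" by metis
  let ?Z = "\<lambda>k r. zonotope (map ((*\<^sub>R) r) (vs k))"
  have Z: "cball 0 (r * (1 - e k)) \<subseteq> ?Z k r" "?Z k r \<subseteq> cball 0 (r * (1 + e k))" if "r \<ge> 0" for k r
  proof -
    have ball: "(*\<^sub>R) r ` cball 0 c = cball (0::'a) (r * c)" if "c > 0" for c
    proof (cases "r = 0")
      case False
      then show ?thesis using \<open>r \<ge> 0\<close> cball_scale[of r 0 c] by simp
    qed (use that in \<open>simp add: image_constant_conv\<close>)
    show "cball 0 (r * (1 - e k)) \<subseteq> ?Z k r" "?Z k r \<subseteq> cball 0 (r * (1 + e k))"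
      unfolding zonotope_scaleR
      using image_mono[OF vs(1)[of k], of "(*\<^sub>R) r"] image_mono[OF vs(2)[of k], of "(*\<^sub>R) r"]
        ball[of "1 - e k"] ball[of "1 + e k"] e[of k] by (simp_all add: add_pos_pos)
  qed
  have "\<exists>p. \<forall>r\<ge>0. vol (K + ?Z k r) = poly p r" for k
    using vol_plus_zonotope_poly[OF K(1,2)] by metis
  then obtain p where p: "\<And>k r. r \<ge> 0 \<Longrightarrow> vol (K + ?Z k r) = poly (p k) r" by metis
  have deg: "degree (p k) \<le> ?n" for k
  proof (rule degree_le_of_bounds)
    show "degree (smult (kappa TYPE('a)) ([:R, 1 + e k:] ^ ?n)) \<le> ?n"
      using degree_power_le[of "[:R, 1 + e k:]" ?n]
      by (intro order.trans[OF degree_smult_le]) (simp split: if_splits)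
    fix r :: real assume r: "r \<ge> 0"
    show "0 \<le> poly (p k) r" using p[OF r] by (metis measure_nonneg)
    have "vol (K + ?Z k r) \<le> kappa TYPE('a) * (R + r * (1 + e k)) ^ ?n"
      using R K e[of k] r Z[OF r] by (intro vol_plus_cball_upper compact_zonotope) auto
    then show "poly (p k) r \<le> poly (smult (kappa TYPE('a)) ([:R, 1 + e k:] ^ ?n)) r"
      using p[OF r] by simp
  qed
  have lim: "(\<lambda>k. poly (p k) r) \<longlonglongrightarrow> vol (K + cball 0 r)" if r: "r \<ge> 0" for r
  proof (rule tendsto_sandwich)
    have cpt: "compact (K + cball 0 s)" "compact (K + ?Z k s)" for k s
      using K by (auto intro: compact_set_plus compact_zonotope)
    show "eventually (\<lambda>k. poly (p k) r \<le> (1 + e k) ^ ?n * vol (K + cball 0 r)) sequentially"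
    proof (rule always_eventually, rule allI)
      fix k
      have "poly (p k) r \<le> vol (K + cball 0 ((1 + e k) * r))"
        unfolding p[OF r, symmetric] using cpt Z[OF r]
        by (intro vol_mono_compact set_plus_mono2) (auto simp: mult.commute compact_imp_closed borel_closed)
      also have "\<dots> \<le> (1 + e k) ^ ?n * vol (K + cball 0 r)"
        using K e[of k] by (intro vol_plus_cball_scale_le) auto
      finally show "poly (p k) r \<le> (1 + e k) ^ ?n * vol (K + cball 0 r)" .
    qed
    show "eventually (\<lambda>k. (1 - e k) ^ ?n * vol (K + cball 0 r) \<le> poly (p k) r) sequentially"
    proof (rule always_eventually, rule allI)
      fix k
      have "vol (K + cball 0 r) = vol (K + cball 0 (1 / (1 - e k) * ((1 - e k) * r)))"
        using e[of k] by simp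
      also have "\<dots> \<le> (1 / (1 - e k)) ^ ?n * vol (K + cball 0 ((1 - e k) * r))"
        using K e[of k] by (intro vol_plus_cball_scale_le) auto
      also have "\<dots> \<le> (1 / (1 - e k)) ^ ?n * poly (p k) r"
        unfolding p[OF r, symmetric] using cpt Z[OF r] e[of k]
        by (intro mult_left_mono vol_mono_compact set_plus_mono2) (auto simp: mult.commute compact_imp_closed borel_closed)
      finally show "(1 - e k) ^ ?n * vol (K + cball 0 r) \<le> poly (p k) r"
        using e[of k] by (simp add: power_divide pos_le_divide_eq mult.commute)
    qed
    have "(\<lambda>k. (1 + e k) ^ ?n * vol (K + cball 0 r)) \<longlonglongrightarrow> (1 + 0) ^ ?n * vol (K + cball 0 r)"
      "(\<lambda>k. (1 - e k) ^ ?n * vol (K + cball 0 r)) \<longlonglongrightarrow> (1 - 0) ^ ?n * vol (K + cball 0 r)"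
      by (intro tendsto_intros \<open>e \<longlonglongrightarrow> 0\<close>)+
    then show "(\<lambda>k. (1 + e k) ^ ?n * vol (K + cball 0 r)) \<longlonglongrightarrow> vol (K + cball 0 r)"
      "(\<lambda>k. (1 - e k) ^ ?n * vol (K + cball 0 r)) \<longlonglongrightarrow> vol (K + cball 0 r)" by simp_all
  qed
  show thesis
    using polynomial_pointwise_limit[of p ?n "\<lambda>r. vol (K + cball 0 r)", OF deg lim] that by blast
qed

lemma steiner_polynomial_exists:
  fixes K :: "'a::euclidean_space set"
  assumes K: "compact K" "convex K" "K \<noteq> {}"
  obtains p where "degree p \<le> DIM('a)" "\<And>r. r \<ge> 0 \<Longrightarrow> poly p r = vol (K + cball 0 r)"
proof -
  obtain x where x: "x \<in> K" using K(3) by blast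
  let ?L = "(+) (- x) ` K"
  have "compact ?L" "convex ?L" "0 \<in> ?L"
    using K x by (auto intro: compact_translation convex_translation image_eqI[of _ _ x] simp del: uminus_add_conv_diff)
  then obtain p where p: "degree p \<le> DIM('a)" "\<And>r. r \<ge> 0 \<Longrightarrow> poly p r = vol (?L + cball 0 r)"
    using steiner_polynomial_origin[of ?L] by metis
  have "vol (?L + cball 0 r) = vol (K + cball 0 r)" for r
  proof -
    have "?L + cball 0 r = (+) (- x) ` (K + cball 0 r)"
      by (force simp: set_plus_def image_iff)
    then show ?thesis using vol_translation[OF compact_set_plus[OF K(1) compact_cball], of "- x" 0 r] by simp
  qed
  then show thesis using that p by metis
qed


section \<open>Quermassintegrals as Steiner coefficients\<close>

text \<open>The \<open>THE\<close> in \<open>quermassintegral\<close> denotes: a competing sequence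
  gives a polynomial of degree at most \<open>DIM('a)\<close> that agrees with \<open>p\<close> at
  \<open>DIM('a) + 1\<close> integers, and indices above \<open>DIM('a)\<close> are fixed to
  0.\<close>

lemma quermassintegral_eq_coeff:
  fixes K :: "'a::euclidean_space set"
  assumes ne: "K \<noteq> {}" and deg: "degree p \<le> DIM('a)" and p: "\<And>r. r \<ge> 0 \<Longrightarrow> poly p r = vol (K + cball 0 r)"
    and i: "i \<le> DIM('a)"
  shows "real (DIM('a) choose i) * quermassintegral i K = coeff p i"
proof -
  let ?n = "DIM('a)"
  define w where "w = (\<lambda>j. coeff p j / real (?n choose j))"
  let ?P = "\<lambda>w :: nat \<Rightarrow> real. (\<forall>j > ?n. w j = 0) \<and>
              (\<forall>\<rho> \<ge> 0. vol (K + cball 0 \<rho>) = (\<Sum>j = 0..?n. real (?n choose j) * w j * \<rho> ^ j))"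
  have "(THE w. ?P w) = w"
  proof (rule the_equality)
    have "poly p \<rho> = (\<Sum>j = 0..?n. real (?n choose j) * w j * \<rho> ^ j)" for \<rho>
    proof -
      have "poly p \<rho> = (\<Sum>j\<le>?n. coeff p j * \<rho> ^ j)"
        unfolding poly_altdef using deg by (intro sum.mono_neutral_left) (auto simp: coeff_eq_0)
      then show ?thesis by (simp add: w_def atLeast0AtMost)
    qed
    then show "?P w" using p deg by (auto simp: w_def coeff_eq_0)
  next
    fix v assume v: "?P v"
    define q where "q = (\<Sum>j\<le>?n. monom (real (?n choose j) * v j) j)"
    have "degree q \<le> ?n"
      unfolding q_def by (intro degree_sum_le) (auto intro: order.trans[OF degree_monom_le])
    moreover have "poly q x = poly p x" if "x \<ge> 0" for x
      using v p that by (simp add: q_def poly_sum poly_monom atLeast0AtMost)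
    moreover have "card (real ` {..?n}) = Suc ?n" by (simp add: card_image inj_on_def)
    ultimately have "q = p"
      using deg by (intro poly_eqI_degree[of "real ` {..?n}"]) auto
    moreover have "coeff q j = real (?n choose j) * v j" if "j \<le> ?n" for j
      using that by (simp add: q_def coeff_sum if_distrib cong: if_cong)
    ultimately have "v j = w j" if "j \<le> ?n" for j
      using that by (simp add: w_def)
    moreover have "v j = w j" if "j > ?n" for j
      using that v deg by (simp add: w_def coeff_eq_0)
    ultimately show "v = w" by (intro ext) (metis not_le)
  qed
  then have "quermassintegral i K = w i"
    using ne by (simp add: quermassintegral_def)
  then show ?thesis using i by (simp add: w_def)
qed

abbreviation mean_quermass :: "'a::euclidean_space set \<Rightarrow> real" where
  "mean_quermass K \<equiv> quermassintegral (DIM('a) - 1) K"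

lemma choose_pred_self: "n > 0 \<Longrightarrow> n choose (n - Suc 0) = n"
  by (subst binomial_symmetric) auto

lemma coeff_linear_power_gt: "i > n \<Longrightarrow> coeff ([:a, b:] ^ n) i = (0 :: real)"
  by (intro coeff_eq_0 le_less_trans[OF degree_power_le]) (auto intro: le_less_trans)

text \<open>The volume lies between \<open>kappa * r ^ n\<close> and
  \<open>kappa * (R + r) ^ n\<close>, which fixes the leading coefficient. Being the same for all
  bodies, it makes the next coefficient, the mean width, accessible to
  \<open>coeff_mono_of_le\<close>.\<close>

lemma steiner_top_coeffs:
  fixes K :: "'a::euclidean_space set"
  assumes K: "compact K" "convex K" "K \<noteq> {}"
  obtains p where "\<And>r. r \<ge> 0 \<Longrightarrow> poly p r = vol (K + cball 0 r)" "degree p \<le> DIM('a)"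
    "coeff p DIM('a) = kappa TYPE('a)" "coeff p (DIM('a) - 1) = real DIM('a) * mean_quermass K"
proof -
  let ?n = "DIM('a)" and ?k = "kappa TYPE('a)"
  obtain p where deg: "degree p \<le> ?n" and p: "\<And>r. r \<ge> 0 \<Longrightarrow> poly p r = vol (K + cball 0 r)"
    using steiner_polynomial_exists[OF K] by metis
  have "coeff p (?n - 1) = real ?n * mean_quermass K"
    using quermassintegral_eq_coeff[OF K(3) deg p, of "?n - 1"] by (simp add: choose_pred_self)
  moreover have "coeff p ?n = ?k"
  proof (rule antisym)
    obtain R where "R > 0" "\<forall>x\<in>K. norm x \<le> R"
      using compact_imp_bounded[OF K(1)] unfolding bounded_pos by blast
    then have R: "K \<subseteq> cball 0 R" "R > 0" by auto
    have "coeff p ?n \<le> coeff (smult ?k ([:R, 1:] ^ ?n)) ?n"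
    proof (rule coeff_mono_of_le[of 0])
      fix r :: real assume "r \<ge> 0"
      then show "poly p r \<le> poly (smult ?k ([:R, 1:] ^ ?n)) r"
        using vol_plus_cball_upper[OF R(1) _ K(1), of "cball 0 r" r] R(2) p by simp
    next
      fix i assume "i > ?n"
      then show "coeff p i = coeff (smult ?k ([:R, 1:] ^ ?n)) i"
        using deg by (simp add: coeff_eq_0 coeff_linear_power_gt)
    qed
    then show "coeff p ?n \<le> ?k" by (simp add: coeff_linear_poly_power)
    have "coeff (smult ?k ([:0, 1:] ^ ?n)) ?n \<le> coeff p ?n"
    proof (rule coeff_mono_of_le[of 0])
      fix r :: real assume r: "r \<ge> 0"
      obtain x where x: "x \<in> K" using K(3) by blast
      have "cball x r = {x} + cball 0 r" using cball_plus_cball[of 0 r x 0] r by simp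
      also have "\<dots> \<subseteq> K + cball 0 r" using x by (intro set_plus_mono2) auto
      finally have "vol (cball x r) \<le> vol (K + cball 0 r)"
        using K by (intro vol_mono_compact compact_set_plus) auto
      then show "poly (smult ?k ([:0, 1:] ^ ?n)) r \<le> poly p r"
        using r p by (simp add: vol_cball)
    next
      fix i assume "i > ?n"
      then show "coeff (smult ?k ([:0, 1:] ^ ?n)) i = coeff p i"
        using deg by (simp add: coeff_eq_0 coeff_linear_power_gt)
    qed
    then show "?k \<le> coeff p ?n" by (simp add: coeff_linear_poly_power)
  qed
  ultimately show thesis using that p deg by blast
qed

text \<open>The lower bound has the leading coefficient of the Steiner polynomial, so the next
  coefficients, \<open>n * kappa * e\<close> and \<open>n * mean_quermass K\<close>, are ordered as
  well.\<close>

lemma mean_quermass_ge: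
  fixes K :: "'a::euclidean_space set"
  assumes K: "compact K" "convex K" "K \<noteq> {}"
    and lower: "\<And>r. r \<ge> r0 \<Longrightarrow> r \<ge> 0 \<Longrightarrow> kappa TYPE('a) * (r + e) ^ DIM('a) \<le> vol (K + cball 0 r)"
  shows "kappa TYPE('a) * e \<le> mean_quermass K"
proof -
  let ?n = "DIM('a)" and ?k = "kappa TYPE('a)"
  obtain p where p: "\<And>r. r \<ge> 0 \<Longrightarrow> poly p r = vol (K + cball 0 r)" "degree p \<le> ?n"
    "coeff p ?n = ?k" "coeff p (?n - 1) = real ?n * mean_quermass K"
    using steiner_top_coeffs[OF K] by metis
  have "coeff (smult ?k ([:e, 1:] ^ ?n)) (?n - 1) \<le> coeff p (?n - 1)"
  proof (rule coeff_mono_of_le[of "max 0 r0"])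
    fix r assume "r \<ge> max 0 r0"
    then show "poly (smult ?k ([:e, 1:] ^ ?n)) r \<le> poly p r"
      using lower[of r] p(1) by (simp add: add.commute)
  next
    fix i assume "i > ?n - 1"
    then have "i = ?n \<or> i > ?n" by linarith
    then show "coeff (smult ?k ([:e, 1:] ^ ?n)) i = coeff p i"
      using p(2,3) by (auto simp: coeff_eq_0 coeff_linear_poly_power coeff_linear_power_gt)
  qed
  moreover have "?n - (?n - 1) = 1" using DIM_positive[where 'a='a] by linarith
  ultimately have "real ?n * (?k * e) \<le> real ?n * mean_quermass K"
    unfolding p(4) by (simp add: coeff_linear_poly_power choose_pred_self ac_simps)
  then show ?thesis by simp
qed

text \<open>Serves to show that the mean width of a level decreases with the level and hence is
  measurable in it.\<close>

lemma mean_quermass_mono: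
  fixes K L :: "'a::euclidean_space set"
  assumes K: "compact K" "convex K" "K \<noteq> {}" and L: "compact L" "convex L" and "K \<subseteq> L"
  shows "mean_quermass K \<le> mean_quermass L"
proof -
  let ?n = "DIM('a)" and ?k = "kappa TYPE('a)"
  have "L \<noteq> {}" using assms by auto
  obtain p where p: "\<And>r. r \<ge> 0 \<Longrightarrow> poly p r = vol (K + cball 0 r)" "degree p \<le> ?n"
    "coeff p ?n = ?k" "coeff p (?n - 1) = real ?n * mean_quermass K"
    using steiner_top_coeffs[OF K] by metis
  obtain q where q: "\<And>r. r \<ge> 0 \<Longrightarrow> poly q r = vol (L + cball 0 r)" "degree q \<le> ?n"
    "coeff q ?n = ?k" "coeff q (?n - 1) = real ?n * mean_quermass L"
    using steiner_top_coeffs[OF L \<open>L \<noteq> {}\<close>] by metis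
  have "coeff p (?n - 1) \<le> coeff q (?n - 1)"
  proof (rule coeff_mono_of_le[of 0])
    fix r :: real assume "r \<ge> 0"
    moreover have "vol (K + cball 0 r) \<le> vol (L + cball 0 r)"
      using K L assms(6) by (intro vol_mono_compact set_plus_mono2 borel_compact compact_set_plus) auto
    ultimately show "poly p r \<le> poly q r" using p(1) q(1) by simp
  next
    fix i assume "i > ?n - 1"
    then have "i = ?n \<or> i > ?n" by linarith
    then show "coeff p i = coeff q i" using p(2,3) q(2,3) by (auto simp: coeff_eq_0)
  qed
  then show ?thesis unfolding p(4) q(4) by simp
qed

lemma mean_quermass_cball:
  fixes x :: "'a::euclidean_space"
  assumes "R \<ge> 0"
  shows "mean_quermass (cball x R) = kappa TYPE('a) * R"
proof -
  let ?n = "DIM('a)" and ?k = "kappa TYPE('a)"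
  let ?p = "smult ?k ([:R, 1:] ^ ?n)"
  have "degree ?p \<le> ?n"
    using degree_power_le[of "[:R, 1:]" ?n] by (intro order.trans[OF degree_smult_le]) simp
  moreover have "poly ?p r = vol (cball x R + cball 0 r)" if "r \<ge> 0" for r
    using that assms by (simp add: cball_plus_cball vol_cball)
  ultimately have "real (?n choose (?n - 1)) * mean_quermass (cball x R) = coeff ?p (?n - 1)"
    using assms by (intro quermassintegral_eq_coeff) auto
  moreover have "?n - (?n - 1) = 1" using DIM_positive[where 'a='a] by linarith
  ultimately show ?thesis by (simp add: coeff_linear_poly_power choose_pred_self)
qed

lemma quermassintegral_empty: "quermassintegral i ({} :: 'a::euclidean_space set) = 0"
  by (simp add: quermassintegral_def)

section \<open>The volume radius and Urysohn's inequality\<close>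

text \<open>The radius of a ball with the volume of \<open>K\<close>; in these terms Urysohn's
  inequality compares \<open>K\<close> with that ball.\<close>

definition vol_radius :: "'a::euclidean_space set \<Rightarrow> real" where
  "vol_radius K = root DIM('a) (vol K / kappa TYPE('a))"

lemma vol_radius_nonneg: "vol_radius K \<ge> 0"
  by (simp add: vol_radius_def kappa_pos less_imp_le)

lemma vol_eq_vol_radius: "vol (K :: 'a::euclidean_space set) = kappa TYPE('a) * vol_radius K ^ DIM('a)"
  using kappa_pos[where 'a='a] by (simp add: vol_radius_def)

lemma brunn_minkowski_vol_radius:
  fixes A B :: "'a::euclidean_space set"
  assumes "compact A" "A \<noteq> {}" "compact B" "B \<noteq> {}"
  shows "kappa TYPE('a) * (vol_radius A + vol_radius B) ^ DIM('a) \<le> vol (A + B)"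
proof -
  let ?k = "kappa TYPE('a)"
  have k: "?k > 0" by (rule kappa_pos)
  have r: "root DIM('a) (vol C) = root DIM('a) ?k * vol_radius C" for C :: "'a set"
    using k by (simp add: vol_radius_def real_root_divide)
  have "?k * (vol_radius A + vol_radius B) ^ DIM('a) = (root DIM('a) (vol A) + root DIM('a) (vol B)) ^ DIM('a)"
    unfolding r distrib_left[symmetric] power_mult_distrib using k by simp
  then show ?thesis using brunn_minkowski[OF assms] by simp
qed

lemma vol_radius_cball:
  assumes "r \<ge> 0" shows "vol_radius (cball (x :: 'a::euclidean_space) r) = r"
  using assms kappa_pos[where 'a='a] by (simp add: vol_radius_def vol_cball real_root_power_cancel)

text \<open>For \<open>r \<ge> s\<close>, Brunn--Minkowski is applied to \<open>K + s B\<close> and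
  \<open>(r - s) B\<close>. The choice \<open>s = 0\<close> is Urysohn's inequality;
  \<open>s = 1\<close> turns equality in it into an upper bound for \<open>vol (K + B)\<close>, the
  reverse of Brunn--Minkowski.\<close>

lemma mean_quermass_ge_parallel:
  fixes K :: "'a::euclidean_space set"
  assumes K: "compact K" "convex K" "K \<noteq> {}" and s: "s \<ge> 0"
  shows "kappa TYPE('a) * (vol_radius (K + cball 0 s) - s) \<le> mean_quermass K"
proof (rule mean_quermass_ge[OF K])
  fix r assume r: "r \<ge> s"
  have "K + cball 0 r = (K + cball 0 s) + cball 0 (r - s)"
    using r s by (simp add: add.assoc cball_plus_cball)
  moreover have "kappa TYPE('a) * (vol_radius (K + cball 0 s) + vol_radius (cball (0::'a) (r - s))) ^ DIM('a)
      \<le> vol ((K + cball 0 s) + cball 0 (r - s))"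
  proof (rule brunn_minkowski_vol_radius)
    obtain x where "x \<in> K" using K by blast
    then have "x + 0 \<in> K + cball 0 s" using s by (intro set_plus_intro) auto
    then show "K + cball 0 s \<noteq> {}" by blast
  qed (use K r in \<open>auto intro: compact_set_plus\<close>)
  ultimately show "kappa TYPE('a) * (r + (vol_radius (K + cball 0 s) - s)) ^ DIM('a) \<le> vol (K + cball 0 r)"
    using r by (simp add: vol_radius_cball algebra_simps)
qed

theorem urysohn:
  fixes K :: "'a::euclidean_space set"
  assumes "compact K" "convex K"
  shows "kappa TYPE('a) * vol_radius K \<le> mean_quermass K"
proof (cases "K = {}")
  case True
  then show ?thesis by (simp add: vol_radius_def quermassintegral_empty)
next
  case False
  then show ?thesis using mean_quermass_ge_parallel[OF assms False, of 0] by simp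
qed

lemma mean_quermass_nonneg:
  fixes K :: "'a::euclidean_space set"
  assumes "compact K" "convex K"
  shows "mean_quermass K \<ge> 0"
  using urysohn[OF assms] vol_radius_nonneg[of K] kappa_pos[where 'a='a]
  by (smt (verit) mult_nonneg_nonneg)

lemma urysohn_equality_parallel:
  fixes K :: "'a::euclidean_space set"
  assumes K: "compact K" "convex K" "K \<noteq> {}" and eq: "mean_quermass K = kappa TYPE('a) * vol_radius K"
  shows "vol (K + cball 0 1) \<le> kappa TYPE('a) * (vol_radius K + 1) ^ DIM('a)"
proof -
  have "kappa TYPE('a) * (vol_radius (K + cball 0 1) - 1) \<le> kappa TYPE('a) * vol_radius K"
    using mean_quermass_ge_parallel[OF K, of 1] eq by simp
  then have "vol_radius (K + cball 0 1) \<le> vol_radius K + 1"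
    using kappa_pos[where 'a='a] by simp
  then show ?thesis
    unfolding vol_eq_vol_radius[of "K + cball 0 1"] using kappa_pos[where 'a='a] vol_radius_nonneg
    by (intro mult_left_mono power_mono) (auto simp: less_imp_le)
qed

section \<open>Equality in the Urysohn inequality\<close>

text \<open>A convex body is the closure of its interior, so an open set that meets it also meets
  its interior, in a non-empty open set.\<close>

lemma open_Int_convex_not_null:
  fixes C :: "'a::euclidean_space set"
  assumes C: "compact C" "convex C" "interior C \<noteq> {}" and S: "open S" "C \<inter> S \<noteq> {}"
    and D: "compact D" "C \<inter> S \<subseteq> D"
  shows "vol D > 0"
proof -
  have "closure (interior C) = C"
    using convex_closure_interior[OF C(2,3)] C(1) by (simp add: compact_imp_closed)
  then have "interior C \<inter> S \<noteq> {}"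
    using S open_Int_closure_eq_empty[OF S(1), of "interior C"] by (metis inf_commute)
  moreover have "open (interior C \<inter> S)" by (intro open_Int open_interior S)
  moreover have "interior C \<inter> S \<subseteq> D" using D interior_subset by blast
  ultimately have "\<not> negligible D" using open_not_negligible negligible_subset by blast
  then have "measure lebesgue D \<noteq> 0"
    using lmeasurable_compact[OF D(1)] by (simp add: negligible_iff_measure)
  then show ?thesis using D(1) by (simp add: borel_compact zero_less_measure_iff)
qed

text \<open>A point of \<open>C\<close> outside the closed set \<open>U\<close> would bring with it
  a piece of \<open>C\<close> of positive volume that misses \<open>U\<close>.\<close>

lemma convex_full_measure_subset:
  fixes C :: "'a::euclidean_space set"
  assumes C: "compact C" "convex C" "interior C \<noteq> {}" and U: "compact U" "U \<subseteq> C" "vol C \<le> vol U"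
  shows "U = C"
proof (rule ccontr)
  assume "U \<noteq> C"
  then obtain z where z: "z \<in> C" "z \<notin> U" using U by blast
  have "open (- U)" using U by (simp add: compact_imp_closed open_Compl)
  then obtain e where e: "e > 0" "cball z e \<subseteq> - U" using z by (metis ComplI open_contains_cball)
  let ?D = "C \<inter> cball z e"
  have cD: "compact ?D" using C by (simp add: compact_Int)
  have "z \<in> C \<inter> ball z e" using z e by simp
  then have "C \<inter> ball z e \<noteq> {}" by blast
  moreover have "C \<inter> ball z e \<subseteq> ?D" by auto
  ultimately have "vol ?D > 0"
    using open_Int_convex_not_null[OF C open_ball _ cD, of z e] by blast
  moreover have "vol (U \<union> ?D) = vol U + vol ?D"
    using e by (intro vol_Un_negligible U cD) (auto intro: negligible_subset[OF negligible_empty])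
  moreover have "vol (U \<union> ?D) \<le> vol C"
    using U cD C by (intro vol_mono_compact borel_compact compact_Un) auto
  ultimately show False using U by simp
qed

lemma interior_plus_cball:
  fixes K :: "'a::euclidean_space set"
  assumes "K \<noteq> {}" "r > 0"
  shows "interior (K + cball 0 r) \<noteq> {}"
proof -
  obtain x where x: "x \<in> K" using assms by blast
  have "cball x r = {x} + cball 0 r" using cball_plus_cball[of 0 r x 0] assms(2) by simp
  also have "\<dots> \<subseteq> K + cball 0 r" using x by (intro set_plus_mono2) auto
  finally have "ball x r \<subseteq> interior (K + cball 0 r)"
    by (metis interior_cball interior_mono)
  then show ?thesis using assms(2) by (metis centre_in_ball empty_iff subset_empty)
qed

section \<open>Equality in Brunn--Minkowski for a convex body and the ball\<close>

lemma root_sum_proportional: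
  assumes "n > 0" "s \<ge> 0"
  shows "(root n (s * p) + root n (s * q)) ^ n = s * (root n p + root n q) ^ n"
proof -
  have "root n (s * p) + root n (s * q) = root n s * (root n p + root n q)"
    by (simp add: real_root_mult distrib_left)
  then show ?thesis using assms by (simp add: power_mult_distrib)
qed

(* Halfspaces with parallel boundaries cutting off the same volume fraction from K and from the ball
   split K + B, because Brunn-Minkowski is applied to both pairs of pieces without loss. *)
lemma brunn_minkowski_ball_equality_cut:
  fixes K :: "'a::euclidean_space set"
  assumes K: "compact K" "convex K" "vol K > 0"
    and eq: "vol (K + cball 0 1) \<le> (root DIM('a) (vol K) + root DIM('a) (vol (cball (0::'a) 1))) ^ DIM('a)"
    and u: "u \<noteq> 0" and ne: "K \<inter> {x. x \<bullet> u \<le> a} \<noteq> {}" "K \<inter> {x. x \<bullet> u \<ge> a} \<noteq> {}"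
  obtains b where
    "vol (K \<inter> {x. x \<bullet> u \<le> a}) / vol K * vol (cball (0::'a) 1) = vol (cball (0::'a) 1 \<inter> {x. x \<bullet> u \<le> b})"
    "K + cball 0 1 = (K \<inter> {x. x \<bullet> u \<le> a}) + (cball 0 1 \<inter> {x. x \<bullet> u \<le> b}) \<union>
      ((K \<inter> {x. x \<bullet> u \<ge> a}) + (cball 0 1 \<inter> {x. x \<bullet> u \<ge> b}))"
proof -
  let ?n = "DIM('a)"
  define B where "B = (cball 0 1 :: 'a set)"
  let ?K1 = "K \<inter> {x. x \<bullet> u \<le> a}" and ?K2 = "K \<inter> {x. x \<bullet> u \<ge> a}"
  define s where "s = vol ?K1 / vol K"
  have splitK: "vol K = vol ?K1 + vol ?K2" by (rule vol_halfspace_split[OF K(1) u])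
  have s: "0 \<le> s" "s \<le> 1" "vol ?K1 = s * vol K" "vol ?K2 = (1 - s) * vol K"
    using splitK K(3) by (auto simp: s_def field_simps)
  have B: "compact B" "vol B > 0" using kappa_pos[where 'a='a] by (auto simp: B_def vol_cball)
  have "\<bar>x \<bullet> u\<bar> \<le> norm u" if "x \<in> B" for x
  proof -
    have "\<bar>x \<bullet> u\<bar> \<le> norm x * norm u" by (rule Cauchy_Schwarz_ineq2)
    also have "\<dots> \<le> norm u" using that by (intro mult_left_le_one_le) (auto simp: B_def)
    finally show ?thesis .
  qed
  then obtain b where b: "- norm u \<le> b" "b \<le> norm u" "vol (B \<inter> {x. x \<bullet> u \<le> b}) = s * vol B"
    using vol_halfspace_ivt[OF B(1) u, of "norm u" "s * vol B"] s B(2) by (auto simp: mult_left_le_one_le)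
  let ?B1 = "B \<inter> {x. x \<bullet> u \<le> b}" and ?B2 = "B \<inter> {x. x \<bullet> u \<ge> b}"
  have B2: "vol ?B2 = (1 - s) * vol B"
    using vol_halfspace_split[OF B(1) u, of b] b(3) by (simp add: algebra_simps)
  have "u /\<^sub>R norm u \<in> B" "(u /\<^sub>R norm u) \<bullet> u = norm u" "- (u /\<^sub>R norm u) \<in> B" "- (u /\<^sub>R norm u) \<bullet> u = - norm u"
    using u by (auto simp: B_def dot_square_norm power2_eq_square)
  then have "u /\<^sub>R norm u \<in> ?B2" "- (u /\<^sub>R norm u) \<in> ?B1" using b by auto
  then have neB: "?B1 \<noteq> {}" "?B2 \<noteq> {}" by blast+
  note cpt = compact_Int_halfspace[OF K(1), where u = u and d = a] compact_Int_halfspace[OF B(1), where u = u and d = b]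
  let ?M = "(root ?n (vol K) + root ?n (vol B)) ^ ?n"
  let ?U = "(?K1 + ?B1) \<union> (?K2 + ?B2)"
  have "s * ?M \<le> vol (?K1 + ?B1)"
    using brunn_minkowski[OF cpt(1) ne(1) cpt(3) neB(1)] s
    unfolding b(3) s(3) by (simp add: root_sum_proportional)
  moreover have "(1 - s) * ?M \<le> vol (?K2 + ?B2)"
    using brunn_minkowski[OF cpt(2) ne(2) cpt(4) neB(2)] s
    unfolding B2 s(4) by (simp add: root_sum_proportional)
  moreover have "vol (?K1 + ?B1) + vol (?K2 + ?B2) = vol ?U"
    by (rule vol_plus_halfspaces[OF K(1) B(1) u]) (use cpt in auto)
  ultimately have vol: "vol (K + B) \<le> vol ?U"
    using eq by (simp add: B_def algebra_simps)
  have "?U = K + B"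
  proof (rule convex_full_measure_subset[OF _ _ _ _ _ vol])
    show "compact (K + B)" "convex (K + B)"
      using K B by (auto intro: compact_set_plus convex_set_plus simp: B_def)
    show "interior (K + B) \<noteq> {}"
      unfolding B_def using ne by (intro interior_plus_cball) auto
    show "compact ?U" using cpt by (intro compact_Un compact_set_plus)
    show "?U \<subseteq> K + B" by (intro Un_least set_plus_mono2) auto
  qed
  then show thesis using that[of b] b(3) by (simp add: s_def B_def)
qed

definition support_point :: "'a::euclidean_space set \<Rightarrow> 'a \<Rightarrow> 'a \<Rightarrow> bool" where
  "support_point K v p \<longleftrightarrow> p \<in> K \<and> (\<forall>x\<in>K. x \<bullet> v \<le> p \<bullet> v)"

lemma support_point_exists:
  fixes K :: "'a::euclidean_space set"
  assumes "compact K" "K \<noteq> {}"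
  shows "\<exists>p. support_point K v p"
proof -
  have "\<exists>p\<in>K. \<forall>x\<in>K. x \<bullet> v \<le> p \<bullet> v"
    using assms by (intro continuous_attains_sup) (auto intro!: continuous_intros)
  then show ?thesis by (auto simp: support_point_def)
qed

text \<open>The ball is strictly convex, so the point \<open>p + v\<close>, extremal in direction
  \<open>v\<close>, decomposes in one way only. When a cut splits \<open>K + B\<close>, this tells
  on which side \<open>p\<close> and \<open>v\<close> lie.\<close>

lemma support_point_plus_ball_unique:
  fixes K :: "'a::euclidean_space set"
  assumes p: "support_point K v p" and v: "norm v = 1"
    and xy: "x \<in> K" "y \<in> cball 0 1" "p + v = x + y"
  shows "y = v" "x = p"
proof -
  have vv: "v \<bullet> v = 1" using v by (simp add: dot_square_norm)
  have "x \<bullet> v \<le> p \<bullet> v" using p xy by (simp add: support_point_def)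
  moreover have "p \<bullet> v + 1 = x \<bullet> v + y \<bullet> v" using arg_cong[OF xy(3), of "\<lambda>z. z \<bullet> v"] vv by (simp add: inner_add_left)
  ultimately have "y \<bullet> v \<ge> 1" by linarith
  moreover have "y \<bullet> y \<le> 1" using xy(2) by (simp add: dot_square_norm power_le_one)
  ultimately have "(y - v) \<bullet> (y - v) \<le> 0" using vv by (simp add: inner_diff inner_commute)
  then show "y = v" by (metis inner_eq_zero_iff inner_ge_zero antisym right_minus_eq)
  then show "x = p" using xy(3) by simp
qed

text \<open>If \<open>p \<bullet> u < a < q \<bullet> u\<close>, the cut of \<open>K\<close> at
  height \<open>a\<close> puts \<open>p + v\<close> into the lower sum and \<open>q + w\<close> into
  the upper one, so the matching cut of the ball is at height
  \<open>v \<bullet> u = w \<bullet> u\<close> whatever \<open>a\<close> is. The volume of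
  \<open>K\<close> below \<open>a\<close> would then not depend on \<open>a\<close>, although
  \<open>K\<close> has positive volume between any two such heights.\<close>

lemma brunn_minkowski_ball_equality_support:
  fixes K :: "'a::euclidean_space set"
  assumes K: "compact K" "convex K" "vol K > 0"
    and eq: "vol (K + cball 0 1) \<le> (root DIM('a) (vol K) + root DIM('a) (vol (cball (0::'a) 1))) ^ DIM('a)"
    and v: "norm v = 1" "norm w = 1" and p: "support_point K v p" and q: "support_point K w q"
    and u: "v \<bullet> u = w \<bullet> u"
  shows "p \<bullet> u \<ge> q \<bullet> u"
proof (rule ccontr)
  assume "\<not> p \<bullet> u \<ge> q \<bullet> u"
  then have lt: "p \<bullet> u < q \<bullet> u" by simp
  then have u0: "u \<noteq> 0" by auto
  have pq: "p \<in> K" "q \<in> K" using p q by (auto simp: support_point_def)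
  let ?B = "cball 0 1 :: 'a set"
  have cut: "vol (K \<inter> {x. x \<bullet> u \<le> a}) / vol K * vol ?B = vol (?B \<inter> {x. x \<bullet> u \<le> v \<bullet> u})"
    if a: "p \<bullet> u < a" "a < q \<bullet> u" for a
  proof -
    have ne: "K \<inter> {x. x \<bullet> u \<le> a} \<noteq> {}" "K \<inter> {x. x \<bullet> u \<ge> a} \<noteq> {}"
      using pq a by (auto simp: less_imp_le)
    obtain b where b: "vol (K \<inter> {x. x \<bullet> u \<le> a}) / vol K * vol ?B = vol (?B \<inter> {x. x \<bullet> u \<le> b})"
      "K + ?B = (K \<inter> {x. x \<bullet> u \<le> a}) + (?B \<inter> {x. x \<bullet> u \<le> b}) \<union>
        ((K \<inter> {x. x \<bullet> u \<ge> a}) + (?B \<inter> {x. x \<bullet> u \<ge> b}))"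
      by (rule brunn_minkowski_ball_equality_cut[OF K eq u0 ne])
    have side: "z \<bullet> u \<le> a \<and> t \<bullet> u \<le> b \<or> z \<bullet> u \<ge> a \<and> t \<bullet> u \<ge> b"
      if "norm t = 1" "support_point K t z" for t z
    proof -
      have "z + t \<in> K + ?B" using that by (intro set_plus_intro) (auto simp: support_point_def)
      then obtain x y where xy: "x \<in> K" "y \<in> ?B" "z + t = x + y"
        "x \<bullet> u \<le> a \<and> y \<bullet> u \<le> b \<or> x \<bullet> u \<ge> a \<and> y \<bullet> u \<ge> b"
        unfolding b(2) by (auto elim!: set_plus_elim)
      then show ?thesis using support_point_plus_ball_unique[OF that(2,1) xy(1-3)] by simp
    qed
    have "v \<bullet> u = b"
      using side[OF v(1) p] side[OF v(2) q] a u by linarith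
    then show ?thesis using b(1) by simp
  qed
  \<comment> \<open>Cuts at one third and two thirds, so that the midpoint of \<open>p\<close> and
    \<open>q\<close> lies strictly between them.\<close>
  define d where "d = (q \<bullet> u - p \<bullet> u) / 3"
  define a1 where "a1 = p \<bullet> u + d"
  define a2 where "a2 = p \<bullet> u + 2 * d"
  have a: "p \<bullet> u < a1" "a1 < a2" "a2 < q \<bullet> u"
    using lt by (simp_all add: d_def a1_def a2_def field_simps)
  have "vol (K \<inter> {x. x \<bullet> u \<le> a1}) / vol K * vol ?B = vol (K \<inter> {x. x \<bullet> u \<le> a2}) / vol K * vol ?B"
    using cut[of a1] cut[of a2] a by simp
  then have same: "vol (K \<inter> {x. x \<bullet> u \<le> a1}) = vol (K \<inter> {x. x \<bullet> u \<le> a2})"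
    using K(3) by (simp add: zero_less_measure_iff)
  let ?S = "(K \<inter> {x. x \<bullet> u \<le> a2}) \<inter> {x. x \<bullet> u \<ge> a1}"
  have "(K \<inter> {x. x \<bullet> u \<le> a2}) \<inter> {x. x \<bullet> u \<le> a1} = K \<inter> {x. x \<bullet> u \<le> a1}" using a by auto
  then have "vol ?S = 0"
    using vol_halfspace_split[OF compact_Int_halfspace(1)[OF K(1), of u a2] u0, of a1] same by simp
  moreover have "vol ?S > 0"
  proof (rule open_Int_convex_not_null[OF K(1,2)])
    have "\<not> negligible K" using vol_negligible[OF K(1)] K(3) by auto
    then show "interior K \<noteq> {}" using K(2) negligible_convex_interior by blast
    show "open ({x. a1 < x \<bullet> u} \<inter> {x. x \<bullet> u < a2})"
      by (intro open_Int open_Collect_less continuous_intros)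
    have "midpoint p q \<in> K"
      using convexD[OF K(2) pq, of "1/2" "1/2"] by (simp add: midpoint_def scaleR_add_right)
    moreover have "midpoint p q \<bullet> u = (p \<bullet> u + q \<bullet> u) / 2"
      by (simp add: midpoint_def inner_add_left)
    moreover have "a1 < (p \<bullet> u + q \<bullet> u) / 2" "(p \<bullet> u + q \<bullet> u) / 2 < a2"
      using lt by (simp_all add: a1_def a2_def d_def field_simps)
    ultimately have "midpoint p q \<in> K \<inter> ({x. a1 < x \<bullet> u} \<inter> {x. x \<bullet> u < a2})" by simp
    then show "K \<inter> ({x. a1 < x \<bullet> u} \<inter> {x. x \<bullet> u < a2}) \<noteq> {}" by blast
    show "compact ?S" using K(1) by (intro compact_Int_halfspace)
  qed auto
  ultimately show False by simp
qed

section \<open>Recovering a ball from its support points\<close>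

text \<open>A line meets the sphere in at most two points: for \<open>y = z + w\<close> and
  \<open>x = z + k w\<close>, the unit norms force \<open>k = 0\<close> or
  \<open>k = 1\<close>.\<close>

lemma sphere_parallel_differences:
  fixes x y z :: "'a::euclidean_space"
  assumes "norm x = 1" "norm y = 1" "norm z = 1" "x \<noteq> y" "x \<noteq> z" "y \<noteq> z"
    and eq: "a *\<^sub>R (x - z) = b *\<^sub>R (y - z)"
  shows "a = 0"
proof (rule ccontr)
  assume a: "a \<noteq> 0"
  define w where "w = y - z"
  define k where "k = b / a"
  have "x - z = k *\<^sub>R w"
    using arg_cong[OF eq, of "\<lambda>t. (1 / a) *\<^sub>R t"] a by (simp add: k_def w_def)
  then have x: "x = z + k *\<^sub>R w" by (simp add: algebra_simps)
  have y: "y = z + w" by (simp add: w_def)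
  have "z \<bullet> z = 1" "x \<bullet> x = 1" "y \<bullet> y = 1" using assms by (auto simp: dot_square_norm)
  then have 1: "2 * k * (z \<bullet> w) + k * k * (w \<bullet> w) = 0" and 2: "2 * (z \<bullet> w) + w \<bullet> w = 0"
    by (simp_all add: x y inner_add inner_commute algebra_simps)
  have "k * (k - 1) * (w \<bullet> w) = (2 * k * (z \<bullet> w) + k * k * (w \<bullet> w)) - k * (2 * (z \<bullet> w) + w \<bullet> w)"
    by (simp add: algebra_simps)
  then have "k * (k - 1) * (w \<bullet> w) = 0" using 1 2 by simp
  moreover have "w \<noteq> 0" using assms by (simp add: w_def)
  ultimately have "k = 0 \<or> k = 1" by simp
  then show False using x y assms by auto
qed

lemma ball_of_parallel_support_points:
  fixes K :: "'a::euclidean_space set"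
  assumes K: "compact K" "convex K"
    and p: "\<And>v. norm v = 1 \<Longrightarrow> support_point K v (p v)"
    and par: "\<And>v w u. norm v = 1 \<Longrightarrow> norm w = 1 \<Longrightarrow> v \<bullet> u = w \<bullet> u \<Longrightarrow> p v \<bullet> u = p w \<bullet> u"
  obtains c r where "r \<ge> 0" "K = cball c r"
proof -
  have "\<exists>l. p v - p w = l *\<^sub>R (v - w)" if "norm v = 1" "norm w = 1" for v w
  proof (cases "v = w")
    case False
    define d where "d = v - w"
    define l where "l = ((p v - p w) \<bullet> d) / (d \<bullet> d)"
    \<comment> \<open>The component of \<open>p v - p w\<close> orthogonal to \<open>v - w\<close>.
      Used as test direction in \<open>par\<close>, it turns out orthogonal to itself.\<close>
    define u where "u = (p v - p w) - l *\<^sub>R d"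
    have "d \<bullet> d \<noteq> 0" using False by (simp add: d_def)
    then have du: "d \<bullet> u = 0" by (simp add: u_def l_def inner_diff_right inner_commute)
    then have "p v \<bullet> u = p w \<bullet> u" using par[OF that, of u] by (simp add: d_def inner_diff_left)
    then have "u \<bullet> u = 0" using du by (simp add: u_def inner_diff_left)
    then show ?thesis by (intro exI[of _ l]) (simp add: u_def d_def)
  qed simp
  then obtain l where l: "\<And>v w. norm v = 1 \<Longrightarrow> norm w = 1 \<Longrightarrow> p v - p w = l v w *\<^sub>R (v - w)" by metis
  obtain e :: 'a where e: "norm e = 1" by (rule vector_choose_size[of 1]) auto
  \<comment> \<open>The antipodal pair \<open>e\<close>, \<open>- e\<close> fixes radius and centre;
    any further \<open>v\<close> completes it to three distinct points of the sphere, which forces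
    the factor \<open>l e v\<close> to be \<open>r\<close>.\<close>
  define r where "r = l e (- e)"
  define c where "c = p e - r *\<^sub>R e"
  have pv: "p v = c + r *\<^sub>R v" if v: "norm v = 1" for v
  proof -
    have ne: "e \<noteq> - e"
    proof
      assume "e = - e"
      then have "e + e = 0" by (metis add.right_inverse)
      then have "2 *\<^sub>R e = 0" by (simp only: scaleR_2)
      then show False using e by simp
    qed
    consider "v = e" | "v = - e" | "v \<noteq> e" "v \<noteq> - e" by blast
    then show ?thesis
    proof cases
      case 1
      then show ?thesis by (simp add: c_def)
    next
      case 2
      then show ?thesis using l[OF e, of "- e"] e by (simp add: c_def r_def algebra_simps)
    next
      case 3
      have "p e - p v = (p e - p (- e)) + (p (- e) - p v)" by simp
      then have "l e v *\<^sub>R (e - v) = r *\<^sub>R (e - - e) + l (- e) v *\<^sub>R (- e - v)"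
        using l e v by (simp add: r_def)
      then have "(r - l e v) *\<^sub>R (e - v) = (r - l (- e) v) *\<^sub>R (- e - v)"
        by (simp add: algebra_simps)
      then have "r - l e v = 0"
        using sphere_parallel_differences[of e "- e" v "r - l e v" "r - l (- e) v"] e v ne 3 by auto
      then show ?thesis using l[OF e v] by (simp add: c_def algebra_simps)
    qed
  qed
  have sup: "x \<bullet> v \<le> c \<bullet> v + r" if "x \<in> K" "norm v = 1" for x v
    using p[OF that(2)] that pv[OF that(2)] by (simp add: support_point_def inner_add_left dot_square_norm)
  have pK: "p v \<in> K" if "norm v = 1" for v using p[OF that] by (simp add: support_point_def)
  have "r \<ge> 0"
    using sup[OF pK[of "- e"], of e] pv[of "- e"] e by (simp add: inner_diff_left dot_square_norm)
  moreover have "K = cball c r"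
  proof (intro equalityI subsetI)
    fix x assume x: "x \<in> K"
    show "x \<in> cball c r"
    proof (cases "x = c")
      case False
      define v where "v = (x - c) /\<^sub>R norm (x - c)"
      have "norm v = 1" using False by (simp add: v_def)
      then have "(x - c) \<bullet> v \<le> r" using sup[OF x] by (simp add: inner_diff_left algebra_simps)
      moreover have "(x - c) \<bullet> v = norm (x - c)"
        using False by (simp add: v_def dot_square_norm power2_eq_square)
      ultimately show ?thesis by (simp add: dist_norm norm_minus_commute)
    qed (use \<open>r \<ge> 0\<close> in simp)
  next
    fix x assume x: "x \<in> cball c r"
    show "x \<in> K"
    proof (rule ccontr)
      assume "x \<notin> K"
      then obtain a b where ab: "a \<bullet> x < b" "\<And>y. y \<in> K \<Longrightarrow> a \<bullet> y > b"
        using separating_hyperplane_closed_point[OF K(2) compact_imp_closed[OF K(1)]] by blast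
      have "a \<noteq> 0" using ab(1) ab(2)[OF pK[OF e]] by auto
      define v where "v = - (a /\<^sub>R norm a)"
      have v: "norm v = 1" and av: "a = - norm a *\<^sub>R v" using \<open>a \<noteq> 0\<close> by (simp_all add: v_def)
      have "a \<bullet> x < a \<bullet> p v" using ab(1) ab(2)[OF pK[OF v]] by simp
      then have "norm a * (v \<bullet> p v) < norm a * (v \<bullet> x)" by (subst (asm) (1 2) av) simp
      then have "v \<bullet> p v < v \<bullet> x" by (rule mult_left_less_imp_less) simp
      then have "r < v \<bullet> (x - c)" using v by (simp add: pv[OF v] inner_add_right inner_diff_right dot_square_norm)
      also have "\<dots> \<le> norm (x - c)" using norm_cauchy_schwarz[of v "x - c"] v by simp
      finally show False using x by (simp add: dist_norm norm_minus_commute)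
    qed
  qed
  ultimately show thesis using that by blast
qed

theorem urysohn_equality:
  fixes K :: "'a::euclidean_space set"
  assumes K: "compact K" "convex K" "K \<noteq> {}" and eq: "mean_quermass K = kappa TYPE('a) * vol_radius K"
  obtains c r where "r \<ge> 0" "K = cball c r"
proof (cases "vol K = 0")
  \<comment> \<open>A null \<open>K\<close> is treated directly: \<open>K + B\<close> has no more
    volume than one unit ball inside it, hence equals that ball, and \<open>K\<close> is a single
    point.\<close>
  case True
  obtain x where x: "x \<in> K" using K by blast
  have up: "vol (K + cball 0 1) \<le> vol (cball x 1)"
    using urysohn_equality_parallel[OF K eq] True by (simp add: vol_radius_def vol_cball)
  have sub: "cball y 1 \<subseteq> K + cball 0 1" if "y \<in> K" for y
  proof -
    have "cball y 1 = {y} + cball 0 1" using cball_plus_cball[of 0 1 y 0] by simp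
    also have "\<dots> \<subseteq> K + cball 0 1" using that by (intro set_plus_mono2) auto
    finally show ?thesis .
  qed
  have ball: "cball x 1 = K + cball 0 1"
    by (rule convex_full_measure_subset[OF _ _ _ _ sub[OF x] up])
      (use K interior_plus_cball[OF K(3), of 1] in \<open>auto intro: compact_set_plus convex_set_plus\<close>)
  have "y = x" if "y \<in> K" for y
    using sub[OF that] unfolding ball[symmetric] by (simp add: cball_subset_cball_iff)
  then have "K = {x}" using x by blast
  then show thesis using that[of 0 x] by simp
next
  case False
  then have pos: "vol K > 0" by (simp add: zero_less_measure_iff)
  let ?k = "kappa TYPE('a)"
  have "?k * (vol_radius K + 1) ^ DIM('a) = (root DIM('a) (vol K) + root DIM('a) ?k) ^ DIM('a)"
  proof -
    have "root DIM('a) (vol K) + root DIM('a) ?k = root DIM('a) ?k * (vol_radius K + 1)"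
      using kappa_pos[where 'a='a] by (simp add: vol_radius_def real_root_divide field_simps)
    then show ?thesis using kappa_pos[where 'a='a] by (simp add: power_mult_distrib)
  qed
  then have eq': "vol (K + cball 0 1) \<le> (root DIM('a) (vol K) + root DIM('a) (vol (cball (0::'a) 1))) ^ DIM('a)"
    using urysohn_equality_parallel[OF K eq] by (simp add: vol_cball)
  define p where "p = (\<lambda>v. SOME q. support_point K v q)"
  have p: "support_point K v (p v)" for v
    unfolding p_def by (rule someI_ex[OF support_point_exists[OF K(1,3)]])
  have "p v \<bullet> u = p w \<bullet> u" if "norm v = 1" "norm w = 1" "v \<bullet> u = w \<bullet> u" for v w u
    using brunn_minkowski_ball_equality_support[OF K(1,2) pos eq' that(1,2) p p that(3)]
      brunn_minkowski_ball_equality_support[OF K(1,2) pos eq' that(2,1) p p that(3)[symmetric]] by simp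
  then show thesis
    using ball_of_parallel_support_points[OF K(1,2), of p] p that by metis
qed

section \<open>Layer-cake form of the Minkowski integral inequality\<close>

text \<open>The explicit remainder shows that equality forces \<open>y = l\<close>. Passing from
  \<open>m\<close> to \<open>m + 1\<close> multiplies the right-hand side by \<open>l\<close> and
  adds \<open>(m + 2) * y ^ (m + 1) * (y - l) ^ 2\<close>.\<close>

lemma young_power_gap:
  fixes y l :: real
  assumes "y \<ge> 0" "l > 0"
  shows "l ^ m * (y - l)\<^sup>2 \<le> real (Suc m) * y ^ Suc (Suc m) + l ^ Suc (Suc m) - real (Suc (Suc m)) * l * y ^ Suc m"
proof (induction m)
  case 0
  then show ?case by (simp add: power2_eq_square algebra_simps)
next
  case (Suc m)
  have "l * (l ^ m * (y - l)\<^sup>2) \<le> l * (real (Suc m) * y ^ Suc (Suc m) + l ^ Suc (Suc m) - real (Suc (Suc m)) * l * y ^ Suc m)"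
    using Suc assms by (intro mult_left_mono) auto
  moreover have "0 \<le> real (Suc (Suc m)) * y ^ Suc m * (y - l)\<^sup>2" using assms by simp
  ultimately show ?case by (simp add: power2_eq_square algebra_simps)
qed

lemma young_power:
  fixes y l :: real
  assumes "y \<ge> 0" "l > 0" "n > 0"
  shows "real n * l * y ^ (n - 1) \<le> (real n - 1) * y ^ n + l ^ n"
    and "n \<ge> 2 \<Longrightarrow> real n * l * y ^ (n - 1) = (real n - 1) * y ^ n + l ^ n \<Longrightarrow> y = l"
proof -
  consider "n = 1" | m where "n = Suc (Suc m)"
    using assms(3) by (metis One_nat_def not0_implies_Suc less_numeral_extra(3))
  then have "real n * l * y ^ (n - 1) \<le> (real n - 1) * y ^ n + l ^ n
     \<and> (n \<ge> 2 \<longrightarrow> real n * l * y ^ (n - 1) = (real n - 1) * y ^ n + l ^ n \<longrightarrow> y = l)"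
  proof cases
    case 2
    have gap: "l ^ m * (y - l)\<^sup>2 \<le> (real n - 1) * y ^ n + l ^ n - real n * l * y ^ (n - 1)"
      using young_power_gap[OF assms(1,2), of m] by (simp add: 2)
    moreover have "0 \<le> l ^ m * (y - l)\<^sup>2" using assms by simp
    moreover have "y = l" if "l ^ m * (y - l)\<^sup>2 \<le> 0"
      using that assms zero_less_power[OF assms(2), of m] by (simp add: mult_le_0_iff)
    ultimately show ?thesis by auto
  qed simp
  then show "real n * l * y ^ (n - 1) \<le> (real n - 1) * y ^ n + l ^ n"
    "n \<ge> 2 \<Longrightarrow> real n * l * y ^ (n - 1) = (real n - 1) * y ^ n + l ^ n \<Longrightarrow> y = l" by auto
qed

section \<open>Moments over superlevel sets\<close>

lemma layer_cake_power:
  fixes g :: "'a::euclidean_space \<Rightarrow> real"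
  assumes g [measurable]: "g \<in> borel_measurable borel" and nonneg: "\<And>x. g x \<ge> 0" and n: "n > 0"
  shows "(\<integral>\<^sup>+x. ennreal (g x ^ n) \<partial>lborel) =
    (\<integral>\<^sup>+t\<in>{0<..}. (\<integral>\<^sup>+x. ennreal (g x ^ (n - 1)) * indicator {x. t \<le> g x} x \<partial>lborel) \<partial>lborel)"
proof -
  have "ennreal (g x ^ n) = (\<integral>\<^sup>+t. ennreal (g x ^ (n - 1)) * (indicator {x. t \<le> g x} x * indicator {0<..} t) \<partial>lborel)" for x
  proof -
    have "(\<integral>\<^sup>+t. indicator {x. t \<le> g x} x * indicator {0<..} t \<partial>lborel) = (\<integral>\<^sup>+t. indicator {0<..g x} t \<partial>lborel)"
      by (intro nn_integral_cong) (auto simp: indicator_def)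
    also have "\<dots> = ennreal (g x)" using nonneg by simp
    finally have "(\<integral>\<^sup>+t. ennreal (g x ^ (n - 1)) * (indicator {x. t \<le> g x} x * indicator {0<..} t) \<partial>lborel)
        = ennreal (g x ^ (n - 1)) * ennreal (g x)"
      by (subst nn_integral_cmult) auto
    also have "\<dots> = ennreal (g x ^ n)"
      using n nonneg power_minus_mult[OF n, of "g x"] by (simp add: ennreal_mult'[symmetric])
    finally show ?thesis by simp
  qed
  then have "(\<integral>\<^sup>+x. ennreal (g x ^ n) \<partial>lborel) =
     (\<integral>\<^sup>+x. \<integral>\<^sup>+t. ennreal (g x ^ (n - 1)) * (indicator {x. t \<le> g x} x * indicator {0<..} t) \<partial>lborel \<partial>lborel)"
    by simp
  also have "\<dots> = (\<integral>\<^sup>+t. \<integral>\<^sup>+x. ennreal (g x ^ (n - 1)) * (indicator {x. t \<le> g x} x * indicator {0<..} t) \<partial>lborel \<partial>lborel)"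
    by (rule lborel_pair.Fubini'[symmetric]) (simp add: indicator_def, measurable)
  also have "\<dots> = (\<integral>\<^sup>+t\<in>{0<..}. (\<integral>\<^sup>+x. ennreal (g x ^ (n - 1)) * indicator {x. t \<le> g x} x \<partial>lborel) \<partial>lborel)"
    by (intro nn_integral_cong) (auto simp: indicator_def)
  finally show ?thesis .
qed

lemma superlevel_finite_measure:
  fixes g :: "'a::euclidean_space \<Rightarrow> real"
  assumes [measurable]: "g \<in> borel_measurable borel" and nonneg: "\<And>x. g x \<ge> 0" and n: "n > 0"
    and int: "integrable lborel (\<lambda>x. g x ^ n)" and t: "t > 0"
  shows "emeasure lborel {x. t \<le> g x} < \<infinity>"
proof -
  have "ennreal (t ^ n) * emeasure lborel {x. t \<le> g x} = (\<integral>\<^sup>+x. ennreal (t ^ n) * indicator {x. t \<le> g x} x \<partial>lborel)"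
    by (subst nn_integral_cmult_indicator) auto
  also have "\<dots> \<le> (\<integral>\<^sup>+x. ennreal (g x ^ n) \<partial>lborel)"
    using t by (intro nn_integral_mono) (auto simp: indicator_def intro!: ennreal_leI power_mono)
  also have "\<dots> < \<infinity>"
    using int nonneg by (subst nn_integral_eq_integral) auto
  finally show ?thesis using t by (auto simp: ennreal_mult_less_top less_top[symmetric])
qed

text \<open>Hoelder's inequality for \<open>g ^ (n - 1)\<close> and the indicator of a level, with
  its equality case. Young's inequality is integrated over the level and gives at most
  \<open>(n - 1) * N + N\<close>. In case of equality no part of \<open>N\<close> lies outside the
  level, which needs \<open>n \<ge> 2\<close>, and on the level Young's equality case gives
  \<open>g = l\<close>.\<close>

lemma superlevel_moment_bound:
  fixes g :: "'a::euclidean_space \<Rightarrow> real"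
  assumes g [measurable]: "g \<in> borel_measurable borel" and nonneg: "\<And>x. g x \<ge> 0" and n: "n > 0"
    and int: "integrable lborel (\<lambda>x. g x ^ n)" and pos: "(LINT x|lborel. g x ^ n) > 0" and t: "t > 0"
  defines "N \<equiv> LINT x|lborel. g x ^ n"
    and "v \<equiv> measure lborel {x. t \<le> g x}"
    and "H \<equiv> \<integral>\<^sup>+x. ennreal (g x ^ (n - 1)) * indicator {x. t \<le> g x} x \<partial>lborel"
  shows "H \<le> ennreal (root n N ^ (n - 1) * root n v)"
    and "n \<ge> 2 \<Longrightarrow> v > 0 \<Longrightarrow> H = ennreal (root n N ^ (n - 1) * root n v) \<Longrightarrow>
      \<exists>l>0. AE x in lborel. g x = l * indicator {x. t \<le> g x} x"
proof -
  let ?E = "{x. t \<le> g x}"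
  have fin: "emeasure lborel ?E < \<infinity>" by (rule superlevel_finite_measure[OF g nonneg n int t])
  have v: "emeasure lborel ?E = ennreal v"
    using fin unfolding v_def by (intro emeasure_eq_ennreal_measure) auto
  have vnn: "v \<ge> 0" by (simp add: v_def)
  let ?goal1 = "H \<le> ennreal (root n N ^ (n - 1) * root n v)"
  let ?goal2 = "n \<ge> 2 \<longrightarrow> H = ennreal (root n N ^ (n - 1) * root n v) \<longrightarrow>
      (\<exists>l>0. AE x in lborel. g x = l * indicator ?E x)"
  have main: "?goal1 \<and> ?goal2" if vpos: "v > 0"
  proof -
    \<comment> \<open>The value of \<open>g\<close> on the level in the extremal case, fixed by
      \<open>l ^ n * v = N\<close>.\<close>
    define l where "l = root n N / root n v"
    have N: "N > 0" using pos by (simp add: N_def)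
    have l: "l > 0" using N vpos n by (simp add: l_def)
    have ln: "l ^ n * v = N" using N vpos n by (simp add: l_def power_divide)
    have rN: "root n N ^ (n - 1) * root n v = N / l"
    proof -
      have "root n N ^ (n - 1) * root n N = N" using power_minus_mult[OF n, of "root n N"] N n by simp
      then show ?thesis using N vpos n by (simp add: l_def field_simps)
    qed
    have i1: "integrable lborel (\<lambda>x. g x ^ n * indicator ?E x)"
      using integrable_mult_indicator[OF _ int, of ?E] by (simp add: mult.commute)
    have i2: "integrable lborel (\<lambda>x. l ^ n * indicator ?E x :: real)"
      using fin by (intro integrable_mult_right) (auto simp: integrable_indicator_iff)
    have yle: "real n * l * (g x ^ (n - 1) * indicator ?E x) \<le> (real n - 1) * (g x ^ n * indicator ?E x) + l ^ n * indicator ?E x" for x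
      using young_power(1)[OF nonneg[of x] l n] by (simp add: indicator_def)
    have i3: "integrable lborel (\<lambda>x. g x ^ (n - 1) * indicator ?E x)"
    proof (rule Bochner_Integration.integrable_bound)
      show "integrable lborel (\<lambda>x. ((real n - 1) * (g x ^ n * indicator ?E x) + l ^ n * indicator ?E x) / (real n * l))"
        using i1 i2 by simp
      show "AE x in lborel. norm (g x ^ (n - 1) * indicator ?E x)
        \<le> norm (((real n - 1) * (g x ^ n * indicator ?E x) + l ^ n * indicator ?E x) / (real n * l))"
      proof (rule AE_I2)
        fix x
        have "g x ^ (n - 1) * indicator ?E x \<le> ((real n - 1) * (g x ^ n * indicator ?E x) + l ^ n * indicator ?E x) / (real n * l)"
          using yle[of x] l n by (simp add: pos_le_divide_eq mult.commute)
        moreover have "0 \<le> g x ^ (n - 1) * indicator ?E x" using nonneg by simp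
        ultimately show "norm (g x ^ (n - 1) * indicator ?E x)
          \<le> norm (((real n - 1) * (g x ^ n * indicator ?E x) + l ^ n * indicator ?E x) / (real n * l))"
          unfolding real_norm_def by linarith
      qed
    qed measurable
    define h where "h = (LINT x|lborel. g x ^ (n - 1) * indicator ?E x)"
    define G where "G = (LINT x|lborel. g x ^ n * indicator ?E x)"
    have H: "H = ennreal h"
    proof -
      have "H = (\<integral>\<^sup>+x. ennreal (g x ^ (n - 1) * indicator ?E x) \<partial>lborel)"
        unfolding H_def using nonneg by (intro nn_integral_cong) (auto simp: indicator_def)
      also have "\<dots> = ennreal h"
        unfolding h_def using nonneg by (intro nn_integral_eq_integral i3) auto
      finally show ?thesis .
    qed
    have G: "G \<le> N"
      unfolding G_def N_def using nonneg by (intro integral_mono i1 int) (auto simp: indicator_def)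
    have intv: "(LINT x|lborel. l ^ n * indicator ?E x) = N"
      using ln by (simp add: v_def)
    have gap: "(LINT x|lborel. (real n - 1) * (g x ^ n * indicator ?E x) + l ^ n * indicator ?E x - real n * l * (g x ^ (n - 1) * indicator ?E x))
       = (real n - 1) * G + N - real n * l * h"
      using i1 i2 i3 intv by (simp add: G_def h_def)
    have gap0: "0 \<le> (real n - 1) * G + N - real n * l * h"
      unfolding gap[symmetric] using yle by (intro integral_nonneg_AE) auto
    have Gn: "(real n - 1) * G \<le> (real n - 1) * N" using G n by (intro mult_left_mono) auto
    have "real n * (l * h) \<le> real n * N" using gap0 Gn by (simp add: algebra_simps)
    then have "h \<le> N / l" using n l by (simp add: pos_le_divide_eq mult.commute)
    then have goal1: ?goal1 unfolding H rN by (intro ennreal_leI)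
    have ?goal2
    proof (intro impI)
      assume n2: "n \<ge> 2" and eq: "H = ennreal (root n N ^ (n - 1) * root n v)"
      have "h \<ge> 0" unfolding h_def using nonneg by (intro integral_nonneg_AE) auto
      then have "h = N / l" using eq N l unfolding H rN by (simp add: ennreal_inj)
      then have nlh: "real n * l * h = real n * N" using l by simp
      moreover have "real n * N = (real n - 1) * N + N" by (simp add: algebra_simps)
      ultimately have "(real n - 1) * G = (real n - 1) * N" using gap0 Gn by linarith
      then have GN: "G = N" using n2 by simp
      have "(LINT x|lborel. (real n - 1) * (g x ^ n * indicator ?E x) + l ^ n * indicator ?E x - real n * l * (g x ^ (n - 1) * indicator ?E x)) = 0"
        unfolding gap GN nlh by (simp add: algebra_simps)
      then have "AE x in lborel. (real n - 1) * (g x ^ n * indicator ?E x) + l ^ n * indicator ?E x - real n * l * (g x ^ (n - 1) * indicator ?E x) = 0"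
        using i1 i2 i3 yle by (subst (asm) integral_nonneg_eq_0_iff_AE) auto
      moreover have "AE x in lborel. g x ^ n - g x ^ n * indicator ?E x = 0"
      proof -
        have "(LINT x|lborel. g x ^ n - g x ^ n * indicator ?E x) = 0"
          using GN int i1 by (simp add: N_def G_def)
        then show ?thesis
          using int i1 nonneg by (subst (asm) integral_nonneg_eq_0_iff_AE) (auto simp: indicator_def)
      qed
      ultimately have "AE x in lborel. g x = l * indicator ?E x"
      proof eventually_elim
        case (elim x)
        show ?case
        proof (cases "x \<in> ?E")
          case True
          then have "real n * l * g x ^ (n - 1) = (real n - 1) * g x ^ n + l ^ n" using elim(1) by simp
          then show ?thesis using young_power(2)[OF nonneg l n n2] True by simp
        next
          case False
          then have "g x ^ n = 0" using elim(2) by simp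
          then show ?thesis using False by simp
        qed
      qed
      then show "\<exists>l>0. AE x in lborel. g x = l * indicator ?E x" using l by blast
    qed
    then show ?thesis using goal1 by blast
  qed
  show ?goal1
  proof (cases "v = 0")
    case True
    then have "?E \<in> null_sets lborel" using v by (auto simp: null_sets_def)
    then have "AE x in lborel. x \<notin> ?E" by (rule AE_not_in)
    then have "AE x in lborel. ennreal (g x ^ (n - 1)) * indicator ?E x = 0"
      by eventually_elim simp
    then have "H = (\<integral>\<^sup>+(x::'a). 0 \<partial>lborel)"
      unfolding H_def by (rule nn_integral_cong_AE)
    then show ?thesis by simp
  next
    case False
    then show ?thesis using main vnn by auto
  qed
  show "n \<ge> 2 \<Longrightarrow> v > 0 \<Longrightarrow> H = ennreal (root n N ^ (n - 1) * root n v) \<Longrightarrow>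
      \<exists>l>0. AE x in lborel. g x = l * indicator ?E x"
    using main by blast
qed

text \<open>Integrating the moment bound over the levels bounds the \<open>n\<close>-th power of the
  norm by its power \<open>n - 1\<close> times the right-hand side; integrability allows the common
  power to be cancelled.\<close>

lemma minkowski_layer_cake:
  fixes g :: "'a::euclidean_space \<Rightarrow> real"
  assumes g [measurable]: "g \<in> borel_measurable borel" and nonneg: "\<And>x. g x \<ge> 0" and n: "n > 0"
    and int: "integrable lborel (\<lambda>x. g x ^ n)"
  shows "ennreal (root n (LINT x|lborel. g x ^ n)) \<le>
    (\<integral>\<^sup>+t\<in>{0<..}. ennreal (root n (measure lborel {x. t \<le> g x})) \<partial>lborel)" (is "_ \<le> ?J")
proof -
  define N where "N = (LINT x|lborel. g x ^ n)"
  have "N \<ge> 0" unfolding N_def using nonneg by (intro integral_nonneg_AE) auto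
  show ?thesis
  proof (cases "N = 0")
    case True
    then show ?thesis by (simp add: N_def)
  next
    case False
    then have N: "N > 0" using \<open>N \<ge> 0\<close> by simp
    let ?L = "root n N"
    have L: "?L > 0" using N n by simp
    have LL: "?L ^ (n - 1) * ?L = N" using power_minus_mult[OF n, of ?L] N n by simp
    have meas: "(\<lambda>t. measure lborel {x. t \<le> g x}) \<in> borel_measurable borel"
    proof -
      have "(\<lambda>t. emeasure lborel {x. t \<le> g x}) \<in> borel_measurable borel"
        by (rule lborel.measurable_emeasure[where A = "\<lambda>t. {x. t \<le> g x}"]) measurable
      then show ?thesis unfolding measure_def by measurable
    qed
    have "ennreal (?L ^ (n - 1)) * ennreal ?L = (\<integral>\<^sup>+x. ennreal (g x ^ n) \<partial>lborel)"
      using L LL nonneg by (subst nn_integral_eq_integral[OF int]) (auto simp: ennreal_mult'[symmetric] N_def)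
    also have "\<dots> = (\<integral>\<^sup>+t\<in>{0<..}. (\<integral>\<^sup>+x. ennreal (g x ^ (n - 1)) * indicator {x. t \<le> g x} x \<partial>lborel) \<partial>lborel)"
      by (rule layer_cake_power[OF g nonneg n])
    also have "\<dots> \<le> (\<integral>\<^sup>+t. ennreal (?L ^ (n - 1)) * (ennreal (root n (measure lborel {x. t \<le> g x})) * indicator {0<..} t) \<partial>lborel)"
    proof (rule nn_integral_mono)
      fix t :: real
      show "(\<integral>\<^sup>+x. ennreal (g x ^ (n - 1)) * indicator {x. t \<le> g x} x \<partial>lborel) * indicator {0<..} t
        \<le> ennreal (?L ^ (n - 1)) * (ennreal (root n (measure lborel {x. t \<le> g x})) * indicator {0<..} t)"
      proof (cases "t > 0")
        case True
        then show ?thesis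
          using superlevel_moment_bound(1)[OF g nonneg n int N[unfolded N_def] True] L
          by (simp add: N_def ennreal_mult')
      qed simp
    qed
    also have "\<dots> = ennreal (?L ^ (n - 1)) * ?J"
      using meas by (intro nn_integral_cmult) measurable
    finally have "ennreal (?L ^ (n - 1)) * ennreal ?L \<le> ennreal (?L ^ (n - 1)) * ?J" .
    then show ?thesis
      using L unfolding N_def[symmetric] by (subst (asm) ennreal_mult_le_mult_iff) auto
  qed
qed

section \<open>Mean width of quasi-concave functions\<close>

lemma closed_superlevel:
  assumes "upper_semicontinuous f"
  shows "closed {x. t \<le> f x}"
proof -
  have "open {x. f x < t}"
    unfolding open_subopen[of "{x. f x < t}"]
  proof
    fix x assume "x \<in> {x. f x < t}"
    \<comment> \<open>\<open>Limsup (at x)\<close> ignores the value at \<open>x\<close> itself, so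
      \<open>f x < t\<close> is carried along.\<close>
    then have "Limsup (at x) f < t" "f x < t"
      using assms by (auto simp: upper_semicontinuous_def intro: le_less_trans)
    then have "eventually (\<lambda>y. f y < t) (nhds x)"
      using Limsup_lessD by (auto simp: eventually_nhds_conv_at)
    then show "\<exists>T. open T \<and> x \<in> T \<and> T \<subseteq> {x. f x < t}"
      by (auto simp: eventually_nhds)
  qed
  moreover have "{x. t \<le> f x} = - {x. f x < t}" by auto
  ultimately show ?thesis by (simp add: closed_def)
qed

lemma Qn_superlevel:
  fixes f :: "'a::euclidean_space \<Rightarrow> ennreal"
  assumes f: "f \<in> Qn"
  shows "t > 0 \<Longrightarrow> compact {x. t \<le> f x}" "convex {x. t \<le> f x}"
proof -
  show "convex {x. t \<le> f x}" using f by (simp add: Qn_def quasi_concave_def)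
  show "compact {x. t \<le> f x}" if "t > 0"
  proof -
    have "(f \<longlongrightarrow> 0) at_infinity" using f by (simp add: Qn_def)
    then have "eventually (\<lambda>x. f x < t) at_infinity" using that by (rule order_tendstoD)
    then obtain b where b: "\<And>x. b \<le> norm x \<Longrightarrow> f x < t" by (auto simp: eventually_at_infinity)
    have "norm x \<le> b" if "t \<le> f x" for x using b[of x] that by (meson linear not_le)
    then have "bounded {x. t \<le> f x}" unfolding bounded_iff by blast
    moreover have "closed {x. t \<le> f x}" using f by (intro closed_superlevel) (simp add: Qn_def)
    ultimately show ?thesis by (simp add: compact_eq_bounded_closed)
  qed
qed

lemma Qn_measurable [measurable_dest]:
  fixes f :: "'a::euclidean_space \<Rightarrow> ennreal"
  assumes f: "f \<in> Qn"
  shows "f \<in> borel_measurable borel"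
proof (rule borel_measurableI_ge)
  fix y
  have "closed {x. y \<le> f x}" using f by (intro closed_superlevel) (simp add: Qn_def)
  then show "{x \<in> space borel. y \<le> f x} \<in> sets borel" by simp
qed

lemma root_vol_eq:
  fixes S :: "'a::euclidean_space set"
  shows "root DIM('a) (vol S) = root DIM('a) (kappa TYPE('a)) * vol_radius S"
  using kappa_pos[where 'a='a] by (simp add: vol_radius_def real_root_divide)

section \<open>Truncation and the Minkowski inequality on \<open>Qn\<close>\<close>

text \<open>Cutting at height \<open>k + 1\<close> and discarding values below
  \<open>1 / (k + 1)\<close> leaves a bounded function supported in a compact level, whose
  \<open>n\<close>-th power is integrable.\<close>

definition trunc :: "('a \<Rightarrow> ennreal) \<Rightarrow> nat \<Rightarrow> 'a \<Rightarrow> real" where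
  "trunc f k x = (if ennreal (1 / Suc k) \<le> f x then enn2real (min (f x) (ennreal (Suc k))) else 0)"

lemma trunc_le: "ennreal (trunc f k x) \<le> f x"
  by (auto simp: trunc_def ennreal_enn2real_if min_def)

lemma trunc_bound: "trunc f k x \<le> Suc k"
proof -
  have "enn2real (min (f x) (ennreal (Suc k))) \<le> enn2real (ennreal (Suc k))"
    by (intro enn2real_mono) auto
  then show ?thesis by (simp add: trunc_def del: of_nat_Suc)
qed

lemma trunc_nonneg: "trunc f k x \<ge> 0"
  by (simp add: trunc_def)

lemma trunc_mono: "k \<le> m \<Longrightarrow> trunc f k x \<le> trunc f m x"
proof -
  assume km: "k \<le> m"
  have "ennreal (1 / Suc m) \<le> ennreal (1 / Suc k)" using km by (intro ennreal_leI) (simp add: field_simps)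
  then have "ennreal (1 / Suc m) \<le> f x" if "ennreal (1 / Suc k) \<le> f x" using that by (rule order_trans)
  moreover have "enn2real (min (f x) (ennreal (Suc k))) \<le> enn2real (min (f x) (ennreal (Suc m)))"
    using km by (intro enn2real_mono min.mono ennreal_leI) (auto simp: min_less_iff_disj)
  ultimately show ?thesis unfolding trunc_def by (cases "ennreal (1 / Suc k) \<le> f x") (simp_all only: if_True if_False, simp)
qed

lemma SUP_trunc_power:
  assumes n: "n > 0"
  shows "f x ^ n \<le> (SUP k. ennreal (trunc f k x ^ n))"
proof (cases "f x = 0")
  case True
  then show ?thesis using n by (simp add: zero_power)
next
  case False
  show ?thesis
  proof (cases "f x = \<infinity>")
    case True
    have "of_nat m \<le> (SUP k. ennreal (trunc f k x ^ n))" for m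
    proof -
      have "real m \<le> real (Suc m) ^ n"
        using self_le_power[of "real (Suc m)" n] n by simp
      moreover have "trunc f m x = real (Suc m)" using True by (simp add: trunc_def)
      ultimately have "of_nat m \<le> ennreal (trunc f m x ^ n)"
        by (metis ennreal_leI ennreal_of_nat_eq_real_of_nat)
      then show ?thesis by (rule SUP_upper2[OF UNIV_I])
    qed
    then have "(SUP k. ennreal (trunc f k x ^ n)) = top"
      by (meson ennreal_Ex_less_of_nat not_less top.not_eq_extremum)
    then show ?thesis by (simp only: top_greatest)
  next
    case fin: False
    define y where "y = enn2real (f x)"
    have y: "f x = ennreal y" "y > 0"
      using fin False by (auto simp: y_def ennreal_enn2real_if enn2real_positive_iff less_top zero_less_iff_neq_zero)
    obtain k1 where k1: "1 / Suc k1 < y" using nat_approx_posE[OF y(2)] by (metis inverse_eq_divide)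
    obtain k2 where k2: "y < real k2" using reals_Archimedean2 by blast
    define k where "k = max k1 k2"
    have "1 / real (Suc k) \<le> 1 / real (Suc k1)" by (simp add: k_def field_simps)
    then have "1 / real (Suc k) \<le> y" "y \<le> real (Suc k)" using k1 k2 by (auto simp: k_def)
    then have "ennreal (1 / Suc k) \<le> f x" "min (f x) (ennreal (Suc k)) = ennreal y"
      unfolding y(1) by (auto intro!: ennreal_leI min_absorb1 simp del: of_nat_Suc)
    then have "trunc f k x = y" using y by (simp only: trunc_def if_True enn2real_ennreal less_imp_le)
    then have "f x ^ n = ennreal (trunc f k x ^ n)" using y by (simp add: ennreal_power)
    then show ?thesis by (simp only:) (rule SUP_upper2[OF UNIV_I order_refl])
  qed
qed

text \<open>The levels of a truncation lie in those of \<open>f\<close>, so all truncations share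
  the bound \<open>?J\<close>, and monotone convergence passes it on to \<open>f\<close>.\<close>

lemma minkowski_Qn:
  fixes f :: "'a::euclidean_space \<Rightarrow> ennreal"
  assumes f: "f \<in> Qn"
  shows "norm_n f \<le> (\<integral>\<^sup>+t\<in>{0<..}. ennreal (root DIM('a) (vol {x. ennreal t \<le> f x})) \<partial>lborel)" (is "_ \<le> ?J")
proof -
  let ?n = "DIM('a)"
  note [measurable] = Qn_measurable[OF f]
  have tm [measurable]: "trunc f k \<in> borel_measurable borel" for k
    unfolding trunc_def by measurable
  have int: "integrable lborel (\<lambda>x. trunc f k x ^ ?n)" for k
  proof (rule Bochner_Integration.integrable_bound)
    let ?S = "{x. ennreal (1 / Suc k) \<le> f x}"
    have "compact ?S" by (intro Qn_superlevel(1)[OF f]) simp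
    then show "integrable lborel (\<lambda>x. real (Suc k) ^ ?n * indicator ?S x)"
      using emeasure_compact_finite[of ?S]
      by (intro integrable_mult_right) (auto simp: integrable_indicator_iff borel_compact)
    show "AE x in lborel. norm (trunc f k x ^ ?n) \<le> norm (real (Suc k) ^ ?n * indicator ?S x)"
    proof (rule AE_I2)
      fix x
      show "norm (trunc f k x ^ ?n) \<le> norm (real (Suc k) ^ ?n * indicator ?S x)"
        using power_mono[OF trunc_bound[of f k x] trunc_nonneg, of ?n] trunc_nonneg[of f k x]
        by (cases "x \<in> ?S") (auto simp: trunc_def zero_power)
    qed
  qed measurable
  have step: "(\<integral>\<^sup>+x. ennreal (trunc f k x ^ ?n) \<partial>lborel) \<le> ?J ^ ?n" for k
  proof -
    let ?N = "LINT x|lborel. trunc f k x ^ ?n"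
    have "?N \<ge> 0" by (intro integral_nonneg_AE AE_I2 zero_le_power trunc_nonneg)
    have "ennreal (root ?n ?N) \<le> (\<integral>\<^sup>+t\<in>{0<..}. ennreal (root ?n (vol {x. t \<le> trunc f k x})) \<partial>lborel)"
      by (intro minkowski_layer_cake tm trunc_nonneg int DIM_positive)
    also have "\<dots> \<le> ?J"
    proof (rule nn_integral_mono)
      fix t :: real
      show "ennreal (root ?n (vol {x. t \<le> trunc f k x})) * indicator {0<..} t
        \<le> ennreal (root ?n (vol {x. ennreal t \<le> f x})) * indicator {0<..} t"
      proof (cases "t > 0")
        case True
        have "{x. t \<le> trunc f k x} \<subseteq> {x. ennreal t \<le> f x}"
        proof
          fix x assume "x \<in> {x. t \<le> trunc f k x}"
          then have "ennreal t \<le> ennreal (trunc f k x)" by (intro ennreal_leI) simp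
          then show "x \<in> {x. ennreal t \<le> f x}" using trunc_le[of f k x] order_trans by blast
        qed
        then have "vol {x. t \<le> trunc f k x} \<le> vol {x. ennreal t \<le> f x}"
          using True by (intro vol_mono_compact Qn_superlevel[OF f]) (auto, measurable)
        then show ?thesis using True by (simp add: ennreal_leI)
      qed simp
    qed
    finally have "ennreal (root ?n ?N) ^ ?n \<le> ?J ^ ?n" by (intro power_mono) auto
    moreover have "ennreal (root ?n ?N) ^ ?n = ennreal ?N" using \<open>?N \<ge> 0\<close> by (simp add: ennreal_power)
    moreover have "AE x in lborel. 0 \<le> trunc f k x ^ ?n" by (intro AE_I2 zero_le_power trunc_nonneg)
    ultimately show ?thesis by (subst nn_integral_eq_integral[OF int]) simp_all
  qed
  have "(\<integral>\<^sup>+x. f x ^ ?n \<partial>lborel) \<le> (\<integral>\<^sup>+x. (SUP k. ennreal (trunc f k x ^ ?n)) \<partial>lborel)"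
    by (intro nn_integral_mono SUP_trunc_power DIM_positive)
  also have "\<dots> = (SUP k. \<integral>\<^sup>+x. ennreal (trunc f k x ^ ?n) \<partial>lborel)"
  proof (rule nn_integral_monotone_convergence_SUP)
    show "incseq (\<lambda>k x. ennreal (trunc f k x ^ ?n))"
      by (auto simp: incseq_def le_fun_def intro!: ennreal_leI power_mono trunc_mono trunc_nonneg)
  qed measurable
  also have "\<dots> \<le> ?J ^ ?n" by (rule SUP_least) (rule step)
  finally have le: "(\<integral>\<^sup>+x. f x ^ ?n \<partial>lborel) \<le> ?J ^ ?n" .
  show ?thesis
  proof (cases "?J = \<infinity>")
    case False
    then obtain j where j: "?J = ennreal j" "j \<ge> 0" by (cases ?J) auto
    let ?F = "\<integral>\<^sup>+x. f x ^ ?n \<partial>lborel"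
    have Fj: "?F \<le> ennreal (j ^ ?n)" using le j by (simp add: ennreal_power)
    then have fin: "?F \<noteq> \<infinity>" using ennreal_less_top[of "j ^ ?n"] by (auto simp: top_unique)
    have "enn2real ?F \<le> enn2real (ennreal (j ^ ?n))" using Fj by (intro enn2real_mono) auto
    then have "root ?n (enn2real ?F) \<le> root ?n (j ^ ?n)" using j by (intro real_root_le_mono) auto
    then have "root ?n (enn2real ?F) \<le> j" using j by (simp add: real_root_power_cancel)
    then show ?thesis using fin j by (simp add: norm_n_def ennreal_root_def ennreal_leI)
  qed simp
qed

section \<open>Measurability in the level, and the mean width inequality\<close>

lemma antimono_ennreal_measurable:
  fixes h :: "real \<Rightarrow> real"
  assumes "\<And>s t. 0 < s \<Longrightarrow> s \<le> t \<Longrightarrow> h t \<le> h s"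
  shows "(\<lambda>t. ennreal (h t) * indicator {0<..} t) \<in> borel_measurable borel"
proof -
  have "mono_on {0<..} (\<lambda>t. - h t)" using assms by (auto simp: mono_on_def)
  then have "(\<lambda>t. - h t) \<in> borel_measurable (restrict_space borel {0<..})"
    by (rule borel_measurable_mono_on_fnc)
  then have [measurable]: "(\<lambda>t. indicator {0<..} t *\<^sub>R - h t) \<in> borel_measurable borel"
    by (subst (asm) borel_measurable_restrict_space_iff) auto
  have "(\<lambda>t. ennreal (h t) * indicator {0<..} t) = (\<lambda>t. ennreal (- (indicator {0<..} t *\<^sub>R - h t)))"
    by (auto simp: indicator_def)
  also have "\<dots> \<in> borel_measurable borel" by measurable
  finally show ?thesis .
qed

text \<open>For \<open>t \<le> 0\<close> the level is the whole space; restricted to positive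
  \<open>t\<close>, the levels are compact and convex and the quermassintegral decreases in
  \<open>t\<close>.\<close>

lemma mean_quermass_superlevel_measurable:
  fixes f :: "'a::euclidean_space \<Rightarrow> ennreal"
  assumes f: "f \<in> Qn"
  shows "(\<lambda>t. ennreal (mean_quermass {x. ennreal t \<le> f x}) * indicator {0<..} t) \<in> borel_measurable borel"
proof (rule antimono_ennreal_measurable)
  fix s t :: real assume st: "0 < s" "s \<le> t"
  have sub: "{x. ennreal t \<le> f x} \<subseteq> {x. ennreal s \<le> f x}"
    using st ennreal_leI order_trans by blast
  have K: "compact {x. ennreal t \<le> f x}" "convex {x. ennreal t \<le> f x}"
    "compact {x. ennreal s \<le> f x}" "convex {x. ennreal s \<le> f x}"
    using st by (auto intro!: Qn_superlevel[OF f])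
  show "mean_quermass {x. ennreal t \<le> f x} \<le> mean_quermass {x. ennreal s \<le> f x}"
  proof (cases "{x. ennreal t \<le> f x} = {}")
    case True
    then show ?thesis using mean_quermass_nonneg[OF K(3,4)] by (simp add: quermassintegral_empty)
  next
    case False
    show ?thesis by (rule mean_quermass_mono[OF K(1,2) False K(3,4) sub])
  qed
qed

lemma bound_constant:
  assumes n: "n > 0" and k: "k > (0::real)"
  shows "k powr (- 1 / real n) = 1 / root n k"
  using assms by (simp add: powr_minus_divide root_powr_inverse)

lemma mean_width_ge:
  fixes f :: "'a::euclidean_space \<Rightarrow> ennreal"
  assumes f: "f \<in> Qn"
  shows "ennreal (2 * kappa TYPE('a) powr (- 1 / real DIM('a))) * norm_n f \<le> mean_width f"
proof -
  let ?n = "DIM('a)" and ?k = "kappa TYPE('a)"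
  let ?c = "2 * ?k powr (- 1 / real ?n)"
  have k: "?k > 0" by (rule kappa_pos)
  have "ennreal ?c * norm_n f \<le> ennreal ?c * (\<integral>\<^sup>+t\<in>{0<..}. ennreal (root ?n (vol {x. ennreal t \<le> f x})) \<partial>lborel)"
    by (intro mult_left_mono minkowski_Qn f) auto
  \<comment> \<open>In the factor, \<open>root ?n ?k\<close> converts the volume radius into a root
    of the volume, and \<open>1 / ?k\<close> comes from Urysohn's inequality; together with
    \<open>?c\<close> it makes \<open>2 / ?k\<close>.\<close>
  also have "\<dots> \<le> ennreal ?c * (\<integral>\<^sup>+t\<in>{0<..}. ennreal (root ?n ?k / ?k) * ennreal (mean_quermass {x. ennreal t \<le> f x}) \<partial>lborel)"
  proof (intro mult_left_mono nn_integral_mono)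
    fix t :: real
    show "ennreal (root ?n (vol {x. ennreal t \<le> f x})) * indicator {0<..} t \<le>
      ennreal (root ?n ?k / ?k) * ennreal (mean_quermass {x. ennreal t \<le> f x}) * indicator {0<..} t"
    proof (cases "t > 0")
      case True
      then have K: "compact {x. ennreal t \<le> f x}" "convex {x. ennreal t \<le> f x}"
        by (auto intro!: Qn_superlevel[OF f])
      have "root ?n (vol {x. ennreal t \<le> f x}) = (root ?n ?k / ?k) * (?k * vol_radius {x. ennreal t \<le> f x})"
        using k by (simp add: root_vol_eq)
      also have "\<dots> \<le> (root ?n ?k / ?k) * mean_quermass {x. ennreal t \<le> f x}"
        using k by (intro mult_left_mono urysohn K) auto
      finally show ?thesis using True k mean_quermass_nonneg[OF K]
        by (simp add: ennreal_mult'[symmetric] ennreal_leI)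
    qed simp
  qed simp
  also have "\<dots> = ennreal ?c * (ennreal (root ?n ?k / ?k) * quermassintegral_fun (?n - 1) f)"
    unfolding quermassintegral_fun_def mult.assoc
    using mean_quermass_superlevel_measurable[OF f] by (subst nn_integral_cmult) auto
  also have "\<dots> = mean_width f"
  proof -
    have "?c * (root ?n ?k / ?k) = 2 / ?k"
      unfolding bound_constant[OF DIM_positive k] using k by simp
    then have "ennreal ?c * ennreal (root ?n ?k / ?k) = ennreal (2 / ?k)"
      using ennreal_mult'[of ?c "root ?n ?k / ?k"] by (simp only: powr_ge_zero mult_nonneg_nonneg zero_le_numeral)
    then show ?thesis by (simp only: mean_width_def mult.assoc[symmetric])
  qed
  finally show ?thesis .
qed


section \<open>Functions that attain equality\<close>

text \<open>A larger value at \<open>p\<close> only affects levels above \<open>c\<close>, which are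
  empty or the single point \<open>p\<close> and contribute 0. For \<open>r = 0\<close> both sides
  vanish, even if the value at \<open>p\<close> is infinite.\<close>

lemma mean_width_scaled_ball:
  fixes f :: "'a::euclidean_space \<Rightarrow> ennreal"
  assumes r: "r \<ge> 0" and c: "c > 0" and p: "p \<in> cball x r" "f p \<ge> c"
    and f: "\<And>y. y \<noteq> p \<Longrightarrow> f y = c * indicator (cball x r) y" and fin: "r = 0 \<or> c \<noteq> \<infinity>"
  shows "mean_width f = ennreal (2 * kappa TYPE('a) powr (- 1 / real DIM('a))) * norm_n f"
proof -
  let ?n = "DIM('a)" and ?k = "kappa TYPE('a)"
  have k: "?k > 0" by (rule kappa_pos)
  have fge: "f y \<ge> c" if "y \<in> cball x r" for y using that f[of y] p by (cases "y = p") auto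
  have mq: "mean_quermass {y. ennreal t \<le> f y} = (if ennreal t \<le> c then ?k * r else 0)" if t: "t > 0" for t
  proof (cases "ennreal t \<le> c")
    case True
    have "y \<in> cball x r" if "ennreal t \<le> f y" for y
    proof (rule ccontr)
      assume "y \<notin> cball x r"
      then have "f y = 0" using f[of y] p(1) by auto
      then show False using that t by simp
    qed
    then have "{y. ennreal t \<le> f y} = cball x r" using fge True order_trans by blast
    then show ?thesis using True mean_quermass_cball[OF r, of x] by simp
  next
    case False
    have "y = p" if "ennreal t \<le> f y" for y
    proof (rule ccontr)
      assume "y \<noteq> p"
      then have "f y \<le> c" using f[of y] by (simp add: indicator_def)
      then show False using that False by (meson order_trans)
    qed
    then have "{y. ennreal t \<le> f y} = {} \<or> {y. ennreal t \<le> f y} = cball p 0" by auto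
    then show ?thesis using False mean_quermass_cball[of 0 p] by (auto simp: quermassintegral_empty)
  qed
  have quer: "quermassintegral_fun (?n - 1) f = (\<integral>\<^sup>+t\<in>{0<..}. ennreal (if ennreal t \<le> c then ?k * r else 0) \<partial>lborel)"
    unfolding quermassintegral_fun_def
    by (intro nn_integral_cong) (auto simp: mq[unfolded One_nat_def] indicator_def)
  have "AE y in lborel. y \<noteq> p" by (rule AE_lborel_singleton)
  then have "AE y in lborel. f y ^ ?n = c ^ ?n * indicator (cball x r) y"
    by eventually_elim (simp add: f indicator_def)
  then have "(\<integral>\<^sup>+y. f y ^ ?n \<partial>lborel) = (\<integral>\<^sup>+y. c ^ ?n * indicator (cball x r) y \<partial>lborel)"
    by (rule nn_integral_cong_AE)
  also have "\<dots> = c ^ ?n * emeasure lborel (cball x r)"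
    by (rule nn_integral_cmult_indicator) simp
  also have "emeasure lborel (cball x r) = ennreal (?k * r ^ ?n)"
    using emeasure_compact_finite[of "cball x r"] r
    by (subst emeasure_eq_ennreal_measure) (auto simp: vol_cball)
  finally have F: "(\<integral>\<^sup>+y. f y ^ ?n \<partial>lborel) = c ^ ?n * ennreal (?k * r ^ ?n)" .
  show ?thesis
  proof (cases "r = 0")
    case True
    have "norm_n f = 0" using F True by (simp add: norm_n_def ennreal_root_def zero_power)
    moreover have "quermassintegral_fun (?n - 1) f = 0" unfolding quer using True by (simp cong: if_cong)
    ultimately show ?thesis by (simp add: mean_width_def)
  next
    case False
    then obtain d where d: "c = ennreal d" "d > 0"
      using fin c by (cases c) auto
    have "quermassintegral_fun (?n - 1) f = (\<integral>\<^sup>+t. ennreal (?k * r) * indicator {0<..d} t \<partial>lborel)"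
      unfolding quer using d by (intro nn_integral_cong) (auto simp: indicator_def)
    also have "\<dots> = ennreal (?k * r * d)"
      using k r d by (subst nn_integral_cmult_indicator) (auto simp: ennreal_mult')
    finally have "mean_width f = ennreal (2 / ?k) * ennreal (?k * r * d)" by (simp add: mean_width_def)
    also have "\<dots> = ennreal (2 * r * d)" using k by (subst ennreal_mult'[symmetric]) (simp_all add: mult.assoc)
    finally have mw: "mean_width f = ennreal (2 * r * d)" .
    have "(\<integral>\<^sup>+y. f y ^ ?n \<partial>lborel) = ennreal (?k * (d * r) ^ ?n)"
      using F d k r by (simp add: ennreal_power ennreal_mult'[symmetric] power_mult_distrib mult_ac)
    then have "norm_n f = ennreal (root ?n (?k * (d * r) ^ ?n))"
      using k d r by (simp add: norm_n_def ennreal_root_def)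
    also have "root ?n (?k * (d * r) ^ ?n) = root ?n ?k * (d * r)"
      using d r by (simp add: real_root_mult real_root_power_cancel)
    finally have nf: "norm_n f = ennreal (root ?n ?k * (d * r))" .
    show ?thesis
      unfolding mw nf bound_constant[OF DIM_positive k]
      using k by (subst ennreal_mult'[symmetric]) (simp_all add: mult_ac)
  qed
qed

section \<open>Consequences of equality\<close>

lemma AE_greater_interval:
  fixes a b :: real
  assumes "AE t in lborel. t > 0 \<longrightarrow> P t" "0 \<le> a" "a < b"
  obtains t where "a < t" "t < b" "P t"
proof -
  have "\<exists>t. a < t \<and> t < b \<and> P t"
  proof (rule ccontr)
    assume none: "\<nexists>t. a < t \<and> t < b \<and> P t"
    have "AE t in lborel. t \<notin> {a<..<b}"
      using assms(1) by eventually_elim (use none assms(2) in force)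
    then have "emeasure lborel {a<..<b} = 0"
      by (subst (asm) AE_iff_measurable[of "{a<..<b}"]) auto
    then show False using assms(3) by simp
  qed
  then show thesis using that by blast
qed

lemma nn_integral_eq_imp_AE_eq:
  assumes [measurable]: "f \<in> borel_measurable M" "g \<in> borel_measurable M"
    and le: "\<And>x. f x \<le> g x" and eq: "(\<integral>\<^sup>+x. f x \<partial>M) = (\<integral>\<^sup>+x. g x \<partial>M)" and fin: "(\<integral>\<^sup>+x. f x \<partial>M) \<noteq> \<infinity>"
  shows "AE x in M. f x = g x"
proof -
  have "(\<integral>\<^sup>+x. g x - f x \<partial>M) = (\<integral>\<^sup>+x. g x \<partial>M) - (\<integral>\<^sup>+x. f x \<partial>M)"
    using fin le by (intro nn_integral_diff) auto
  also have "\<dots> = 0" using eq fin by simp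
  finally have "AE x in M. g x - f x = 0" by (subst (asm) nn_integral_0_iff_AE) auto
  then show ?thesis
    by eventually_elim (use le in \<open>auto simp: diff_eq_0_iff_ennreal intro: antisym\<close>)
qed


text \<open>Unless the norm is 0, the moment \<open>H t\<close> is bounded through the volume of the
  level and then through its mean width, and equality of the two ends after integration makes both
  steps equalities for almost every \<open>t\<close>. The second step is Urysohn's equality; the
  first, at a single level of positive volume, already determines \<open>f\<close> almost
  everywhere.\<close>

lemma mean_width_equality_levels:
  fixes f :: "'a::euclidean_space \<Rightarrow> ennreal"
  assumes f: "f \<in> Qn" and n2: "DIM('a) \<ge> 2" and fin: "norm_n f \<noteq> \<infinity>"
    and eq: "mean_width f = ennreal (2 * kappa TYPE('a) powr (- 1 / real DIM('a))) * norm_n f"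
  shows "AE t in lborel. t > 0 \<longrightarrow>
      mean_quermass {x. ennreal t \<le> f x} = kappa TYPE('a) * vol_radius {x. ennreal t \<le> f x}"
    and "(AE x in lborel. f x = 0) \<or>
      (\<exists>t l. t > 0 \<and> l > 0 \<and> vol {x. ennreal t \<le> f x} > 0 \<and>
        mean_quermass {x. ennreal t \<le> f x} = kappa TYPE('a) * vol_radius {x. ennreal t \<le> f x} \<and>
        (AE x in lborel. f x = ennreal l * indicator {x. ennreal t \<le> f x} x))"
proof -
  let ?n = "DIM('a)" and ?k = "kappa TYPE('a)"
  let ?L = "\<lambda>t. {x. ennreal t \<le> f x}"
  have n: "?n > 0" by simp
  have k: "?k > 0" by (rule kappa_pos)
  note [measurable] = Qn_measurable[OF f]
  \<comment> \<open>A real-valued version of \<open>f\<close>; finiteness of the norm makes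
    \<open>f\<close> infinite on a null set only.\<close>
  define g where "g = (\<lambda>x. enn2real (f x))"
  have g [measurable]: "g \<in> borel_measurable borel" unfolding g_def by measurable
  have nonneg: "g x \<ge> 0" for x by (simp add: g_def)
  have Ffin: "(\<integral>\<^sup>+x. f x ^ ?n \<partial>lborel) \<noteq> \<infinity>"
    using fin by (auto simp: norm_n_def ennreal_root_def)
  have "AE x in lborel. f x ^ ?n \<noteq> \<infinity>"
    by (rule nn_integral_PInf_AE[OF _ Ffin]) measurable
  then have fg: "AE x in lborel. f x = ennreal (g x)"
  proof eventually_elim
    case (elim x)
    then have "f x \<noteq> \<infinity>" using n by (auto simp: power_eq_top_ennreal)
    then show ?case by (simp add: g_def less_top)
  qed
  have F: "(\<integral>\<^sup>+x. f x ^ ?n \<partial>lborel) = (\<integral>\<^sup>+x. ennreal (g x ^ ?n) \<partial>lborel)"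
    using fg by (intro nn_integral_cong_AE) (auto elim!: eventually_mono simp: ennreal_power nonneg)
  have int: "integrable lborel (\<lambda>x. g x ^ ?n)"
    using Ffin nonneg unfolding F by (intro integrableI_nonneg) (auto simp: less_top)
  define N where "N = (LINT x|lborel. g x ^ ?n)"
  have N0: "N \<ge> 0" unfolding N_def by (intro integral_nonneg_AE AE_I2 zero_le_power nonneg)
  have FN: "(\<integral>\<^sup>+x. ennreal (g x ^ ?n) \<partial>lborel) = ennreal N"
    unfolding N_def by (rule nn_integral_eq_integral[OF int]) (simp add: nonneg)
  have norm: "norm_n f = ennreal (root ?n N)"
    using F FN N0 by (simp add: norm_n_def ennreal_root_def)
  let ?Q = "quermassintegral_fun (?n - 1) f"
  have Q: "?Q = ennreal (?k / root ?n ?k * root ?n N)"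
  proof -
    have "ennreal (?k / 2) * mean_width f = ennreal (?k / 2) * ennreal (2 / ?k) * ?Q"
      by (simp add: mean_width_def mult.assoc)
    also have "ennreal (?k / 2) * ennreal (2 / ?k) = 1"
      using k by (simp add: ennreal_mult'[symmetric])
    finally have "?Q = ennreal (?k / 2) * mean_width f" by simp
    also have "\<dots> = ennreal (?k / 2 * (2 * (1 / root ?n ?k) * root ?n N))"
      unfolding eq norm bound_constant[OF n k] using k N0 by (simp add: ennreal_mult'[symmetric])
    also have "?k / 2 * (2 * (1 / root ?n ?k) * root ?n N) = ?k / root ?n ?k * root ?n N" by simp
    finally show ?thesis .
  qed
  have lev: "compact (?L t)" "convex (?L t)" if "t > 0" for t
    using that by (auto intro!: Qn_superlevel[OF f])
  have mq0: "mean_quermass (?L t) \<ge> 0" if "t > 0" for t by (rule mean_quermass_nonneg[OF lev[OF that]])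
  have Qmeas [measurable]: "(\<lambda>t. ennreal (mean_quermass (?L t)) * indicator {0<..} t) \<in> borel_measurable borel"
    by (rule mean_quermass_superlevel_measurable[OF f])
  have vol: "measure lborel {x. t \<le> g x} = vol (?L t)" if "t > 0" for t
  proof -
    have "AE x in lborel. (x \<in> {x. t \<le> g x}) = (x \<in> ?L t)"
      using fg by eventually_elim (use that in \<open>auto simp: ennreal_le_iff nonneg\<close>)
    then show ?thesis by (intro measure_eq_AE) (auto, measurable)
  qed
  show "AE t in lborel. t > 0 \<longrightarrow> mean_quermass (?L t) = ?k * vol_radius (?L t)"
    and "(AE x in lborel. f x = 0) \<or>
      (\<exists>t l. t > 0 \<and> l > 0 \<and> vol (?L t) > 0 \<and> mean_quermass (?L t) = ?k * vol_radius (?L t) \<and>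
        (AE x in lborel. f x = ennreal l * indicator (?L t) x))"
  proof (atomize (full), cases "N = 0")
    case True
    then have "?Q = 0" using Q by simp
    then have "AE t in lborel. ennreal (mean_quermass (?L t)) * indicator {0<..} t = 0"
      unfolding quermassintegral_fun_def by (subst (asm) nn_integral_0_iff_AE) (use Qmeas in simp_all)
    then have "AE t in lborel. t > 0 \<longrightarrow> mean_quermass (?L t) = ?k * vol_radius (?L t)"
    proof eventually_elim
      case (elim t)
      show ?case
      proof
        assume t: "t > 0"
        then have "mean_quermass (?L t) = 0" using elim mq0[OF t] by (simp add: ennreal_eq_0_iff)
        moreover have "?k * vol_radius (?L t) \<ge> 0" using k vol_radius_nonneg[of "?L t"] by simp
        ultimately show "mean_quermass (?L t) = ?k * vol_radius (?L t)" using urysohn[OF lev[OF t]] by linarith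
      qed
    qed
    moreover have "AE x in lborel. f x = 0"
    proof -
      have "(\<integral>\<^sup>+x. f x ^ ?n \<partial>lborel) = 0" using F FN True by simp
      then have "AE x in lborel. f x ^ ?n = 0" by (subst (asm) nn_integral_0_iff_AE) auto
      then show ?thesis by eventually_elim simp
    qed
    ultimately show "(AE t in lborel. t > 0 \<longrightarrow> mean_quermass (?L t) = ?k * vol_radius (?L t)) \<and>
      ((AE x in lborel. f x = 0) \<or>
      (\<exists>t l. t > 0 \<and> l > 0 \<and> vol (?L t) > 0 \<and> mean_quermass (?L t) = ?k * vol_radius (?L t) \<and>
        (AE x in lborel. f x = ennreal l * indicator (?L t) x)))" by blast
  next
    case False
    then have N: "N > 0" using N0 by simp
    let ?R = "root ?n N"
    have R: "?R > 0" using N by simp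
    have RR: "?R ^ (?n - 1) * ?R = N" using power_minus_mult[OF n, of ?R] N by simp
    \<comment> \<open>Multiplied by \<open>C\<close>, Urysohn's inequality has the bound of
      \<open>superlevel_moment_bound\<close> as its smaller side.\<close>
    define C where "C = ?R ^ (?n - 1) * (root ?n ?k / ?k)"
    have C: "C > 0" unfolding C_def using R k by simp
    define H where "H = (\<lambda>t. \<integral>\<^sup>+x. ennreal (g x ^ (?n - 1)) * indicator {x. t \<le> g x} x \<partial>lborel)"
    have [measurable]: "H \<in> borel_measurable borel"
      unfolding H_def by measurable
    have bound1: "H t \<le> ennreal (?R ^ (?n - 1) * root ?n (vol (?L t)))" if "t > 0" for t
      using superlevel_moment_bound(1)[OF g nonneg n int N[unfolded N_def] that]
      unfolding vol[OF that] H_def N_def .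
    have split: "?R ^ (?n - 1) * root ?n (vol (?L t)) = C * (?k * vol_radius (?L t))" for t
      using k by (simp add: root_vol_eq C_def)
    have bound2: "?R ^ (?n - 1) * root ?n (vol (?L t)) \<le> C * mean_quermass (?L t)" if "t > 0" for t
      unfolding split using C by (intro mult_left_mono urysohn lev that) auto
    have "AE t in lborel. H t * indicator {0<..} t = ennreal C * (ennreal (mean_quermass (?L t)) * indicator {0<..} t)"
    proof (rule nn_integral_eq_imp_AE_eq)
      show "H t * indicator {0<..} t \<le> ennreal C * (ennreal (mean_quermass (?L t)) * indicator {0<..} t)" for t
      proof (cases "t > 0")
        case True
        have "H t \<le> ennreal (C * mean_quermass (?L t))"
          using bound1[OF True] ennreal_leI[OF bound2[OF True]] by (rule order_trans)
        then show ?thesis using True C by (simp add: ennreal_mult')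
      qed simp
      have HN: "(\<integral>\<^sup>+t. H t * indicator {0<..} t \<partial>lborel) = ennreal N"
        using layer_cake_power[OF g nonneg n] FN by (simp add: H_def)
      then show "(\<integral>\<^sup>+t. H t * indicator {0<..} t \<partial>lborel) \<noteq> \<infinity>" by simp
      have "(\<integral>\<^sup>+t. ennreal C * (ennreal (mean_quermass (?L t)) * indicator {0<..} t) \<partial>lborel) = ennreal C * ?Q"
        unfolding quermassintegral_fun_def by (rule nn_integral_cmult) measurable
      also have "\<dots> = ennreal (C * (?k / root ?n ?k * ?R))"
        unfolding Q using C k R by (intro ennreal_mult'[symmetric]) auto
      also have "C * (?k / root ?n ?k * ?R) = ?R ^ (?n - 1) * ?R" using k by (simp add: C_def)
      finally show "(\<integral>\<^sup>+t. H t * indicator {0<..} t \<partial>lborel)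
        = (\<integral>\<^sup>+t. ennreal C * (ennreal (mean_quermass (?L t)) * indicator {0<..} t) \<partial>lborel)"
        using HN RR by simp
    qed measurable
    then have good: "AE t in lborel. t > 0 \<longrightarrow> mean_quermass (?L t) = ?k * vol_radius (?L t) \<and>
       H t = ennreal (?R ^ (?n - 1) * root ?n (vol (?L t)))"
    proof eventually_elim
      case (elim t)
      show ?case
      proof
        assume t: "t > 0"
        then have Heq: "H t = ennreal (C * mean_quermass (?L t))"
          using elim C by (simp add: ennreal_mult')
        then have "ennreal (C * mean_quermass (?L t)) \<le> ennreal (?R ^ (?n - 1) * root ?n (vol (?L t)))"
          using bound1[OF t] by simp
        moreover have "0 \<le> ?R ^ (?n - 1) * root ?n (vol (?L t))" using R by simp
        ultimately have "C * mean_quermass (?L t) \<le> ?R ^ (?n - 1) * root ?n (vol (?L t))"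
          by (simp only: ennreal_le_iff)
        then have same: "C * mean_quermass (?L t) = ?R ^ (?n - 1) * root ?n (vol (?L t))"
          using bound2[OF t] by linarith
        then have "C * mean_quermass (?L t) = C * (?k * vol_radius (?L t))" unfolding split .
        then have "mean_quermass (?L t) = ?k * vol_radius (?L t)" using C by (metis less_irrefl mult_left_cancel)
        then show "mean_quermass (?L t) = ?k * vol_radius (?L t) \<and>
          H t = ennreal (?R ^ (?n - 1) * root ?n (vol (?L t)))"
          using Heq same by simp
      qed
    qed
    \<comment> \<open>If almost every level were null, \<open>H\<close> would vanish almost
      everywhere and its integral \<open>N\<close> would be 0.\<close>
    have "\<exists>t>0. vol (?L t) > 0 \<and> mean_quermass (?L t) = ?k * vol_radius (?L t) \<and>
       H t = ennreal (?R ^ (?n - 1) * root ?n (vol (?L t)))"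
    proof (rule ccontr)
      assume none: "\<not> ?thesis"
      have "AE t in lborel. H t * indicator {0<..} t = 0"
        using good
      proof eventually_elim
        case (elim t)
        show ?case
        proof (cases "t > 0")
          case True
          then have "vol (?L t) = 0" using none elim by (auto simp: zero_less_measure_iff)
          then show ?thesis using elim True by simp
        qed simp
      qed
      then have "(\<integral>\<^sup>+t. H t * indicator {0<..} t \<partial>lborel) = 0"
        by (subst nn_integral_0_iff_AE) auto
      then show False using layer_cake_power[OF g nonneg n] FN N by (simp add: H_def)
    qed
    then obtain t where t: "t > 0" "vol (?L t) > 0" "mean_quermass (?L t) = ?k * vol_radius (?L t)"
       "H t = ennreal (?R ^ (?n - 1) * root ?n (vol (?L t)))" by blast
    have "\<exists>l>0. AE x in lborel. g x = l * indicator {x. t \<le> g x} x"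
      using superlevel_moment_bound(2)[OF g nonneg n int N[unfolded N_def] t(1) n2] t(2,4)
      unfolding vol[OF t(1)] H_def N_def by blast
    then obtain l where l: "l > 0" "AE x in lborel. g x = l * indicator {x. t \<le> g x} x" by blast
    have "AE x in lborel. f x = ennreal l * indicator (?L t) x"
      using l(2) fg
    proof eventually_elim
      case (elim x)
      have "t \<le> g x \<longleftrightarrow> ennreal t \<le> f x" using elim(2) by (simp add: ennreal_le_iff nonneg)
      then have "indicator {x. t \<le> g x} x = (indicator (?L t) x :: real)" by (simp only: indicator_def mem_Collect_eq)
      then have "f x = ennreal (l * indicator (?L t) x)" using elim by metis
      also have "\<dots> = ennreal l * indicator (?L t) x" by (simp only: indicator_def) simp
      finally show ?case .
    qed
    then have "\<exists>t l. t > 0 \<and> l > 0 \<and> vol (?L t) > 0 \<and> mean_quermass (?L t) = ?k * vol_radius (?L t) \<and>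
        (AE x in lborel. f x = ennreal l * indicator (?L t) x)"
      using t l(1) by blast
    then show "(AE t in lborel. t > 0 \<longrightarrow> mean_quermass (?L t) = ?k * vol_radius (?L t)) \<and>
      ((AE x in lborel. f x = 0) \<or>
      (\<exists>t l. t > 0 \<and> l > 0 \<and> vol (?L t) > 0 \<and> mean_quermass (?L t) = ?k * vol_radius (?L t) \<and>
        (AE x in lborel. f x = ennreal l * indicator (?L t) x)))"
      using good by (auto elim: eventually_mono)
  qed
qed

text \<open>A level \<open>t\<close> slightly above \<open>a\<close> contains both points and can be
  chosen with equality in Urysohn's inequality, so it is a ball; since \<open>f \<le> a\<close>
  almost everywhere, it is null and its radius is 0.\<close>

lemma superlevel_singleton_of_null:
  fixes f :: "'a::euclidean_space \<Rightarrow> ennreal"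
  assumes f: "f \<in> Qn"
    and levels: "AE t in lborel. t > 0 \<longrightarrow>
      mean_quermass {x. ennreal t \<le> f x} = kappa TYPE('a) * vol_radius {x. ennreal t \<le> f x}"
    and null: "AE x in lborel. f x \<le> ennreal a" and a: "a \<ge> 0"
    and pq: "f p > ennreal a" "f q > ennreal a"
  shows "p = q"
proof -
  obtain b where b: "a < b" "ennreal b \<le> f p" "ennreal b \<le> f q"
  proof -
    have "ennreal a < min (f p) (f q)" using pq by simp
    then obtain z where z: "ennreal a < z" "z < min (f p) (f q)" using dense by blast
    then obtain b where "z = ennreal b" "b \<ge> 0" by (cases z) auto
    then show thesis using that[of b] z a by (auto simp: ennreal_less_iff less_imp_le)
  qed
  obtain t where t: "a < t" "t < b"
    and good: "mean_quermass {x. ennreal t \<le> f x} = kappa TYPE('a) * vol_radius {x. ennreal t \<le> f x}"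
    using AE_greater_interval[OF levels a b(1)] by metis
  let ?L = "{x. ennreal t \<le> f x}"
  have t0: "t > 0" using t a by simp
  have "ennreal t \<le> ennreal b" using t by (intro ennreal_leI) simp
  then have in_L: "p \<in> ?L" "q \<in> ?L" using b order_trans by blast+
  have L: "compact ?L" "convex ?L" "?L \<noteq> {}"
    using t0 in_L by (auto intro!: Qn_superlevel[OF f])
  obtain c r where cr: "r \<ge> 0" "?L = cball c r"
    by (rule urysohn_equality[OF L good])
  have "AE x in lborel. x \<notin> ?L"
    using null
  proof eventually_elim
    case (elim x)
    have "ennreal a < ennreal t" using t a by (simp add: ennreal_less_iff)
    then show ?case using elim by auto
  qed
  then have "emeasure lborel ?L = 0"
    using L(1) by (subst (asm) AE_iff_measurable[of ?L]) (auto simp: borel_compact)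
  then have "vol (cball c r) = 0" using cr(2) by (simp add: measure_def)
  then have "r = 0" using cr(1) by simp
  then show "p = q" using in_L unfolding cr(2) by simp
qed

text \<open>If \<open>f\<close> vanishes almost everywhere, at most one point has a positive value
  and the ball degenerates to it. Otherwise \<open>f\<close> is \<open>l\<close> times the indicator
  of a ball almost everywhere, and the compact convex levels make this exact up to a single point
  where \<open>f\<close> may exceed \<open>l\<close>.\<close>

lemma mean_width_equality_imp_ball:
  fixes f :: "'a::euclidean_space \<Rightarrow> ennreal"
  assumes f: "f \<in> Qn" and n2: "DIM('a) \<ge> 2" and fin: "norm_n f \<noteq> \<infinity>"
    and eq: "mean_width f = ennreal (2 * kappa TYPE('a) powr (- 1 / real DIM('a))) * norm_n f"
  shows "\<exists>x r p (c::ennreal). r \<ge> 0 \<and> c > 0 \<and> p \<in> cball x r \<and> f p \<ge> c \<and>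
              (\<forall>y. y \<noteq> p \<longrightarrow> f y = c * indicator (cball x r) y)"
proof -
  note levels = mean_width_equality_levels(1)[OF f n2 fin eq]
  from mean_width_equality_levels(2)[OF f n2 fin eq] show ?thesis
  proof
    assume "AE x in lborel. f x = 0"
    then have null: "AE x in lborel. f x \<le> ennreal 0" by eventually_elim simp
    obtain p where p: "f p \<noteq> 0" using f by (auto simp: Qn_def fun_eq_iff)
    have "f y = 0" if "y \<noteq> p" for y
      using superlevel_singleton_of_null[OF f levels null order_refl, of y p] that p
      by (auto simp: zero_less_iff_neq_zero)
    then show ?thesis
      using p by (intro exI[of _ p] exI[of _ 0] exI[of _ "f p"]) (auto simp: zero_less_iff_neq_zero)
  next
    assume "\<exists>t l. t > 0 \<and> l > 0 \<and> vol {x. ennreal t \<le> f x} > 0 \<and>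
        mean_quermass {x. ennreal t \<le> f x} = kappa TYPE('a) * vol_radius {x. ennreal t \<le> f x} \<and>
        (AE x in lborel. f x = ennreal l * indicator {x. ennreal t \<le> f x} x)"
    then obtain t l where t: "t > 0" and l: "l > 0" and pos: "vol {x. ennreal t \<le> f x} > 0"
      and good: "mean_quermass {x. ennreal t \<le> f x} = kappa TYPE('a) * vol_radius {x. ennreal t \<le> f x}"
      and ae: "AE x in lborel. f x = ennreal l * indicator {x. ennreal t \<le> f x} x"
      by blast
    have ne: "{x. ennreal t \<le> f x} \<noteq> {}" using pos by (metis less_irrefl measure_empty)
    have L: "compact {x. ennreal t \<le> f x}" "convex {x. ennreal t \<le> f x}"
      using t by (auto intro!: Qn_superlevel[OF f])
    obtain x r where xr: "r \<ge> 0" "{x. ennreal t \<le> f x} = cball x r"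
      by (rule urysohn_equality[OF L ne good])
    have r: "r > 0" using pos unfolding xr(2) by simp
    have ball: "compact (cball x r)" "convex (cball x r)" "interior (cball x r) \<noteq> {}"
      using r by auto
    have ae': "AE y in lborel. f y = ennreal l * indicator (cball x r) y" using ae unfolding xr(2) .
    have ge: "ennreal l \<le> f y" if "y \<in> cball x r" for y
    proof -
      let ?U = "{y. ennreal l \<le> f y} \<inter> cball x r"
      have U: "compact ?U" using l by (intro compact_Int Qn_superlevel[OF f]) auto
      have "AE y in lborel. (y \<in> cball x r) = (y \<in> ?U)"
        using ae' by eventually_elim (auto simp: indicator_def)
      then have "vol (cball x r) = vol ?U"
        using U by (intro measure_eq_AE) (auto simp: borel_compact)
      then have "?U = cball x r"
        by (intro convex_full_measure_subset[OF ball U]) auto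
      then show ?thesis using that by blast
    qed
    have zero: "f y = 0" if y: "y \<notin> cball x r" for y
    proof (rule ccontr)
      assume "f y \<noteq> 0"
      \<comment> \<open>The minimum with \<open>l\<close> puts both \<open>y\<close> and the whole
        ball into the level at \<open>s\<close>; this level has the volume of the ball, hence is the
        ball.\<close>
      define s where "s = min (f y) (ennreal l)"
      have s: "s > 0" using \<open>f y \<noteq> 0\<close> l by (simp add: s_def zero_less_iff_neq_zero)
      let ?C = "{y. s \<le> f y}"
      have C: "compact ?C" "convex ?C" using s by (auto intro!: Qn_superlevel[OF f])
      have sub: "cball x r \<subseteq> ?C" using ge by (auto simp: s_def min_le_iff_disj)
      have "interior ?C \<noteq> {}" using interior_mono[OF sub] ball(3) by blast
      have "AE y in lborel. (y \<in> ?C) = (y \<in> cball x r)"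
        using ae'
      proof eventually_elim
        case (elim y)
        then show ?case using s sub by (cases "y \<in> cball x r") auto
      qed
      then have "vol ?C = vol (cball x r)"
        using C by (intro measure_eq_AE) (auto simp: borel_compact)
      then have "cball x r = ?C"
        by (intro convex_full_measure_subset[OF C \<open>interior ?C \<noteq> {}\<close> ball(1) sub]) simp
      moreover have "y \<in> ?C" by (simp add: s_def)
      ultimately show False using y by blast
    qed
    have null: "AE y in lborel. f y \<le> ennreal l"
      using ae' by eventually_elim (simp add: indicator_def)
    obtain p where p: "p \<in> cball x r" "\<And>y. y \<in> cball x r \<Longrightarrow> y \<noteq> p \<Longrightarrow> f y \<le> ennreal l"
    proof (cases "\<exists>p\<in>cball x r. f p > ennreal l")
      case True
      then obtain p where p: "p \<in> cball x r" "f p > ennreal l" by blast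
      have "f y \<le> ennreal l" if "y \<noteq> p" for y
        using superlevel_singleton_of_null[OF f levels null less_imp_le[OF l] p(2), of y] that
        by (auto simp: not_less[symmetric])
      then show thesis using that p(1) by blast
    next
      case False
      then show thesis using that[of x] r by (auto simp: not_less)
    qed
    have "f y = ennreal l * indicator (cball x r) y" if "y \<noteq> p" for y
      using zero ge p(2) that by (cases "y \<in> cball x r") (auto intro: antisym)
    then show ?thesis
      using r l p(1) ge[OF p(1)]
      by (intro exI[of _ x] exI[of _ r] exI[of _ p] exI[of _ "ennreal l"]) auto
  qed
qed

theorem corollary6p3:
  fixes f :: "'a::euclidean_space \<Rightarrow> ennreal"
  assumes "f \<in> Qn"
  shows "let bound = ennreal (2 * kappa TYPE('a) powr (- 1 / real DIM('a))) * norm_n f in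
     mean_width f \<ge> bound \<and>
     ((\<exists>x r. r \<ge> 0 \<and> f = indicator (cball x r)) \<longrightarrow> mean_width f = bound) \<and>
     (DIM('a) \<ge> 2 \<and> norm_n f \<noteq> \<infinity> \<longrightarrow>
        (mean_width f = bound \<longleftrightarrow>
           (\<exists>x r p (c::ennreal). r \<ge> 0 \<and> c > 0 \<and> p \<in> cball x r \<and> f p \<ge> c \<and>
              (\<forall>y. y \<noteq> p \<longrightarrow> f y = c * indicator (cball x r) y))))"
  unfolding Let_def
proof (intro conjI impI)
  let ?bound = "ennreal (2 * kappa TYPE('a) powr (- 1 / real DIM('a))) * norm_n f"
  show "?bound \<le> mean_width f" by (rule mean_width_ge[OF assms])
  show "mean_width f = ?bound" if ball: "\<exists>x r. r \<ge> 0 \<and> f = indicator (cball x r)"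
  proof -
    obtain x r where "r \<ge> 0" "f = indicator (cball x r)" using ball by blast
    then show ?thesis
      by (intro mean_width_scaled_ball[where c = 1 and p = x and x = x and r = r]) auto
  qed
  assume n: "DIM('a) \<ge> 2 \<and> norm_n f \<noteq> \<infinity>"
  show "mean_width f = ?bound \<longleftrightarrow>
           (\<exists>x r p (c::ennreal). r \<ge> 0 \<and> c > 0 \<and> p \<in> cball x r \<and> f p \<ge> c \<and>
              (\<forall>y. y \<noteq> p \<longrightarrow> f y = c * indicator (cball x r) y))"
  proof
    assume "mean_width f = ?bound"
    then show "\<exists>x r p (c::ennreal). r \<ge> 0 \<and> c > 0 \<and> p \<in> cball x r \<and> f p \<ge> c \<and>
              (\<forall>y. y \<noteq> p \<longrightarrow> f y = c * indicator (cball x r) y)"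
      using mean_width_equality_imp_ball assms n by blast
  next
    assume "\<exists>x r p (c::ennreal). r \<ge> 0 \<and> c > 0 \<and> p \<in> cball x r \<and> f p \<ge> c \<and>
              (\<forall>y. y \<noteq> p \<longrightarrow> f y = c * indicator (cball x r) y)"
    then obtain x r p and c :: ennreal where *: "r \<ge> 0" "c > 0" "p \<in> cball x r" "f p \<ge> c"
      "\<And>y. y \<noteq> p \<Longrightarrow> f y = c * indicator (cball x r) y" by blast
    \<comment> \<open>An infinite value on a ball of positive radius would make the norm
      infinite.\<close>
    have "r = 0 \<or> c \<noteq> \<infinity>"
    proof (rule ccontr)
      assume neg: "\<not> (r = 0 \<or> c \<noteq> \<infinity>)"
      have "(\<integral>\<^sup>+y. \<infinity> * indicator (cball x r) y \<partial>lborel) \<le> (\<integral>\<^sup>+y. f y ^ DIM('a) \<partial>lborel)"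
      proof (rule nn_integral_mono)
        fix y
        show "\<infinity> * indicator (cball x r) y \<le> f y ^ DIM('a)"
          using neg *(4) *(5)[of y] by (cases "y = p") (auto simp: indicator_def top_unique)
      qed
      moreover have "(\<integral>\<^sup>+y. \<infinity> * indicator (cball x r) y \<partial>lborel) = \<infinity> * emeasure lborel (cball x r)"
        by (rule nn_integral_cmult_indicator) simp
      moreover have "emeasure lborel (cball x r) \<noteq> 0"
        using neg *(1) content_cball_gt_0_iff[of x r] by (auto simp: measure_def)
      ultimately have "(\<integral>\<^sup>+y. f y ^ DIM('a) \<partial>lborel) = \<infinity>"
        by (simp add: ennreal_top_mult top_unique)
      then show False using n by (simp add: norm_n_def ennreal_root_def)
    qed
    then show "mean_width f = ?bound" by (intro mean_width_scaled_ball[OF *]) auto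
  qed
qed

end
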